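(* Let $N\to M$ be a D2 extension of rings, $R=C_M(N)$, $A=\mathrm{End}({}_NM_N)$ with its left $R$-bialgebroid structure and $B=(M\otimes_NM)^N$ with its right $R$-bialgebroid structure (see context). Then $B$ is isomorphic, as a right bialgebroid over $R$, to the right bialgebroid dual $A^*$ of $A$ via $$B\to A^*=\mathrm{Hom}(A_R,R_R),\qquad b\mapsto\big(\alpha\mapsto b^1\alpha(b^2)\big).$$ Similarly, $B$ is isomorphic, as a right bialgebroid over $R$, to the left bialgebroid dual ${}^*A$ of $A$ via $$\psi:B\to{}^*A=\mathrm{Hom}({}_RA,{}_RR),\qquad b\mapsto\big(\alpha\mapsto\alpha(b^1)b^2\big).$$
   Context: Rings are unital; a ring extension is a unital ring homomorphism $N\to M$. It is D2 if $M\otimes_NM$ is isomorphic to a direct summand of $\oplus^n\,{}_NM_M$ as an $N$-$M$-bimodule and of $\oplus^m\,{}_MM_N$ as an $M$-$N$-bimodule, for some $n,m\ge1$. $X^N$ denotes the elements of a bimodule $X$ commuting with $N$; $C_M(N)=M^N$; elements of $(M\otimes_NM)^N$ are written $b=b^1\otimes b^2$. Then there is a left D2 quasibasis: finitely many $b_i\in B$, $\beta_i\in A$ with $\sum_ib_i^1\otimes b_i^2\beta_i(m)=m\otimes1$ for all $m\in M$. A bialgebroid over $R$ consists of a ring with ring homomorphisms $s$ from $R$ and $t$ from $R^{op}$ with commuting images, and an $R$-coring structure $(\Delta,\varepsilon)$, subject to compatibility axioms; its $R$-$R$-bimodule structure is $r\cdot a\cdot r'=s(r)t(r')a$ for a left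 bialgebroid and $r\cdot b\cdot r'=b\,t(r)s(r')$ for a right bialgebroid. An isomorphism of bialgebroids over $R$ is a ring isomorphism commuting with $s,t,\Delta,\varepsilon$. Write $\Delta(a)=a_{(1)}\otimes a_{(2)}$. Left bialgebroid $A$: multiplication is composition, $s_A(r)(m)=rm$, $t_A(r)(m)=mr$, $\Delta_A(\alpha)=\sum_i\alpha(-\,b_i^1)b_i^2\otimes_R\beta_i$, $\varepsilon_A(\alpha)=\alpha(1)$. Right bialgebroid $B$: $bb'={b'}^1b^1\otimes b^2{b'}^2$, unit $1\otimes1$, $s_B(r)=1\otimes r$, $t_B(r)=r\otimes1$, $\Delta_B(b)=\sum_ib_i\otimes_R(\beta_i(b^1)\otimes b^2)$, $\varepsilon_B(b)=b^1b^2$. Right dual $A^*$ of a left bialgebroid $A$ with $A_R$ finitely generated projective ($a\cdot r=t_A(r)a$): the group $\mathrm{Hom}(A_R,R_R)$ with evaluation $\langle b,a\rangle$, product $\langle bb',a\rangle=\langle b',s_A(\langle b,a_{(1)}\rangle)a_{(2)}\rangle$, unit $\varepsilon_A$, $\langle s_{A^*}(r),a\rangle=\varepsilon_A(a\,t_A(r))$, $\langle t_{A^*}(r),a\rangle=r\varepsilon_A(a)$, bimodule structure $\langle r\cdot b\cdot r',a\rangle=r\langle b,a\,t_A(r')\rangle$, coproduct determined by $\langle b_{(1)}\cdot\langle b_{(2)},a'\rangle,a\rangle=\langle b,aa'\rangle$, counit $b\mapsto\langle b,1_A\rangle$. Left dual ${}^*A$ of a left bialgebroid $A$ with ${}_RA$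 finitely generated projective ($r\cdot a=s_A(r)a$): the group $\mathrm{Hom}({}_RA,{}_RR)$ with evaluation $[a,b]$, product $[a,bb']=[t_A([a_{(2)},b])a_{(1)},b']$, unit $\varepsilon_A$, $[a,s(r)]=\varepsilon_A(a)r$, $[a,t(r)]=\varepsilon_A(a\,s_A(r))$, bimodule structure $[a,r\cdot b\cdot r']=[a\,s_A(r),b]\,r'$, coproduct determined by $[aa',b]=[a,[a',b_{(1)}]\cdot b_{(2)}]$, counit $b\mapsto[1_A,b]$. *)

theory Defs
  imports
    "HOL-Algebra.Free_Abelian_Groups" "HOL-Algebra.Generated_Groups" "HOL-Algebra.QuotRing"
begin

section \<open>Bimodules\<close>

text \<open>As for \<open>module\<close> in HOL-Algebra, the record extends \<open>ring\<close> only to inherit the additive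
  structure; the fields \<open>mult\<close> and \<open>one\<close> of a bimodule are never used.\<close>

record ('l, 'r, 'x) bimodule = "'x ring" +
  lact :: "'l \<Rightarrow> 'x \<Rightarrow> 'x"
  ract :: "'x \<Rightarrow> 'r \<Rightarrow> 'x"

definition regular_bimodule :: "('a, 'p) ring_scheme \<Rightarrow> ('a, 'a, 'a) bimodule" where
  "regular_bimodule M =
     \<lparr>carrier = carrier M, monoid.mult = (\<otimes>\<^bsub>M\<^esub>), one = \<one>\<^bsub>M\<^esub>,
      ring.zero = \<zero>\<^bsub>M\<^esub>, add = (\<oplus>\<^bsub>M\<^esub>),
      lact = monoid.mult M, ract = monoid.mult M\<rparr>"

definition restrict_scalars ::
  "('l1 \<Rightarrow> 'l) \<Rightarrow> ('r1 \<Rightarrow> 'r) \<Rightarrow> ('l, 'r, 'x) bimodule \<Rightarrow> ('l1, 'r1, 'x) bimodule" where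
  "restrict_scalars f g X =
     \<lparr>carrier = carrier X, monoid.mult = (\<otimes>\<^bsub>X\<^esub>), one = \<one>\<^bsub>X\<^esub>,
      ring.zero = \<zero>\<^bsub>X\<^esub>, add = (\<oplus>\<^bsub>X\<^esub>),
      lact = (\<lambda>l. lact X (f l)), ract = (\<lambda>x r. ract X x (g r))\<rparr>"

definition bimod_power :: "nat \<Rightarrow> ('l, 'r, 'x) bimodule \<Rightarrow> ('l, 'r, nat \<Rightarrow> 'x) bimodule" where
  "bimod_power n X =
     \<lparr>carrier = {..<n} \<rightarrow>\<^sub>E carrier X, monoid.mult = undefined, one = undefined,
      ring.zero = (\<lambda>i\<in>{..<n}. \<zero>\<^bsub>X\<^esub>), add = (\<lambda>u v. \<lambda>i\<in>{..<n}. u i \<oplus>\<^bsub>X\<^esub> v i),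
      lact = (\<lambda>l u. \<lambda>i\<in>{..<n}. lact X l (u i)),
      ract = (\<lambda>u r. \<lambda>i\<in>{..<n}. ract X (u i) r)\<rparr>"

definition bimod_hom ::
  "('l, 'p) ring_scheme \<Rightarrow> ('r, 'q) ring_scheme \<Rightarrow> ('l, 'r, 'x) bimodule \<Rightarrow> ('l, 'r, 'y) bimodule
    \<Rightarrow> ('x \<Rightarrow> 'y) set" where
  "bimod_hom L K X Y =
     {f \<in> carrier X \<rightarrow> carrier Y.
        (\<forall>x\<in>carrier X. \<forall>x'\<in>carrier X. f (x \<oplus>\<^bsub>X\<^esub> x') = f x \<oplus>\<^bsub>Y\<^esub> f x') \<and>
        (\<forall>l\<in>carrier L. \<forall>x\<in>carrier X. f (lact X l x) = lact Y l (f x)) \<and>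
        (\<forall>r\<in>carrier K. \<forall>x\<in>carrier X. f (ract X x r) = ract Y (f x) r)}"

definition bimod_isomorphic ::
  "('l, 'p) ring_scheme \<Rightarrow> ('r, 'q) ring_scheme \<Rightarrow> ('l, 'r, 'x) bimodule \<Rightarrow> ('l, 'r, 'y) bimodule
    \<Rightarrow> bool" where
  "bimod_isomorphic L K X Y \<longleftrightarrow>
     (\<exists>f \<in> bimod_hom L K X Y. bij_betw f (carrier X) (carrier Y))"

definition subbimodule ::
  "('l, 'p) ring_scheme \<Rightarrow> ('r, 'q) ring_scheme \<Rightarrow> 'x set \<Rightarrow> ('l, 'r, 'x) bimodule \<Rightarrow> bool" where
  "subbimodule L K U X \<longleftrightarrow> additive_subgroup U X \<and>
     (\<forall>l\<in>carrier L. \<forall>u\<in>U. lact X l u \<in> U) \<and> (\<forall>r\<in>carrier K. \<forall>u\<in>U. ract X u r \<in> U)"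

definition direct_summand ::
  "('l, 'p) ring_scheme \<Rightarrow> ('r, 'q) ring_scheme \<Rightarrow> 'x set \<Rightarrow> ('l, 'r, 'x) bimodule \<Rightarrow> bool" where
  "direct_summand L K U X \<longleftrightarrow> subbimodule L K U X \<and>
     (\<exists>V. subbimodule L K V X \<and> U <+>\<^bsub>X\<^esub> V = carrier X \<and> U \<inter> V = {\<zero>\<^bsub>X\<^esub>})"

definition iso_to_direct_summand ::
  "('l, 'p) ring_scheme \<Rightarrow> ('r, 'q) ring_scheme \<Rightarrow> ('l, 'r, 'x) bimodule \<Rightarrow> ('l, 'r, 'y) bimodule
    \<Rightarrow> bool" where
  "iso_to_direct_summand L K X Y \<longleftrightarrow>
     (\<exists>U. direct_summand L K U Y \<and> bimod_isomorphic L K X (Y\<lparr>carrier := U\<rparr>))"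

definition commutant :: "('n, 'p) ring_scheme \<Rightarrow> ('n, 'n, 'x) bimodule \<Rightarrow> 'x set" where
  "commutant N X = {x \<in> carrier X. \<forall>n\<in>carrier N. lact X n x = ract X x n}"


section \<open>Tensor products over a noncommutative ring\<close>

text \<open>\<open>X \<otimes>\<^sub>R Y\<close> is the free abelian group on \<open>carrier X \<times> carrier Y\<close> modulo the subgroup generated by
  the usual relators, so its elements are cosets. Only the right action of \<open>R\<close> on \<open>X\<close> and its left
  action on \<open>Y\<close> enter the quotient; the outer actions make it a bimodule.\<close>

type_synonym ('x, 'y) tens = "(('x \<times> 'y) \<Rightarrow>\<^sub>0 int) set"

definition tensor_rel ::
  "('r, 'p) ring_scheme \<Rightarrow> ('l, 'r, 'x) bimodule \<Rightarrow> ('r, 'k, 'y) bimodule \<Rightarrow> ('x, 'y) tens" where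
  "tensor_rel R X Y = generate (free_Abelian_group (carrier X \<times> carrier Y))
     ({frag_of (x \<oplus>\<^bsub>X\<^esub> x', y) - frag_of (x, y) - frag_of (x', y) | x x' y.
         x \<in> carrier X \<and> x' \<in> carrier X \<and> y \<in> carrier Y} \<union>
      {frag_of (x, y \<oplus>\<^bsub>Y\<^esub> y') - frag_of (x, y) - frag_of (x, y') | x y y'.
         x \<in> carrier X \<and> y \<in> carrier Y \<and> y' \<in> carrier Y} \<union>
      {frag_of (ract X x r, y) - frag_of (x, lact Y r y) | x r y.
         x \<in> carrier X \<and> r \<in> carrier R \<and> y \<in> carrier Y})"

definition tensor_grp ::
  "('r, 'p) ring_scheme \<Rightarrow> ('l, 'r, 'x) bimodule \<Rightarrow> ('r, 'k, 'y) bimodule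
    \<Rightarrow> ('x, 'y) tens monoid" where
  "tensor_grp R X Y = free_Abelian_group (carrier X \<times> carrier Y) Mod tensor_rel R X Y"

definition tensor_ab ::
  "('r, 'p) ring_scheme \<Rightarrow> ('l, 'r, 'x) bimodule \<Rightarrow> ('r, 'k, 'y) bimodule
    \<Rightarrow> ('x, 'y) tens ring" where
  "tensor_ab R X Y =
     \<lparr>carrier = carrier (tensor_grp R X Y), monoid.mult = undefined, one = undefined,
      ring.zero = one (tensor_grp R X Y), add = monoid.mult (tensor_grp R X Y)\<rparr>"

definition pure_tensor ::
  "('r, 'p) ring_scheme \<Rightarrow> ('l, 'r, 'x) bimodule \<Rightarrow> ('r, 'k, 'y) bimodule \<Rightarrow> 'x \<Rightarrow> 'y
    \<Rightarrow> ('x, 'y) tens" where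
  "pure_tensor R X Y x y =
     tensor_rel R X Y #>\<^bsub>free_Abelian_group (carrier X \<times> carrier Y)\<^esub> frag_of (x, y)"

text \<open>The value in the abelian group \<open>G\<close> at \<open>z \<in> X \<otimes>\<^sub>R Y\<close> of the map induced by \<open>x \<otimes> y \<mapsto> \<phi> x y\<close>.
  It is meaningful for biadditive \<open>R\<close>-balanced \<open>\<phi>\<close>, when the sum does not depend on how \<open>z\<close> is written
  as a sum of pure tensors. All expressions in the notations \<open>b = b\<^sup>1 \<otimes> b\<^sup>2\<close> and
  \<open>\<Delta> a = a\<^sub>(\<^sub>1\<^sub>) \<otimes> a\<^sub>(\<^sub>2\<^sub>)\<close> are written with it.\<close>

definition tensor_lift ::
  "('r, 'p) ring_scheme \<Rightarrow> ('l, 'r, 'x) bimodule \<Rightarrow> ('r, 'k, 'y) bimodule \<Rightarrow> ('g, 'q) ring_scheme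
    \<Rightarrow> ('x \<Rightarrow> 'y \<Rightarrow> 'g) \<Rightarrow> ('x, 'y) tens \<Rightarrow> 'g" where
  "tensor_lift R X Y G \<phi> z =
     (THE v. \<exists>(k::nat) x y. (\<forall>i<k. x i \<in> carrier X \<and> y i \<in> carrier Y) \<and>
        z = (\<Oplus>\<^bsub>tensor_ab R X Y\<^esub>i\<in>{..<k}. pure_tensor R X Y (x i) (y i)) \<and>
        v = (\<Oplus>\<^bsub>G\<^esub>i\<in>{..<k}. \<phi> (x i) (y i)))"

definition tensor ::
  "('r, 'p) ring_scheme \<Rightarrow> ('l, 'r, 'x) bimodule \<Rightarrow> ('r, 'k, 'y) bimodule
    \<Rightarrow> ('l, 'k, ('x, 'y) tens) bimodule" where
  "tensor R X Y =
     \<lparr>carrier = carrier (tensor_ab R X Y), monoid.mult = undefined, one = undefined,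
      ring.zero = ring.zero (tensor_ab R X Y), add = add (tensor_ab R X Y),
      lact = (\<lambda>l. tensor_lift R X Y (tensor_ab R X Y) (\<lambda>x y. pure_tensor R X Y (lact X l x) y)),
      ract = (\<lambda>z k. tensor_lift R X Y (tensor_ab R X Y) (\<lambda>x y. pure_tensor R X Y x (ract Y y k)) z)\<rparr>"


section \<open>D2 extensions\<close>

definition ring_extension ::
  "('n, 'p) ring_scheme \<Rightarrow> ('m, 'q) ring_scheme \<Rightarrow> ('n \<Rightarrow> 'm) \<Rightarrow> bool" where
  "ring_extension N M \<eta> \<longleftrightarrow> ring N \<and> ring M \<and> \<eta> \<in> ring_hom N M"

abbreviation M_N :: "('m, 'q) ring_scheme \<Rightarrow> ('n \<Rightarrow> 'm) \<Rightarrow> ('m, 'n, 'm) bimodule" where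
  "M_N M \<eta> \<equiv> restrict_scalars id \<eta> (regular_bimodule M)"

abbreviation N_M :: "('m, 'q) ring_scheme \<Rightarrow> ('n \<Rightarrow> 'm) \<Rightarrow> ('n, 'm, 'm) bimodule" where
  "N_M M \<eta> \<equiv> restrict_scalars \<eta> id (regular_bimodule M)"

abbreviation N_M_N :: "('m, 'q) ring_scheme \<Rightarrow> ('n \<Rightarrow> 'm) \<Rightarrow> ('n, 'n, 'm) bimodule" where
  "N_M_N M \<eta> \<equiv> restrict_scalars \<eta> \<eta> (regular_bimodule M)"

text \<open>\<open>M \<otimes>\<^sub>N M\<close> as an \<open>M\<close>-\<open>M\<close>-bimodule, its pure tensors, and its induced maps.\<close>

abbreviation MM ::
  "('n, 'p) ring_scheme \<Rightarrow> ('m, 'q) ring_scheme \<Rightarrow> ('n \<Rightarrow> 'm) \<Rightarrow> ('m, 'm, ('m, 'm) tens) bimodule"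
  where "MM N M \<eta> \<equiv> tensor N (M_N M \<eta>) (N_M M \<eta>)"

abbreviation MM_pure ::
  "('n, 'p) ring_scheme \<Rightarrow> ('m, 'q) ring_scheme \<Rightarrow> ('n \<Rightarrow> 'm) \<Rightarrow> 'm \<Rightarrow> 'm \<Rightarrow> ('m, 'm) tens"
  where "MM_pure N M \<eta> \<equiv> pure_tensor N (M_N M \<eta>) (N_M M \<eta>)"

abbreviation MM_lift ::
  "('n, 'p) ring_scheme \<Rightarrow> ('m, 'q) ring_scheme \<Rightarrow> ('n \<Rightarrow> 'm) \<Rightarrow> ('g, 'u) ring_scheme
    \<Rightarrow> ('m \<Rightarrow> 'm \<Rightarrow> 'g) \<Rightarrow> ('m, 'm) tens \<Rightarrow> 'g"
  where "MM_lift N M \<eta> \<equiv> tensor_lift N (M_N M \<eta>) (N_M M \<eta>)"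

definition D2_extension ::
  "('n, 'p) ring_scheme \<Rightarrow> ('m, 'q) ring_scheme \<Rightarrow> ('n \<Rightarrow> 'm) \<Rightarrow> bool" where
  "D2_extension N M \<eta> \<longleftrightarrow> ring_extension N M \<eta> \<and>
     (\<exists>n\<ge>1. iso_to_direct_summand N M
        (restrict_scalars \<eta> id (MM N M \<eta>)) (bimod_power n (N_M M \<eta>))) \<and>
     (\<exists>m\<ge>1. iso_to_direct_summand M N
        (restrict_scalars id \<eta> (MM N M \<eta>)) (bimod_power m (M_N M \<eta>)))"

definition centralizer_ring ::
  "('n, 'p) ring_scheme \<Rightarrow> ('m, 'q) ring_scheme \<Rightarrow> ('n \<Rightarrow> 'm) \<Rightarrow> ('m, 'q) ring_scheme" where
  "centralizer_ring N M \<eta> = M\<lparr>carrier := commutant N (N_M_N M \<eta>)\<rparr>"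


section \<open>Bialgebroid structures\<close>

text \<open>The structure maps of a bialgebroid on a ring: source, target, coproduct and counit. The
  coproduct takes values in the tensor square over the base with respect to the bimodule structure
  given by \<open>left_bimod\<close> for left and \<open>right_bimod\<close> for right bialgebroids. An isomorphism of
  bialgebroids is a condition on these maps alone.\<close>

record ('r, 'a) bialgebroid = "'a ring" +
  src :: "'r \<Rightarrow> 'a"
  tgt :: "'r \<Rightarrow> 'a"
  coprod :: "'a \<Rightarrow> ('a, 'a) tens"
  counit :: "'a \<Rightarrow> 'r"

definition left_bimod ::
  "('a, 'p) ring_scheme \<Rightarrow> ('r \<Rightarrow> 'a) \<Rightarrow> ('r \<Rightarrow> 'a) \<Rightarrow> ('r, 'r, 'a) bimodule" where
  "left_bimod H s t =
     \<lparr>carrier = carrier H, monoid.mult = (\<otimes>\<^bsub>H\<^esub>), one = \<one>\<^bsub>H\<^esub>,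
      ring.zero = \<zero>\<^bsub>H\<^esub>, add = (\<oplus>\<^bsub>H\<^esub>),
      lact = (\<lambda>r a. s r \<otimes>\<^bsub>H\<^esub> a), ract = (\<lambda>a r. t r \<otimes>\<^bsub>H\<^esub> a)\<rparr>"

definition right_bimod ::
  "('a, 'p) ring_scheme \<Rightarrow> ('r \<Rightarrow> 'a) \<Rightarrow> ('r \<Rightarrow> 'a) \<Rightarrow> ('r, 'r, 'a) bimodule" where
  "right_bimod H s t =
     \<lparr>carrier = carrier H, monoid.mult = (\<otimes>\<^bsub>H\<^esub>), one = \<one>\<^bsub>H\<^esub>,
      ring.zero = \<zero>\<^bsub>H\<^esub>, add = (\<oplus>\<^bsub>H\<^esub>),
      lact = (\<lambda>r b. b \<otimes>\<^bsub>H\<^esub> t r), ract = (\<lambda>b r. b \<otimes>\<^bsub>H\<^esub> s r)\<rparr>"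

abbreviation left_bimod_of :: "('r, 'a) bialgebroid \<Rightarrow> ('r, 'r, 'a) bimodule" where
  "left_bimod_of H \<equiv> left_bimod H (src H) (tgt H)"

abbreviation right_bimod_of :: "('r, 'a) bialgebroid \<Rightarrow> ('r, 'r, 'a) bimodule" where
  "right_bimod_of H \<equiv> right_bimod H (src H) (tgt H)"

text \<open>In the coproduct condition the right-hand side is \<open>(f \<otimes>\<^sub>R f) (\<Delta>\<^sub>B b)\<close>.\<close>

definition right_bialgebroid_iso ::
  "('r, 'p) ring_scheme \<Rightarrow> ('r, 'b) bialgebroid \<Rightarrow> ('r, 'c) bialgebroid \<Rightarrow> ('b \<Rightarrow> 'c) \<Rightarrow> bool" where
  "right_bialgebroid_iso R B C f \<longleftrightarrow>
     f \<in> ring_iso B C \<and>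
     (\<forall>r\<in>carrier R. f (src B r) = src C r) \<and>
     (\<forall>r\<in>carrier R. f (tgt B r) = tgt C r) \<and>
     (\<forall>b\<in>carrier B. coprod C (f b) =
        tensor_lift R (right_bimod_of B) (right_bimod_of B)
          (tensor_ab R (right_bimod_of C) (right_bimod_of C))
          (\<lambda>x y. pure_tensor R (right_bimod_of C) (right_bimod_of C) (f x) (f y)) (coprod B b)) \<and>
     (\<forall>b\<in>carrier B. counit C (f b) = counit B b)"


section \<open>The two duals of a left bialgebroid\<close>

text \<open>Functionals are extensional on \<open>carrier A\<close>. The bimodule structures \<open>right_dual_bimod\<close> and
  \<open>left_dual_bimod\<close> are the ones over which the coproducts of the duals are formed; that the equations characterising
  these coproducts have exactly one solution uses that \<open>A\<close> is finitely generated projective over \<open>R\<close>.\<close>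

definition right_dual_bimod ::
  "('r, 'p) ring_scheme \<Rightarrow> ('r, 'a) bialgebroid \<Rightarrow> ('r, 'r, 'a \<Rightarrow> 'r) bimodule" where
  "right_dual_bimod R A =
     \<lparr>carrier = {f \<in> carrier A \<rightarrow>\<^sub>E carrier R.
        (\<forall>a\<in>carrier A. \<forall>a'\<in>carrier A. f (a \<oplus>\<^bsub>A\<^esub> a') = f a \<oplus>\<^bsub>R\<^esub> f a') \<and>
        (\<forall>a\<in>carrier A. \<forall>r\<in>carrier R. f (tgt A r \<otimes>\<^bsub>A\<^esub> a) = f a \<otimes>\<^bsub>R\<^esub> r)},
      monoid.mult = undefined, one = undefined,
      ring.zero = (\<lambda>a\<in>carrier A. \<zero>\<^bsub>R\<^esub>),
      add = (\<lambda>f g. \<lambda>a\<in>carrier A. f a \<oplus>\<^bsub>R\<^esub> g a),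
      lact = (\<lambda>r f. \<lambda>a\<in>carrier A. r \<otimes>\<^bsub>R\<^esub> f a),
      ract = (\<lambda>f r. \<lambda>a\<in>carrier A. f (a \<otimes>\<^bsub>A\<^esub> tgt A r))\<rparr>"

definition right_dual ::
  "('r, 'p) ring_scheme \<Rightarrow> ('r, 'a) bialgebroid \<Rightarrow> ('r, 'a \<Rightarrow> 'r) bialgebroid" where
  "right_dual R A = (let D = right_dual_bimod R A in
     \<lparr>carrier = carrier D,
      monoid.mult = (\<lambda>f g. \<lambda>a\<in>carrier A.
        g (tensor_lift R (left_bimod_of A) (left_bimod_of A) A
             (\<lambda>a\<^sub>1 a\<^sub>2. src A (f a\<^sub>1) \<otimes>\<^bsub>A\<^esub> a\<^sub>2) (coprod A a))),
      one = (\<lambda>a\<in>carrier A. counit A a),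
      ring.zero = ring.zero D, add = add D,
      src = (\<lambda>r. \<lambda>a\<in>carrier A. counit A (a \<otimes>\<^bsub>A\<^esub> tgt A r)),
      tgt = (\<lambda>r. \<lambda>a\<in>carrier A. r \<otimes>\<^bsub>R\<^esub> counit A a),
      coprod = (\<lambda>f. THE z. z \<in> carrier (tensor_ab R D D) \<and>
        (\<forall>a\<in>carrier A. \<forall>a'\<in>carrier A.
           tensor_lift R D D R (\<lambda>f\<^sub>1 f\<^sub>2. (ract D f\<^sub>1 (f\<^sub>2 a')) a) z = f (a \<otimes>\<^bsub>A\<^esub> a'))),
      counit = (\<lambda>f. f \<one>\<^bsub>A\<^esub>)\<rparr>)"

definition left_dual_bimod ::
  "('r, 'p) ring_scheme \<Rightarrow> ('r, 'a) bialgebroid \<Rightarrow> ('r, 'r, 'a \<Rightarrow> 'r) bimodule" where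
  "left_dual_bimod R A =
     \<lparr>carrier = {f \<in> carrier A \<rightarrow>\<^sub>E carrier R.
        (\<forall>a\<in>carrier A. \<forall>a'\<in>carrier A. f (a \<oplus>\<^bsub>A\<^esub> a') = f a \<oplus>\<^bsub>R\<^esub> f a') \<and>
        (\<forall>a\<in>carrier A. \<forall>r\<in>carrier R. f (src A r \<otimes>\<^bsub>A\<^esub> a) = r \<otimes>\<^bsub>R\<^esub> f a)},
      monoid.mult = undefined, one = undefined,
      ring.zero = (\<lambda>a\<in>carrier A. \<zero>\<^bsub>R\<^esub>),
      add = (\<lambda>f g. \<lambda>a\<in>carrier A. f a \<oplus>\<^bsub>R\<^esub> g a),
      lact = (\<lambda>r f. \<lambda>a\<in>carrier A. f (a \<otimes>\<^bsub>A\<^esub> src A r)),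
      ract = (\<lambda>f r. \<lambda>a\<in>carrier A. f a \<otimes>\<^bsub>R\<^esub> r)\<rparr>"

definition left_dual ::
  "('r, 'p) ring_scheme \<Rightarrow> ('r, 'a) bialgebroid \<Rightarrow> ('r, 'a \<Rightarrow> 'r) bialgebroid" where
  "left_dual R A = (let D = left_dual_bimod R A in
     \<lparr>carrier = carrier D,
      monoid.mult = (\<lambda>f g. \<lambda>a\<in>carrier A.
        g (tensor_lift R (left_bimod_of A) (left_bimod_of A) A
             (\<lambda>a\<^sub>1 a\<^sub>2. tgt A (f a\<^sub>2) \<otimes>\<^bsub>A\<^esub> a\<^sub>1) (coprod A a))),
      one = (\<lambda>a\<in>carrier A. counit A a),
      ring.zero = ring.zero D, add = add D,
      src = (\<lambda>r. \<lambda>a\<in>carrier A. counit A a \<otimes>\<^bsub>R\<^esub> r),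
      tgt = (\<lambda>r. \<lambda>a\<in>carrier A. counit A (a \<otimes>\<^bsub>A\<^esub> src A r)),
      coprod = (\<lambda>f. THE z. z \<in> carrier (tensor_ab R D D) \<and>
        (\<forall>a\<in>carrier A. \<forall>a'\<in>carrier A.
           tensor_lift R D D R (\<lambda>f\<^sub>1 f\<^sub>2. (lact D (f\<^sub>1 a') f\<^sub>2) a) z = f (a \<otimes>\<^bsub>A\<^esub> a'))),
      counit = (\<lambda>f. f \<one>\<^bsub>A\<^esub>)\<rparr>)"


section \<open>The bialgebroids of a D2 extension\<close>

definition End_NMN ::
  "('n, 'p) ring_scheme \<Rightarrow> ('m, 'q) ring_scheme \<Rightarrow> ('n \<Rightarrow> 'm) \<Rightarrow> ('m \<Rightarrow> 'm) ring" where
  "End_NMN N M \<eta> =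
     \<lparr>carrier = bimod_hom N N (N_M_N M \<eta>) (N_M_N M \<eta>) \<inter> extensional (carrier M),
      monoid.mult = compose (carrier M), one = (\<lambda>m\<in>carrier M. m),
      ring.zero = (\<lambda>m\<in>carrier M. \<zero>\<^bsub>M\<^esub>), add = (\<lambda>\<alpha> \<beta>. \<lambda>m\<in>carrier M. \<alpha> m \<oplus>\<^bsub>M\<^esub> \<beta> m)\<rparr>"

definition MMN_ring ::
  "('n, 'p) ring_scheme \<Rightarrow> ('m, 'q) ring_scheme \<Rightarrow> ('n \<Rightarrow> 'm) \<Rightarrow> ('m, 'm) tens ring" where
  "MMN_ring N M \<eta> =
     \<lparr>carrier = commutant N (restrict_scalars \<eta> \<eta> (MM N M \<eta>)),
      monoid.mult = (\<lambda>b b'.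
        MM_lift N M \<eta> (MM N M \<eta>) (\<lambda>x' y'.
          MM_lift N M \<eta> (MM N M \<eta>) (\<lambda>x y. MM_pure N M \<eta> (x' \<otimes>\<^bsub>M\<^esub> x) (y \<otimes>\<^bsub>M\<^esub> y')) b) b'),
      one = MM_pure N M \<eta> \<one>\<^bsub>M\<^esub> \<one>\<^bsub>M\<^esub>,
      ring.zero = \<zero>\<^bsub>MM N M \<eta>\<^esub>, add = add (MM N M \<eta>)\<rparr>"

definition left_D2_quasibasis ::
  "('n, 'p) ring_scheme \<Rightarrow> ('m, 'q) ring_scheme \<Rightarrow> ('n \<Rightarrow> 'm)
    \<Rightarrow> nat \<Rightarrow> (nat \<Rightarrow> ('m, 'm) tens) \<Rightarrow> (nat \<Rightarrow> 'm \<Rightarrow> 'm) \<Rightarrow> bool" where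
  "left_D2_quasibasis N M \<eta> k b \<beta> \<longleftrightarrow>
     (\<forall>i<k. b i \<in> carrier (MMN_ring N M \<eta>) \<and> \<beta> i \<in> carrier (End_NMN N M \<eta>)) \<and>
     (\<forall>m\<in>carrier M.
        (\<Oplus>\<^bsub>MM N M \<eta>\<^esub>i\<in>{..<k}. ract (MM N M \<eta>) (b i) (\<beta> i m)) = MM_pure N M \<eta> m \<one>\<^bsub>M\<^esub>)"

text \<open>The coproducts are computed from a left D2 quasibasis \<open>k, b, \<beta>\<close>.\<close>

definition D2_left_bialgebroid ::
  "('n, 'p) ring_scheme \<Rightarrow> ('m, 'q) ring_scheme \<Rightarrow> ('n \<Rightarrow> 'm)
    \<Rightarrow> nat \<Rightarrow> (nat \<Rightarrow> ('m, 'm) tens) \<Rightarrow> (nat \<Rightarrow> 'm \<Rightarrow> 'm) \<Rightarrow> ('m, 'm \<Rightarrow> 'm) bialgebroid" where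
  "D2_left_bialgebroid N M \<eta> k b \<beta> =
     (let R = centralizer_ring N M \<eta>; E = End_NMN N M \<eta>;
          s = (\<lambda>r. \<lambda>m\<in>carrier M. r \<otimes>\<^bsub>M\<^esub> m); t = (\<lambda>r. \<lambda>m\<in>carrier M. m \<otimes>\<^bsub>M\<^esub> r);
          X = left_bimod E s t
      in \<lparr>carrier = carrier E, monoid.mult = (\<otimes>\<^bsub>E\<^esub>), one = \<one>\<^bsub>E\<^esub>,
      ring.zero = \<zero>\<^bsub>E\<^esub>, add = (\<oplus>\<^bsub>E\<^esub>),
          src = s, tgt = t,
          coprod = (\<lambda>\<alpha>. \<Oplus>\<^bsub>tensor_ab R X X\<^esub>i\<in>{..<k}. pure_tensor R X X
            (\<lambda>m\<in>carrier M. MM_lift N M \<eta> M (\<lambda>x y. \<alpha> (m \<otimes>\<^bsub>M\<^esub> x) \<otimes>\<^bsub>M\<^esub> y) (b i)) (\<beta> i)),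
          counit = (\<lambda>\<alpha>. \<alpha> \<one>\<^bsub>M\<^esub>)\<rparr>)"

definition D2_right_bialgebroid ::
  "('n, 'p) ring_scheme \<Rightarrow> ('m, 'q) ring_scheme \<Rightarrow> ('n \<Rightarrow> 'm)
    \<Rightarrow> nat \<Rightarrow> (nat \<Rightarrow> ('m, 'm) tens) \<Rightarrow> (nat \<Rightarrow> 'm \<Rightarrow> 'm) \<Rightarrow> ('m, ('m, 'm) tens) bialgebroid" where
  "D2_right_bialgebroid N M \<eta> k b \<beta> =
     (let R = centralizer_ring N M \<eta>; E = MMN_ring N M \<eta>;
          s = (\<lambda>r. MM_pure N M \<eta> \<one>\<^bsub>M\<^esub> r); t = (\<lambda>r. MM_pure N M \<eta> r \<one>\<^bsub>M\<^esub>);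
          X = right_bimod E s t
      in \<lparr>carrier = carrier E, monoid.mult = (\<otimes>\<^bsub>E\<^esub>), one = \<one>\<^bsub>E\<^esub>,
      ring.zero = \<zero>\<^bsub>E\<^esub>, add = (\<oplus>\<^bsub>E\<^esub>),
          src = s, tgt = t,
          coprod = (\<lambda>c. \<Oplus>\<^bsub>tensor_ab R X X\<^esub>i\<in>{..<k}. pure_tensor R X X (b i)
            (MM_lift N M \<eta> (MM N M \<eta>) (\<lambda>x y. MM_pure N M \<eta> (\<beta> i x) y) c)),
          counit = MM_lift N M \<eta> M (\<lambda>x y. x \<otimes>\<^bsub>M\<^esub> y)\<rparr>)"

end

theory Submission
  imports Defs
begin

text \<open>Write \<open>\<phi>\<close> and \<open>\<psi>\<close> for the two maps. The two direct summand conditions amount to a left quasibasis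
  \<open>\<Sum>\<^sub>i b\<^sub>i \<beta>\<^sub>i(m) = m \<otimes> 1\<close> and a right quasibasis \<open>\<Sum>\<^sub>j \<gamma>\<^sub>j(m) e\<^sub>j = 1 \<otimes> m\<close>. These say exactly
  that \<open>\<psi>(b\<^sub>i), \<beta>\<^sub>i\<close> is a dual basis of \<open>A\<close> as a left \<open>R\<close>-module and \<open>\<phi>(e\<^sub>j), \<gamma>\<^sub>j\<close> one of \<open>A\<close> as a right
  \<open>R\<close>-module, so the inverses are \<open>f \<mapsto> \<Sum>\<^sub>i b\<^sub>i f(\<beta>\<^sub>i)\<close> for \<open>\<psi>\<close> and \<open>f \<mapsto> \<Sum>\<^sub>j f(\<gamma>\<^sub>j) e\<^sub>j\<close> for \<open>\<phi>\<close>.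
  Multiplicativity and comultiplicativity come from contracting the quasibasis in the coproducts:
  \<open>\<Sum>\<^sub>i \<alpha>(y b\<^sub>i\<^sup>1) b\<^sub>i\<^sup>2 \<beta>\<^sub>i(m) = \<alpha>(y m)\<close>. An element of the tensor square of a dual is determined by its
  pairings with \<open>A \<times> A\<close>, again by the dual bases, which makes the coproduct of the dual unique.\<close>

section \<open>Additive maps and tensor products\<close>

text \<open>\<open>tensor_lift\<close> is a definite description that denotes only for balanced
  maps, so each Sweedler-style computation comes with a balancedness proof and is carried out on
  pure tensors. The left quasibasis is arbitrary, since the theorem quantifies over it, and the
  coproducts of both \<open>A\<close> and \<open>B\<close> are written with it; the right one is any
  that the second summand condition yields. Hence the left quasibasis drives multiplicativity and
  comultiplicativity of both maps and inverts \<psi>, while the right one inverts \<phi> and makes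
  the coproduct of the right dual unique. A further obstacle: the coproduct of a dual lives in a
  tensor square over its explicit bimodule structure, whereas \<open>right_bialgebroid_iso\<close>
  forms that square from source and target by multiplication in the dual. The two are identified by
  transport from \<open>B\<close>: once a map is known to be bijective and multiplicative, every
  functional is the image of some c, and multiplying it by the source or target becomes an outer
  multiplication of c by an element of \<open>R\<close>.\<close>

definition additive_map ::
  "('a, 'p) ring_scheme \<Rightarrow> ('b, 'q) ring_scheme \<Rightarrow> ('a \<Rightarrow> 'b) \<Rightarrow> bool" where
  "additive_map G H h \<longleftrightarrow> (\<forall>x\<in>carrier G. h x \<in> carrier H) \<and>
     (\<forall>x\<in>carrier G. \<forall>y\<in>carrier G. h (x \<oplus>\<^bsub>G\<^esub> y) = h x \<oplus>\<^bsub>H\<^esub> h y)"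

lemma additive_mapI:
  assumes "\<And>x. x \<in> carrier G \<Longrightarrow> h x \<in> carrier H"
    and "\<And>x y. x \<in> carrier G \<Longrightarrow> y \<in> carrier G \<Longrightarrow> h (x \<oplus>\<^bsub>G\<^esub> y) = h x \<oplus>\<^bsub>H\<^esub> h y"
  shows "additive_map G H h"
  using assms by (simp add: additive_map_def)

lemma additive_map_closed: "additive_map G H h \<Longrightarrow> x \<in> carrier G \<Longrightarrow> h x \<in> carrier H"
  by (simp add: additive_map_def)

lemma additive_map_add:
  "additive_map G H h \<Longrightarrow> x \<in> carrier G \<Longrightarrow> y \<in> carrier G \<Longrightarrow> h (x \<oplus>\<^bsub>G\<^esub> y) = h x \<oplus>\<^bsub>H\<^esub> h y"
  by (simp add: additive_map_def)

lemma additive_map_zero: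
  assumes "abelian_group G" "abelian_group H" "additive_map G H h"
  shows "h \<zero>\<^bsub>G\<^esub> = \<zero>\<^bsub>H\<^esub>"
proof -
  interpret G: abelian_group G by fact
  interpret H: abelian_group H by fact
  have c: "h \<zero>\<^bsub>G\<^esub> \<in> carrier H"
    by (rule additive_map_closed[OF assms(3)]) simp
  have "h \<zero>\<^bsub>G\<^esub> \<oplus>\<^bsub>H\<^esub> h \<zero>\<^bsub>G\<^esub> = h \<zero>\<^bsub>G\<^esub>"
    using additive_map_add[OF assms(3), of "\<zero>\<^bsub>G\<^esub>" "\<zero>\<^bsub>G\<^esub>"] by simp
  then show ?thesis using c by (metis H.add.r_cancel_one')
qed

lemma additive_map_finsum:
  assumes "abelian_group G" "abelian_group H" "additive_map G H h" "finite I"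
    and "\<And>i. i \<in> I \<Longrightarrow> x i \<in> carrier G"
  shows "h (\<Oplus>\<^bsub>G\<^esub>i\<in>I. x i) = (\<Oplus>\<^bsub>H\<^esub>i\<in>I. h (x i))"
proof -
  interpret G: abelian_group G by fact
  interpret H: abelian_group H by fact
  show ?thesis
    using assms(4,5)
  proof (induction I rule: finite_induct)
    case empty
    then show ?case using additive_map_zero[OF assms(1-3)] by simp
  next
    case (insert i I)
    have 1: "x \<in> I \<rightarrow> carrier G" "x i \<in> carrier G" using insert.prems by auto
    then have 2: "(\<lambda>i. h (x i)) \<in> I \<rightarrow> carrier H" "h (x i) \<in> carrier H"
      using additive_map_closed[OF assms(3)] by auto
    show ?case
      using 1 2 insert
      by (simp add: G.finsum_insert H.finsum_insert additive_map_add[OF assms(3)] G.finsum_closed)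
  qed
qed

lemma (in abelian_group) finsum_cong_all:
  assumes "\<And>i. i \<in> I \<Longrightarrow> x i = y i" "\<And>i. i \<in> I \<Longrightarrow> y i \<in> carrier G"
  shows "(\<Oplus>i\<in>I. x i) = (\<Oplus>i\<in>I. y i)"
  by (rule finsum_cong') (use assms in auto)

lemma additive_map_compose: "additive_map G H f \<Longrightarrow> additive_map H K g \<Longrightarrow> additive_map G K (\<lambda>x. g (f x))"
  by (simp add: additive_map_def)

lemma additive_map_sum:
  assumes "abelian_group H" "\<And>i. i \<in> I \<Longrightarrow> additive_map G H (h i)"
  shows "additive_map G H (\<lambda>x. \<Oplus>\<^bsub>H\<^esub>i\<in>I. h i x)"
proof (rule additive_mapI)
  interpret H: abelian_group H by fact
  note c = additive_map_closed[OF assms(2)]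
  fix x assume x: "x \<in> carrier G"
  then show "(\<Oplus>\<^bsub>H\<^esub>i\<in>I. h i x) \<in> carrier H" by (intro H.finsum_closed) (simp add: c)
  fix y assume y: "y \<in> carrier G"
  have "(\<Oplus>\<^bsub>H\<^esub>i\<in>I. h i (x \<oplus>\<^bsub>G\<^esub> y)) = (\<Oplus>\<^bsub>H\<^esub>i\<in>I. h i x \<oplus>\<^bsub>H\<^esub> h i y)"
    using x y by (intro H.finsum_cong_all) (simp_all add: additive_map_add[OF assms(2)] c)
  also have "\<dots> = (\<Oplus>\<^bsub>H\<^esub>i\<in>I. h i x) \<oplus>\<^bsub>H\<^esub> (\<Oplus>\<^bsub>H\<^esub>i\<in>I. h i y)"
    using x y by (simp add: H.finsum_addf Pi_def c)
  finally show "(\<Oplus>\<^bsub>H\<^esub>i\<in>I. h i (x \<oplus>\<^bsub>G\<^esub> y)) = \<dots>" .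
qed

section \<open>Tensor products as quotients of free abelian groups\<close>

lemma keys_diff_subset: "Poly_Mapping.keys a \<subseteq> S \<Longrightarrow> Poly_Mapping.keys b \<subseteq> S \<Longrightarrow>
    Poly_Mapping.keys (a - b) \<subseteq> S"
  by (meson Un_least keys_diff order_trans)

lemma keys_add_subset: "Poly_Mapping.keys a \<subseteq> S \<Longrightarrow> Poly_Mapping.keys b \<subseteq> S \<Longrightarrow>
    Poly_Mapping.keys (a + b) \<subseteq> S"
  by (meson Un_least keys_add order_trans)

text \<open>These are the data that the quotient sees: two abelian groups and the inner actions of
  \<open>R\<close>. The locale is used for \<open>M\<close> over \<open>N\<close> and for
  \<open>A\<close>, \<open>B\<close> and both duals over \<open>R\<close>.\<close>

locale tensor_pair =
  fixes R :: "('r, 'p) ring_scheme" and X :: "('l, 'r, 'x) bimodule" and Y :: "('r, 'k, 'y) bimodule"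
  assumes abX: "abelian_group X" and abY: "abelian_group Y"
    and ract_closed: "\<And>x r. x \<in> carrier X \<Longrightarrow> r \<in> carrier R \<Longrightarrow> ract X x r \<in> carrier X"
    and lact_closed: "\<And>y r. y \<in> carrier Y \<Longrightarrow> r \<in> carrier R \<Longrightarrow> lact Y r y \<in> carrier Y"
begin

sublocale X: abelian_group X by (rule abX)
sublocale Y: abelian_group Y by (rule abY)

abbreviation "F \<equiv> free_Abelian_group (carrier X \<times> carrier Y)"
abbreviation "K \<equiv> tensor_rel R X Y"
abbreviation "XY \<equiv> tensor_ab R X Y"
abbreviation "pt \<equiv> pure_tensor R X Y"

definition relators :: "('x \<times> 'y \<Rightarrow>\<^sub>0 int) set" where
  "relators =
     {frag_of (x \<oplus>\<^bsub>X\<^esub> x', y) - frag_of (x, y) - frag_of (x', y) | x x' y.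
         x \<in> carrier X \<and> x' \<in> carrier X \<and> y \<in> carrier Y} \<union>
      {frag_of (x, y \<oplus>\<^bsub>Y\<^esub> y') - frag_of (x, y) - frag_of (x, y') | x y y'.
         x \<in> carrier X \<and> y \<in> carrier Y \<and> y' \<in> carrier Y} \<union>
      {frag_of (ract X x r, y) - frag_of (x, lact Y r y) | x r y.
         x \<in> carrier X \<and> r \<in> carrier R \<and> y \<in> carrier Y}"

lemma relators_closed: "relators \<subseteq> carrier F"
proof
  fix a assume "a \<in> relators"
  from this[unfolded relators_def] show "a \<in> carrier F"
    by (elim UnE CollectE exE conjE) (simp_all add: keys_diff_subset ract_closed lact_closed)
qed

lemma tensor_rel_eq: "K = generate F relators"
  by (simp add: tensor_rel_def relators_def)

lemma subgroup_K: "subgroup K F"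
  unfolding tensor_rel_eq by (rule group.generate_is_subgroup[OF _ relators_closed]) simp

lemma normal_K: "K \<lhd> F"
  by (rule comm_group.normal_iff_subgroup[THEN iffD2, OF abelian_free_Abelian_group subgroup_K])

lemma coset_eqI: "a - b \<in> relators \<Longrightarrow> a \<in> carrier F \<Longrightarrow> b \<in> carrier F \<Longrightarrow> K #>\<^bsub>F\<^esub> a = K #>\<^bsub>F\<^esub> b"
proof -
  assume a: "a - b \<in> relators" "a \<in> carrier F" "b \<in> carrier F"
  have "a - b \<in> K" unfolding tensor_rel_eq by (rule generate.incl[OF a(1)])
  then have "a \<in> K #>\<^bsub>F\<^esub> b"
    unfolding r_coset_def by (intro UN_I[of "a - b"]) auto
  then show ?thesis
    using group.repr_independence[OF group_free_Abelian_group _ a(3) subgroup_K] by metis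
qed

lemma coset_add: "a \<in> carrier F \<Longrightarrow> b \<in> carrier F \<Longrightarrow>
   (K #>\<^bsub>F\<^esub> a) \<oplus>\<^bsub>XY\<^esub> (K #>\<^bsub>F\<^esub> b) = K #>\<^bsub>F\<^esub> (a + b)"
  using normal.rcos_sum[OF normal_K, of a b] by (simp add: tensor_ab_def tensor_grp_def)

lemma coset_closed: "a \<in> carrier F \<Longrightarrow> K #>\<^bsub>F\<^esub> a \<in> carrier XY"
  by (simp add: tensor_ab_def tensor_grp_def carrier_FactGroup)

lemma tensor_grp_comm: "comm_group (F Mod K)"
  by (rule comm_group.abelian_FactGroup[OF abelian_free_Abelian_group subgroup_K])

sublocale XY: abelian_group XY
proof -
  interpret Q: comm_group "F Mod K" by (rule tensor_grp_comm)
  have car: "carrier XY = carrier (F Mod K)" by (simp add: tensor_ab_def tensor_grp_def)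
  have add: "add XY = monoid.mult (F Mod K)" by (simp add: tensor_ab_def tensor_grp_def)
  have zero: "\<zero>\<^bsub>XY\<^esub> = \<one>\<^bsub>F Mod K\<^esub>" by (simp add: tensor_ab_def tensor_grp_def)
  show "abelian_group XY"
  proof (rule abelian_groupI; unfold car add zero)
    fix x assume "x \<in> carrier (F Mod K)"
    then show "\<exists>y\<in>carrier (F Mod K). y \<otimes>\<^bsub>F Mod K\<^esub> x = \<one>\<^bsub>F Mod K\<^esub>"
      by (intro bexI[of _ "inv\<^bsub>F Mod K\<^esub> x"] Q.l_inv Q.inv_closed)
  qed (rule Q.m_closed Q.one_closed Q.m_assoc Q.m_comm Q.l_one; assumption)+
qed

lemma pure_closed [intro, simp]: "x \<in> carrier X \<Longrightarrow> y \<in> carrier Y \<Longrightarrow> pt x y \<in> carrier XY"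
  unfolding pure_tensor_def by (rule coset_closed) simp

lemma pure_add_left:
  assumes "x \<in> carrier X" "x' \<in> carrier X" "y \<in> carrier Y"
  shows "pt (x \<oplus>\<^bsub>X\<^esub> x') y = pt x y \<oplus>\<^bsub>XY\<^esub> pt x' y"
proof -
  have "frag_of (x \<oplus>\<^bsub>X\<^esub> x', y) - (frag_of (x, y) + frag_of (x', y)) \<in> relators"
    using assms unfolding relators_def by (auto simp: diff_diff_eq[symmetric])
  from coset_eqI[OF this] show ?thesis
    using assms unfolding pure_tensor_def
    by (subst coset_add) (simp_all add: keys_add_subset)
qed

lemma pure_add_right:
  assumes "x \<in> carrier X" "y \<in> carrier Y" "y' \<in> carrier Y"
  shows "pt x (y \<oplus>\<^bsub>Y\<^esub> y') = pt x y \<oplus>\<^bsub>XY\<^esub> pt x y'"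
proof -
  have "frag_of (x, y \<oplus>\<^bsub>Y\<^esub> y') - (frag_of (x, y) + frag_of (x, y')) \<in> relators"
    using assms unfolding relators_def by (auto simp: diff_diff_eq[symmetric])
  from coset_eqI[OF this] show ?thesis
    using assms unfolding pure_tensor_def
    by (subst coset_add) (simp_all add: keys_add_subset)
qed

lemma pure_balanced:
  assumes "x \<in> carrier X" "y \<in> carrier Y" "r \<in> carrier R"
  shows "pt (ract X x r) y = pt x (lact Y r y)"
proof -
  have "frag_of (ract X x r, y) - frag_of (x, lact Y r y) \<in> relators"
    using assms unfolding relators_def by auto
  from coset_eqI[OF this] show ?thesis
    using assms unfolding pure_tensor_def by (auto simp: ract_closed lact_closed)
qed

section \<open>Balanced maps and the universal property\<close>

definition balanced :: "('g, 'u) ring_scheme \<Rightarrow> ('x \<Rightarrow> 'y \<Rightarrow> 'g) \<Rightarrow> bool" where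
  "balanced G \<phi> \<longleftrightarrow> (\<forall>x\<in>carrier X. \<forall>y\<in>carrier Y. \<phi> x y \<in> carrier G) \<and>
     (\<forall>x\<in>carrier X. \<forall>x'\<in>carrier X. \<forall>y\<in>carrier Y. \<phi> (x \<oplus>\<^bsub>X\<^esub> x') y = \<phi> x y \<oplus>\<^bsub>G\<^esub> \<phi> x' y) \<and>
     (\<forall>x\<in>carrier X. \<forall>y\<in>carrier Y. \<forall>y'\<in>carrier Y. \<phi> x (y \<oplus>\<^bsub>Y\<^esub> y') = \<phi> x y \<oplus>\<^bsub>G\<^esub> \<phi> x y') \<and>
     (\<forall>x\<in>carrier X. \<forall>y\<in>carrier Y. \<forall>r\<in>carrier R. \<phi> (ract X x r) y = \<phi> x (lact Y r y))"

lemma balancedI: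
  assumes "\<And>x y. x \<in> carrier X \<Longrightarrow> y \<in> carrier Y \<Longrightarrow> \<phi> x y \<in> carrier G"
    and "\<And>x x' y. x \<in> carrier X \<Longrightarrow> x' \<in> carrier X \<Longrightarrow> y \<in> carrier Y \<Longrightarrow>
           \<phi> (x \<oplus>\<^bsub>X\<^esub> x') y = \<phi> x y \<oplus>\<^bsub>G\<^esub> \<phi> x' y"
    and "\<And>x y y'. x \<in> carrier X \<Longrightarrow> y \<in> carrier Y \<Longrightarrow> y' \<in> carrier Y \<Longrightarrow>
           \<phi> x (y \<oplus>\<^bsub>Y\<^esub> y') = \<phi> x y \<oplus>\<^bsub>G\<^esub> \<phi> x y'"
    and "\<And>x y r. x \<in> carrier X \<Longrightarrow> y \<in> carrier Y \<Longrightarrow> r \<in> carrier R \<Longrightarrow>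
           \<phi> (ract X x r) y = \<phi> x (lact Y r y)"
  shows "balanced G \<phi>"
  using assms by (simp add: balanced_def)

lemma balanced_closed: "balanced G \<phi> \<Longrightarrow> x \<in> carrier X \<Longrightarrow> y \<in> carrier Y \<Longrightarrow> \<phi> x y \<in> carrier G"
  by (simp add: balanced_def)

lemma balanced_add_left: "balanced G \<phi> \<Longrightarrow> x \<in> carrier X \<Longrightarrow> x' \<in> carrier X \<Longrightarrow> y \<in> carrier Y \<Longrightarrow>
    \<phi> (x \<oplus>\<^bsub>X\<^esub> x') y = \<phi> x y \<oplus>\<^bsub>G\<^esub> \<phi> x' y"
  by (simp add: balanced_def)

lemma balanced_add_right: "balanced G \<phi> \<Longrightarrow> x \<in> carrier X \<Longrightarrow> y \<in> carrier Y \<Longrightarrow> y' \<in> carrier Y \<Longrightarrow>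
    \<phi> x (y \<oplus>\<^bsub>Y\<^esub> y') = \<phi> x y \<oplus>\<^bsub>G\<^esub> \<phi> x y'"
  by (simp add: balanced_def)

lemma balanced_scalar: "balanced G \<phi> \<Longrightarrow> x \<in> carrier X \<Longrightarrow> y \<in> carrier Y \<Longrightarrow> r \<in> carrier R \<Longrightarrow>
    \<phi> (ract X x r) y = \<phi> x (lact Y r y)"
  by (simp add: balanced_def)

lemma balanced_cong:
  assumes "balanced G \<phi>" "\<And>x y. x \<in> carrier X \<Longrightarrow> y \<in> carrier Y \<Longrightarrow> \<phi>' x y = \<phi> x y"
  shows "balanced G \<phi>'"
  using assms(1) assms(2) ract_closed lact_closed unfolding balanced_def by simp

lemma balanced_pure: "balanced XY pt"
  by (rule balancedI) (auto simp: pure_add_left pure_add_right pure_balanced)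

lemma balanced_comp:
  assumes "balanced G \<phi>" "additive_map G H h"
  shows "balanced H (\<lambda>x y. h (\<phi> x y))"
  using assms by (auto simp: balanced_def additive_map_def)

text \<open>Well-definedness of f \<otimes> g for two maps compatible with the inner actions. It
  gives meaning to the right-hand side of the coproduct condition in
  \<open>right_bialgebroid_iso\<close>.\<close>

lemma balanced_pure_map:
  assumes T': "tensor_pair R X' Y'" and f: "additive_map X X' f" and g: "additive_map Y Y' g"
    and "\<And>x r. x \<in> carrier X \<Longrightarrow> r \<in> carrier R \<Longrightarrow> f (ract X x r) = ract X' (f x) r"
    and "\<And>y r. y \<in> carrier Y \<Longrightarrow> r \<in> carrier R \<Longrightarrow> g (lact Y r y) = lact Y' r (g y)"
  shows "balanced (tensor_ab R X' Y') (\<lambda>x y. pure_tensor R X' Y' (f x) (g y))"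
proof -
  interpret T': tensor_pair R X' Y' by (rule T')
  show ?thesis
    using assms(4,5)
    by (intro balancedI) (simp_all add: additive_map_closed[OF f] additive_map_closed[OF g]
        additive_map_add[OF f] additive_map_add[OF g] T'.pure_add_left T'.pure_add_right T'.pure_balanced)
qed

lemma pure_zero_left: "y \<in> carrier Y \<Longrightarrow> pt \<zero>\<^bsub>X\<^esub> y = \<zero>\<^bsub>XY\<^esub>"
  by (rule additive_map_zero[OF abX XY.abelian_group_axioms]) (auto intro!: additive_mapI simp: pure_add_left)

text \<open>Pure tensors generate additively, without negatives, because 0 = 0 \<otimes> 0 and -(x
  \<otimes> y) = (-x) \<otimes> y; hence neither zero nor negation is a case.\<close>

lemma tensor_induct [consumes 1, case_names pure add]:
  assumes "z \<in> carrier XY"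
    and pure: "\<And>x y. x \<in> carrier X \<Longrightarrow> y \<in> carrier Y \<Longrightarrow> P (pt x y)"
    and add: "\<And>z w. z \<in> carrier XY \<Longrightarrow> w \<in> carrier XY \<Longrightarrow> P z \<Longrightarrow> P w \<Longrightarrow> P (z \<oplus>\<^bsub>XY\<^esub> w)"
  shows "P z"
proof -
  have zero: "P \<zero>\<^bsub>XY\<^esub>"
    using pure[of "\<zero>\<^bsub>X\<^esub>" "\<zero>\<^bsub>Y\<^esub>"] by (simp add: pure_zero_left)
  have pure_minus: "\<ominus>\<^bsub>XY\<^esub> pt x y = pt (\<ominus>\<^bsub>X\<^esub> x) y" if "x \<in> carrier X" "y \<in> carrier Y" for x y
    using that
    by (intro XY.minus_equality) (auto simp: pure_add_left[symmetric] X.l_neg pure_zero_left)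
  have minus_zero: "\<ominus>\<^bsub>XY\<^esub> \<zero>\<^bsub>XY\<^esub> = \<zero>\<^bsub>XY\<^esub>"
    by (rule XY.minus_equality) simp_all
  obtain c where c: "Poly_Mapping.keys c \<subseteq> carrier X \<times> carrier Y" "z = K #>\<^bsub>F\<^esub> c"
    using assms(1) by (auto simp: tensor_ab_def tensor_grp_def carrier_FactGroup)
  \<comment> \<open>Induction in the free abelian group runs over differences, so the claim for a
    coset is carried together with the claim for its negative.\<close>
  have "P (K #>\<^bsub>F\<^esub> c) \<and> P (\<ominus>\<^bsub>XY\<^esub> (K #>\<^bsub>F\<^esub> c))"
  proof (rule free_Abelian_group_induct[OF c(1)])
    have e0: "K #>\<^bsub>F\<^esub> 0 = \<zero>\<^bsub>XY\<^esub>"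
      using coset_add[of 0 0] coset_closed[of 0] by (metis XY.add.r_cancel_one' add_0 carrier_free_Abelian_group_iff keys_zero empty_subsetI)
    show "P (K #>\<^bsub>F\<^esub> 0) \<and> P (\<ominus>\<^bsub>XY\<^esub> (K #>\<^bsub>F\<^esub> 0))"
      unfolding e0 minus_zero using zero by blast
  next
    fix x y
    assume 2: "Poly_Mapping.keys x \<subseteq> carrier X \<times> carrier Y" "Poly_Mapping.keys y \<subseteq> carrier X \<times> carrier Y"
      "P (K #>\<^bsub>F\<^esub> x) \<and> P (\<ominus>\<^bsub>XY\<^esub> (K #>\<^bsub>F\<^esub> x))" "P (K #>\<^bsub>F\<^esub> y) \<and> P (\<ominus>\<^bsub>XY\<^esub> (K #>\<^bsub>F\<^esub> y))"
    have xy: "K #>\<^bsub>F\<^esub> x \<in> carrier XY" "K #>\<^bsub>F\<^esub> y \<in> carrier XY" "K #>\<^bsub>F\<^esub> (x - y) \<in> carrier XY"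
      using 2 by (simp_all add: coset_closed keys_diff_subset)
    have "(K #>\<^bsub>F\<^esub> (x - y)) \<oplus>\<^bsub>XY\<^esub> (K #>\<^bsub>F\<^esub> y) = K #>\<^bsub>F\<^esub> x"
      using 2 by (subst coset_add) (simp_all add: keys_diff_subset)
    then have e: "K #>\<^bsub>F\<^esub> (x - y) = (K #>\<^bsub>F\<^esub> x) \<oplus>\<^bsub>XY\<^esub> (\<ominus>\<^bsub>XY\<^esub> (K #>\<^bsub>F\<^esub> y))"
      using xy by (metis XY.add.inv_solve_right)
    have "\<ominus>\<^bsub>XY\<^esub> (K #>\<^bsub>F\<^esub> (x - y)) = (\<ominus>\<^bsub>XY\<^esub> (K #>\<^bsub>F\<^esub> x)) \<oplus>\<^bsub>XY\<^esub> (K #>\<^bsub>F\<^esub> y)"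
      unfolding e using xy by (simp add: XY.minus_add)
    then show "P (K #>\<^bsub>F\<^esub> (x - y)) \<and> P (\<ominus>\<^bsub>XY\<^esub> (K #>\<^bsub>F\<^esub> (x - y)))"
      unfolding e using add 2 xy by simp
  next
    fix a assume "a \<in> carrier X \<times> carrier Y"
    then obtain x y where xy: "a = (x, y)" "x \<in> carrier X" "y \<in> carrier Y" by auto
    have "K #>\<^bsub>F\<^esub> frag_of a = pt x y" by (simp add: xy pure_tensor_def)
    then show "P (K #>\<^bsub>F\<^esub> frag_of a) \<and> P (\<ominus>\<^bsub>XY\<^esub> (K #>\<^bsub>F\<^esub> frag_of a))"
      using pure xy pure_minus by simp
  qed
  then show ?thesis by (simp add: c(2))
qed

lemma tensor_hom_ext:
  assumes "additive_map XY G f" "additive_map XY G g"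
    and "\<And>x y. x \<in> carrier X \<Longrightarrow> y \<in> carrier Y \<Longrightarrow> f (pt x y) = g (pt x y)"
    and "z \<in> carrier XY"
  shows "f z = g z"
  using assms(4) by (induction z rule: tensor_induct) (simp_all add: assms(3) additive_map_add[OF assms(1)] additive_map_add[OF assms(2)])

text \<open>The index set is an initial segment of the naturals because \<open>tensor_lift\<close>
  quantifies over representations of this form.\<close>

lemma tensor_representation:
  assumes "z \<in> carrier XY"
  shows "\<exists>(k::nat) x y. (\<forall>i<k. x i \<in> carrier X \<and> y i \<in> carrier Y) \<and>
     z = (\<Oplus>\<^bsub>XY\<^esub>i\<in>{..<k}. pt (x i) (y i))"
  using assms
proof (induction z rule: tensor_induct)
  case (pure x y)
  then show ?case
    by (intro exI[of _ 1] exI[of _ "\<lambda>_. x"] exI[of _ "\<lambda>_. y"]) (simp add: lessThan_Suc)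
next
  case (add z w)
  from add.IH(1) obtain k :: nat and x y where
    k: "\<forall>i<k. x i \<in> carrier X \<and> y i \<in> carrier Y" "z = (\<Oplus>\<^bsub>XY\<^esub>i\<in>{..<k}. pt (x i) (y i))"
    by (elim exE conjE)
  from add.IH(2) obtain k' :: nat and x' y' where
    k': "\<forall>i<k'. x' i \<in> carrier X \<and> y' i \<in> carrier Y" "w = (\<Oplus>\<^bsub>XY\<^esub>i\<in>{..<k'}. pt (x' i) (y' i))"
    by (elim exE conjE)
  \<comment> \<open>Concatenation of the two families: the summands of w follow those of z, with
    indices shifted by k.\<close>
  define u where "u i = (if i < k then x i else x' (i - k))" for i
  define v where "v i = (if i < k then y i else y' (i - k))" for i
  have uv: "u i \<in> carrier X \<and> v i \<in> carrier Y" if "i < k + k'" for i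
    using that k k' by (auto simp: u_def v_def)
  have part: "(\<Oplus>\<^bsub>XY\<^esub>i\<in>{..<k + j}. pt (u i) (v i)) =
      z \<oplus>\<^bsub>XY\<^esub> (\<Oplus>\<^bsub>XY\<^esub>i\<in>{..<j}. pt (x' i) (y' i))" if "j \<le> k'" for j
    using that
  proof (induction j)
    case 0
    have "(\<Oplus>\<^bsub>XY\<^esub>i\<in>{..<k}. pt (u i) (v i)) = z"
      unfolding k(2) using k(1) by (intro XY.finsum_cong_all) (auto simp: u_def v_def)
    then show ?case using add.hyps by simp
  next
    case (Suc j)
    have c: "(\<lambda>i. pt (u i) (v i)) \<in> {..<k + j} \<rightarrow> carrier XY" "(\<lambda>i. pt (x' i) (y' i)) \<in> {..<j} \<rightarrow> carrier XY"
      "x' j \<in> carrier X" "y' j \<in> carrier Y"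
      using Suc.prems uv k' by (auto intro!: pure_closed)
    have "(\<Oplus>\<^bsub>XY\<^esub>i\<in>{..<k + Suc j}. pt (u i) (v i)) =
       pt (x' j) (y' j) \<oplus>\<^bsub>XY\<^esub> (\<Oplus>\<^bsub>XY\<^esub>i\<in>{..<k + j}. pt (u i) (v i))"
      using c by (simp add: lessThan_Suc XY.finsum_insert u_def v_def)
    then show ?case
      using Suc c add.hyps by (simp add: lessThan_Suc XY.finsum_insert XY.finsum_closed XY.a_lcomm)
  qed
  show ?case
    using uv part[of k'] k'(2) by (intro exI[of _ "k + k'"] exI[of _ u] exI[of _ v]) simp
qed

text \<open>The homomorphism on the free abelian group that sends (x, y) to \<phi> x y kills every
  relator by balancedness, so it factors through the quotient by \<open>K\<close>.\<close>

lemma tensor_universal: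
  assumes "abelian_group G" "balanced G \<phi>"
  obtains h where "additive_map XY G h"
    "\<And>x y. x \<in> carrier X \<Longrightarrow> y \<in> carrier Y \<Longrightarrow> h (pt x y) = \<phi> x y"
proof -
  interpret G: abelian_group G by fact
  have cg: "comm_group (add_monoid G)" by (rule G.a_comm_group)
  obtain f where f: "f \<in> hom F (add_monoid G)"
     "\<And>a. a \<in> carrier X \<times> carrier Y \<Longrightarrow> f (frag_of a) = case_prod \<phi> a"
    by (rule comm_group.free_Abelian_group_universal[OF cg, of "case_prod \<phi>" "carrier X \<times> carrier Y"])
       (auto simp: balanced_closed[OF assms(2)])
  interpret f: group_hom F "add_monoid G" f
    using f(1) cg by (simp add: group_hom_def group_hom_axioms_def comm_group.axioms)
  have f_diff: "f (a - b) = f a \<oplus>\<^bsub>G\<^esub> \<ominus>\<^bsub>G\<^esub> f b" if "a \<in> carrier F" "b \<in> carrier F" for a b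
    using f.hom_mult[of a "- b"] f.hom_inv[of b] that by (simp add: a_inv_def)
  have fc: "f a \<in> carrier G" if "a \<in> carrier F" for a
    using f.hom_closed[OF that] by simp
  \<comment> \<open>Shape taken by the image of an additivity relator, with u and v the values on
    the two summands.\<close>
  have cancel: "u \<oplus>\<^bsub>G\<^esub> v \<oplus>\<^bsub>G\<^esub> \<ominus>\<^bsub>G\<^esub> u \<oplus>\<^bsub>G\<^esub> \<ominus>\<^bsub>G\<^esub> v = \<zero>\<^bsub>G\<^esub>" if "u \<in> carrier G" "v \<in> carrier G" for u v
  proof -
    have "u \<oplus>\<^bsub>G\<^esub> v \<oplus>\<^bsub>G\<^esub> \<ominus>\<^bsub>G\<^esub> u \<oplus>\<^bsub>G\<^esub> \<ominus>\<^bsub>G\<^esub> v = u \<oplus>\<^bsub>G\<^esub> v \<oplus>\<^bsub>G\<^esub> \<ominus>\<^bsub>G\<^esub> (u \<oplus>\<^bsub>G\<^esub> v)"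
      using that by (simp add: G.minus_add G.a_assoc)
    then show ?thesis using that by (simp add: G.r_neg)
  qed
  note bal = balanced_closed[OF assms(2)] balanced_add_left[OF assms(2)]
          balanced_add_right[OF assms(2)] balanced_scalar[OF assms(2)]
  have "f a = \<zero>\<^bsub>G\<^esub>" if "a \<in> relators" for a
  proof -
    from that[unfolded relators_def] show ?thesis
      by (elim UnE CollectE exE conjE)
         (simp_all add: f_diff f(2) keys_diff_subset bal cancel ract_closed lact_closed G.r_neg)
  qed
  then have "relators \<subseteq> kernel F (add_monoid G) f"
    using relators_closed by (auto simp: kernel_def simp del: carrier_free_Abelian_group_iff)
  then have Kk: "K \<subseteq> kernel F (add_monoid G) f"
    unfolding tensor_rel_eq by (intro group.generate_subgroup_incl f.subgroup_kernel) auto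
  \<comment> \<open>Elements of the same coset differ by an element of \<open>K\<close>, on which f
    vanishes.\<close>
  have "f a = f b" if "a \<in> carrier F" "b \<in> carrier F" "K #>\<^bsub>F\<^esub> a = K #>\<^bsub>F\<^esub> b" for a b
  proof -
    have "a \<in> K #>\<^bsub>F\<^esub> b"
      using that subgroup_K by (metis group.rcos_self group_free_Abelian_group)
    then obtain c where "c \<in> K" "a = c + b" by (auto simp: r_coset_def)
    moreover from this have "f c = \<zero>\<^bsub>G\<^esub>" "c \<in> carrier F" using Kk by (auto simp: kernel_def)
    ultimately show ?thesis using f.hom_mult[of c b] that fc by simp
  qed
  from FactGroup_universal[OF f(1) normal_K this]
  obtain g where g: "g \<in> hom (F Mod K) (add_monoid G)" "\<And>a. a \<in> carrier F \<Longrightarrow> g (K #>\<^bsub>F\<^esub> a) = f a"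
    by metis
  show ?thesis
  proof
    show "additive_map XY G g"
      using g(1) by (auto simp: additive_map_def hom_def tensor_ab_def tensor_grp_def simp del: mult_FactGroup)
    show "g (pt x y) = \<phi> x y" if "x \<in> carrier X" "y \<in> carrier Y" for x y
      using that g(2)[of "frag_of (x, y)"] f(2)[of "(x, y)"] by (simp add: pure_tensor_def)
  qed
qed

section \<open>Calculation with \<open>tensor_lift\<close>\<close>

context
  fixes G :: "('g, 'u) ring_scheme" and \<phi>
  assumes G: "abelian_group G" and bal: "balanced G \<phi>"
begin

abbreviation (input) "L \<equiv> tensor_lift R X Y G"

text \<open>Every representation of the same tensor gives the same sum, namely the value of the map
  from \<open>tensor_universal\<close>; this is what makes the definite description in
  \<open>tensor_lift\<close> denote.\<close>

lemma lift_sum: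
  assumes "\<And>i. i < k \<Longrightarrow> x i \<in> carrier X" "\<And>i. i < k \<Longrightarrow> y i \<in> carrier Y"
  shows "L \<phi> (\<Oplus>\<^bsub>XY\<^esub>i\<in>{..<k::nat}. pt (x i) (y i)) = (\<Oplus>\<^bsub>G\<^esub>i\<in>{..<k}. \<phi> (x i) (y i))"
proof -
  interpret G: abelian_group G by (rule G)
  obtain h where h: "additive_map XY G h"
    "\<And>x y. x \<in> carrier X \<Longrightarrow> y \<in> carrier Y \<Longrightarrow> h (pt x y) = \<phi> x y"
    by (rule tensor_universal[OF G bal]) blast
  have *: "h (\<Oplus>\<^bsub>XY\<^esub>i\<in>{..<k::nat}. pt (x i) (y i)) = (\<Oplus>\<^bsub>G\<^esub>i\<in>{..<k}. \<phi> (x i) (y i))"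
    if "\<forall>i<k. x i \<in> carrier X \<and> y i \<in> carrier Y" for k x y
  proof -
    have "h (\<Oplus>\<^bsub>XY\<^esub>i\<in>{..<k}. pt (x i) (y i)) = (\<Oplus>\<^bsub>G\<^esub>i\<in>{..<k}. h (pt (x i) (y i)))"
      by (rule additive_map_finsum[OF XY.abelian_group_axioms G h(1)]) (use that in auto)
    also have "\<dots> = (\<Oplus>\<^bsub>G\<^esub>i\<in>{..<k}. \<phi> (x i) (y i))"
      by (rule G.finsum_cong_all) (use that h(2) balanced_closed[OF bal] in auto)
    finally show ?thesis .
  qed
  show ?thesis
    unfolding tensor_lift_def
  proof (rule the_equality)
    show "\<exists>(k'::nat) x' y'. (\<forall>i<k'. x' i \<in> carrier X \<and> y' i \<in> carrier Y) \<and>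
        (\<Oplus>\<^bsub>XY\<^esub>i\<in>{..<k}. pt (x i) (y i)) = (\<Oplus>\<^bsub>XY\<^esub>i\<in>{..<k'}. pt (x' i) (y' i)) \<and>
        (\<Oplus>\<^bsub>G\<^esub>i\<in>{..<k}. \<phi> (x i) (y i)) = (\<Oplus>\<^bsub>G\<^esub>i\<in>{..<k'}. \<phi> (x' i) (y' i))"
      using assms by (intro exI[of _ k] exI[of _ x] exI[of _ y]) simp
    fix v
    assume "\<exists>(k'::nat) x' y'. (\<forall>i<k'. x' i \<in> carrier X \<and> y' i \<in> carrier Y) \<and>
        (\<Oplus>\<^bsub>XY\<^esub>i\<in>{..<k}. pt (x i) (y i)) = (\<Oplus>\<^bsub>XY\<^esub>i\<in>{..<k'}. pt (x' i) (y' i)) \<and>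
        v = (\<Oplus>\<^bsub>G\<^esub>i\<in>{..<k'}. \<phi> (x' i) (y' i))"
    then obtain k' :: nat and x' y' where k': "\<forall>i<k'. x' i \<in> carrier X \<and> y' i \<in> carrier Y"
        "(\<Oplus>\<^bsub>XY\<^esub>i\<in>{..<k}. pt (x i) (y i)) = (\<Oplus>\<^bsub>XY\<^esub>i\<in>{..<k'}. pt (x' i) (y' i))"
        "v = (\<Oplus>\<^bsub>G\<^esub>i\<in>{..<k'}. \<phi> (x' i) (y' i))"
      by (elim exE conjE)
    show "v = (\<Oplus>\<^bsub>G\<^esub>i\<in>{..<k}. \<phi> (x i) (y i))"
      unfolding k'(3) *[OF k'(1), symmetric] k'(2)[symmetric] by (rule *) (simp add: assms)
  qed
qed

lemma lift_pure: "x \<in> carrier X \<Longrightarrow> y \<in> carrier Y \<Longrightarrow> L \<phi> (pt x y) = \<phi> x y"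
proof -
  interpret G: abelian_group G by (rule G)
  assume "x \<in> carrier X" "y \<in> carrier Y"
  then show ?thesis
    using lift_sum[of 1 "\<lambda>_. x" "\<lambda>_. y"] balanced_closed[OF bal, of x y] by (simp add: lessThan_Suc)
qed

text \<open>On the carrier \<open>tensor_lift\<close> agrees with the map from
  \<open>tensor_universal\<close> and inherits additivity from it.\<close>

lemma lift_additive: "additive_map XY G (L \<phi>)"
proof -
  obtain h where h: "additive_map XY G h"
    "\<And>x y. x \<in> carrier X \<Longrightarrow> y \<in> carrier Y \<Longrightarrow> h (pt x y) = \<phi> x y"
    by (rule tensor_universal[OF G bal]) blast
  interpret G: abelian_group G by (rule G)
  have "L \<phi> z = h z" if "z \<in> carrier XY" for z
  proof -
    from tensor_representation[OF that]
    obtain k :: nat and x y where k: "\<forall>i<k. x i \<in> carrier X \<and> y i \<in> carrier Y"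
        "z = (\<Oplus>\<^bsub>XY\<^esub>i\<in>{..<k}. pt (x i) (y i))"
      by (elim exE conjE)
    have "h z = (\<Oplus>\<^bsub>G\<^esub>i\<in>{..<k}. h (pt (x i) (y i)))"
      unfolding k(2)
      by (rule additive_map_finsum[OF XY.abelian_group_axioms G h(1)]) (use k in auto)
    also have "\<dots> = (\<Oplus>\<^bsub>G\<^esub>i\<in>{..<k}. \<phi> (x i) (y i))"
      by (rule G.finsum_cong_all) (use k h(2) balanced_closed[OF bal] in auto)
    finally show ?thesis unfolding k(2) using k(1) by (simp add: lift_sum)
  qed
  then show ?thesis using h(1) by (simp add: additive_map_def)
qed

lemma lift_closed: "z \<in> carrier XY \<Longrightarrow> L \<phi> z \<in> carrier G"
  by (rule additive_map_closed[OF lift_additive])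

text \<open>Uniqueness in the universal property: later contractions are identified through it, by
  comparing values on pure tensors.\<close>

lemma lift_eqI:
  assumes "additive_map XY G h" "\<And>x y. x \<in> carrier X \<Longrightarrow> y \<in> carrier Y \<Longrightarrow> h (pt x y) = \<phi> x y"
    "z \<in> carrier XY"
  shows "h z = L \<phi> z"
  by (rule tensor_hom_ext[OF assms(1) lift_additive _ assms(3)]) (simp add: assms(2) lift_pure)

lemma lift_comp:
  assumes "abelian_group H" "additive_map G H h" "z \<in> carrier XY"
  shows "h (L \<phi> z) = tensor_lift R X Y H (\<lambda>x y. h (\<phi> x y)) z"
  using assms(3)
proof (induction z rule: tensor_induct)
  case (pure x y)
  then show ?case
    using tensor_pair.lift_pure[OF tensor_pair_axioms assms(1) balanced_comp[OF bal assms(2)]] by (simp add: lift_pure)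
next
  case (add z w)
  then show ?case
    using tensor_pair.lift_additive[OF tensor_pair_axioms assms(1) balanced_comp[OF bal assms(2)]]
    by (simp add: additive_map_add[OF assms(2)] additive_map_add[OF lift_additive] lift_closed additive_map_add)
qed

end

lemma lift_cong:
  assumes "abelian_group G" "balanced G \<phi>" "z \<in> carrier XY"
    "\<And>x y. x \<in> carrier X \<Longrightarrow> y \<in> carrier Y \<Longrightarrow> \<phi>' x y = \<phi> x y"
  shows "tensor_lift R X Y G \<phi>' z = tensor_lift R X Y G \<phi> z"
proof -
  have b: "balanced G \<phi>'" by (rule balanced_cong[OF assms(2,4)])
  show ?thesis
    by (rule lift_eqI[OF assms(1,2) lift_additive[OF assms(1) b] _ assms(3)])
       (simp add: lift_pure[OF assms(1) b] assms(4))
qed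

lemma lift_id:
  assumes "z \<in> carrier XY"
  shows "tensor_lift R X Y XY pt z = z"
  by (rule lift_eqI[OF XY.abelian_group_axioms balanced_pure, symmetric, of "\<lambda>z. z"])
     (use assms in \<open>auto intro: additive_mapI\<close>)

text \<open>Both sides are additive and agree on pure tensors. It serves to move a sum over a
  quasibasis inside a contraction, where the legs of the tensor are actual elements and the
  quasibasis identity applies.\<close>

lemma lift_finsum:
  assumes "abelian_group G" "finite I" "\<And>i. i \<in> I \<Longrightarrow> balanced G (\<phi> i)" "z \<in> carrier XY"
  shows "tensor_lift R X Y G (\<lambda>x y. \<Oplus>\<^bsub>G\<^esub>i\<in>I. \<phi> i x y) z = (\<Oplus>\<^bsub>G\<^esub>i\<in>I. tensor_lift R X Y G (\<phi> i) z)"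
    and "balanced G (\<lambda>x y. \<Oplus>\<^bsub>G\<^esub>i\<in>I. \<phi> i x y)"
proof -
  interpret G: abelian_group G by fact
  note bc = balanced_closed[OF assms(3)]
  have add: "(\<Oplus>\<^bsub>G\<^esub>i\<in>I. h i) = (\<Oplus>\<^bsub>G\<^esub>i\<in>I. f i) \<oplus>\<^bsub>G\<^esub> (\<Oplus>\<^bsub>G\<^esub>i\<in>I. g i)"
    if "\<And>i. i \<in> I \<Longrightarrow> h i = f i \<oplus>\<^bsub>G\<^esub> g i" "\<And>i. i \<in> I \<Longrightarrow> f i \<in> carrier G" "\<And>i. i \<in> I \<Longrightarrow> g i \<in> carrier G"
    for f g h
  proof -
    have "(\<Oplus>\<^bsub>G\<^esub>i\<in>I. h i) = (\<Oplus>\<^bsub>G\<^esub>i\<in>I. f i \<oplus>\<^bsub>G\<^esub> g i)"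
      by (rule G.finsum_cong_all) (use that in auto)
    then show ?thesis using that by (simp add: G.finsum_addf Pi_def)
  qed
  show b: "balanced G (\<lambda>x y. \<Oplus>\<^bsub>G\<^esub>i\<in>I. \<phi> i x y)"
  proof (rule balancedI)
    fix x x' y assume "x \<in> carrier X" "x' \<in> carrier X" "y \<in> carrier Y"
    then show "(\<Oplus>\<^bsub>G\<^esub>i\<in>I. \<phi> i (x \<oplus>\<^bsub>X\<^esub> x') y) = (\<Oplus>\<^bsub>G\<^esub>i\<in>I. \<phi> i x y) \<oplus>\<^bsub>G\<^esub> (\<Oplus>\<^bsub>G\<^esub>i\<in>I. \<phi> i x' y)"
      by (intro add) (simp_all add: bc balanced_add_left[OF assms(3)])
  next
    fix x y y' assume "x \<in> carrier X" "y' \<in> carrier Y" "y \<in> carrier Y"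
    then show "(\<Oplus>\<^bsub>G\<^esub>i\<in>I. \<phi> i x (y \<oplus>\<^bsub>Y\<^esub> y')) = (\<Oplus>\<^bsub>G\<^esub>i\<in>I. \<phi> i x y) \<oplus>\<^bsub>G\<^esub> (\<Oplus>\<^bsub>G\<^esub>i\<in>I. \<phi> i x y')"
      by (intro add) (simp_all add: bc balanced_add_right[OF assms(3)])
  qed (auto intro!: G.finsum_closed G.finsum_cong_all simp: bc balanced_scalar[OF assms(3)] lact_closed)
  have cl: "tensor_lift R X Y G (\<phi> i) z \<in> carrier G" if "i \<in> I" "z \<in> carrier XY" for i z
    by (rule lift_closed[OF assms(1,3)]) (use that in auto)
  show "tensor_lift R X Y G (\<lambda>x y. \<Oplus>\<^bsub>G\<^esub>i\<in>I. \<phi> i x y) z = (\<Oplus>\<^bsub>G\<^esub>i\<in>I. tensor_lift R X Y G (\<phi> i) z)"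
  proof (rule lift_eqI[OF assms(1) b, symmetric, OF _ _ assms(4)])
    show "additive_map XY G (\<lambda>z. \<Oplus>\<^bsub>G\<^esub>i\<in>I. tensor_lift R X Y G (\<phi> i) z)"
      by (rule additive_map_sum[OF assms(1) lift_additive[OF assms(1,3)]])
    show "(\<Oplus>\<^bsub>G\<^esub>i\<in>I. tensor_lift R X Y G (\<phi> i) (pt x y)) = (\<Oplus>\<^bsub>G\<^esub>i\<in>I. \<phi> i x y)"
      if "x \<in> carrier X" "y \<in> carrier Y" for x y
      by (intro G.finsum_cong_all) (auto simp: that lift_pure[OF assms(1,3)] bc)
  qed
qed

lemma lift_add:
  assumes "abelian_group G" "balanced G \<phi>" "balanced G \<phi>'" "z \<in> carrier XY"
  shows "tensor_lift R X Y G (\<lambda>x y. \<phi> x y \<oplus>\<^bsub>G\<^esub> \<phi>' x y) z =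
      tensor_lift R X Y G \<phi> z \<oplus>\<^bsub>G\<^esub> tensor_lift R X Y G \<phi>' z"
proof -
  interpret G: abelian_group G by fact
  \<comment> \<open>A binary sum is written as a sum over the booleans, so that
    \<open>lift_finsum\<close> covers it.\<close>
  have e: "(\<Oplus>\<^bsub>G\<^esub>b\<in>{True, False}. f b) = f True \<oplus>\<^bsub>G\<^esub> f False"
    if "f True \<in> carrier G" "f False \<in> carrier G" for f
    using that by (simp add: G.finsum_insert)
  have b: "balanced G (if b then \<phi> else \<phi>')" for b using assms by simp
  have c: "tensor_lift R X Y G (\<lambda>x y. \<Oplus>\<^bsub>G\<^esub>b\<in>{True, False}. (if b then \<phi> else \<phi>') x y) z =
     (\<Oplus>\<^bsub>G\<^esub>b\<in>{True, False}. tensor_lift R X Y G (if b then \<phi> else \<phi>') z)"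
    by (rule lift_finsum(1)[OF assms(1) _ b assms(4)]) simp
  have d: "balanced G (\<lambda>x y. \<Oplus>\<^bsub>G\<^esub>b\<in>{True, False}. (if b then \<phi> else \<phi>') x y)"
    by (rule lift_finsum(2)[OF assms(1) _ b assms(4)]) simp
  have "tensor_lift R X Y G (\<lambda>x y. \<phi> x y \<oplus>\<^bsub>G\<^esub> \<phi>' x y) z =
     tensor_lift R X Y G (\<lambda>x y. \<Oplus>\<^bsub>G\<^esub>b\<in>{True, False}. (if b then \<phi> else \<phi>') x y) z"
    by (rule lift_cong[OF assms(1) d assms(4)])
       (subst e, auto simp: balanced_closed[OF assms(2)] balanced_closed[OF assms(3)])
  then show ?thesis
    unfolding c by (subst (asm) e) (auto simp: lift_closed[OF assms(1)] assms)
qed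

end

section \<open>Bimodule maps out of the tensor square of a ring extension\<close>

lemma restrict_scalars_simps [simp]:
  "carrier (restrict_scalars f g X) = carrier X"
  "\<zero>\<^bsub>restrict_scalars f g X\<^esub> = \<zero>\<^bsub>X\<^esub>"
  "add (restrict_scalars f g X) = add X"
  "lact (restrict_scalars f g X) l x = lact X (f l) x"
  "ract (restrict_scalars f g X) x r = ract X x (g r)"
  by (simp_all add: restrict_scalars_def)

lemma regular_bimodule_simps [simp]:
  "carrier (regular_bimodule M) = carrier M"
  "\<zero>\<^bsub>regular_bimodule M\<^esub> = \<zero>\<^bsub>M\<^esub>"
  "add (regular_bimodule M) = add M"
  "lact (regular_bimodule M) = monoid.mult M"
  "ract (regular_bimodule M) = monoid.mult M"
  by (simp_all add: regular_bimodule_def)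

lemma finsum_eqI:
  assumes "carrier G = carrier H" "add G = add H" "\<zero>\<^bsub>G\<^esub> = \<zero>\<^bsub>H\<^esub>"
  shows "finsum G f I = finsum H f I"
  using assms by (simp add: finsum_def finprod_def)

lemma abelian_group_eqI:
  assumes "abelian_group G" "carrier H = carrier G" "add H = add G" "\<zero>\<^bsub>H\<^esub> = \<zero>\<^bsub>G\<^esub>"
  shows "abelian_group H"
  using abelian_groupE[OF assms(1)] by (intro abelian_groupI) (simp_all add: assms(2-4))

lemma tensor_simps [simp]:
  "carrier (tensor R X Y) = carrier (tensor_ab R X Y)"
  "\<zero>\<^bsub>tensor R X Y\<^esub> = \<zero>\<^bsub>tensor_ab R X Y\<^esub>"
  "add (tensor R X Y) = add (tensor_ab R X Y)"
  by (simp_all add: tensor_def)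

lemma finsum_tensor [simp]: "finsum (tensor R X Y) f I = finsum (tensor_ab R X Y) f I"
  by (rule finsum_eqI) simp_all

text \<open>Only the additive group of the target enters \<open>tensor_lift\<close>, through
  \<open>finsum\<close>.\<close>

lemma tensor_lift_tensor [simp]:
  "tensor_lift R X Y (tensor R' X' Y') = tensor_lift R X Y (tensor_ab R' X' Y')"
  by (intro ext) (simp add: tensor_lift_def)

locale ring_ext =
  fixes N :: "('n, 'p) ring_scheme" and M :: "('m, 'q) ring_scheme" (structure)
    and \<eta> :: "'n \<Rightarrow> 'm"
  assumes ring_ext: "ring_extension N M \<eta>"
begin

sublocale N: ring N using ring_ext by (simp add: ring_extension_def)
sublocale M: ring M using ring_ext by (simp add: ring_extension_def)

lemma eta_hom: "\<eta> \<in> ring_hom N M" using ring_ext by (simp add: ring_extension_def)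

lemma eta_closed [simp]: "n \<in> carrier N \<Longrightarrow> \<eta> n \<in> carrier M"
  by (rule ring_hom_closed[OF eta_hom])

definition "MN = M_N M \<eta>"
definition "NM = N_M M \<eta>"

lemma MN_simps [simp]:
  "carrier MN = carrier M" "\<zero>\<^bsub>MN\<^esub> = \<zero>" "add MN = add M"
  "ract MN x n = x \<otimes> \<eta> n" "lact MN l x = l \<otimes> x"
  by (simp_all add: MN_def)

lemma NM_simps [simp]:
  "carrier NM = carrier M" "\<zero>\<^bsub>NM\<^esub> = \<zero>" "add NM = add M"
  "ract NM x m = x \<otimes> m" "lact NM n x = \<eta> n \<otimes> x"
  by (simp_all add: NM_def)

sublocale T: tensor_pair N MN NM
  by (rule tensor_pair.intro; (rule abelian_group_eqI[OF M.abelian_group_axioms])?; simp)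

abbreviation "pt \<equiv> pure_tensor N MN NM"
abbreviation "XY \<equiv> tensor_ab N MN NM"
abbreviation "lft \<equiv> tensor_lift N MN NM"
abbreviation "LM \<equiv> lft M"
abbreviation "LT \<equiv> lft XY"
abbreviation "R \<equiv> centralizer_ring N M \<eta>"
abbreviation "E \<equiv> End_NMN N M \<eta>"
abbreviation "B \<equiv> MMN_ring N M \<eta>"

definition "lm = lact (tensor N MN NM)"
definition "rm = ract (tensor N MN NM)"

lemmas XY_ab = T.XY.abelian_group_axioms
lemmas M_ab = M.abelian_group_axioms

lemma pt_eta: "x \<in> carrier M \<Longrightarrow> y \<in> carrier M \<Longrightarrow> n \<in> carrier N \<Longrightarrow>
    pt (x \<otimes> \<eta> n) y = pt x (\<eta> n \<otimes> y)"
  using T.pure_balanced[of x y n] by simp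

lemma XY_induct [consumes 1, case_names pure add]:
  assumes "z \<in> carrier XY"
    and "\<And>x y. x \<in> carrier M \<Longrightarrow> y \<in> carrier M \<Longrightarrow> P (pt x y)"
    and "\<And>z w. z \<in> carrier XY \<Longrightarrow> w \<in> carrier XY \<Longrightarrow> P z \<Longrightarrow> P w \<Longrightarrow> P (z \<oplus>\<^bsub>XY\<^esub> w)"
  shows "P z"
  using assms(1) by (rule T.tensor_induct) (use assms in auto)

lemma balI:
  assumes "\<And>x y. x \<in> carrier M \<Longrightarrow> y \<in> carrier M \<Longrightarrow> \<phi> x y \<in> carrier G"
    and "\<And>x x' y. x \<in> carrier M \<Longrightarrow> x' \<in> carrier M \<Longrightarrow> y \<in> carrier M \<Longrightarrow>
           \<phi> (x \<oplus> x') y = \<phi> x y \<oplus>\<^bsub>G\<^esub> \<phi> x' y"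
    and "\<And>x y y'. x \<in> carrier M \<Longrightarrow> y \<in> carrier M \<Longrightarrow> y' \<in> carrier M \<Longrightarrow>
           \<phi> x (y \<oplus> y') = \<phi> x y \<oplus>\<^bsub>G\<^esub> \<phi> x y'"
    and "\<And>x y n. x \<in> carrier M \<Longrightarrow> y \<in> carrier M \<Longrightarrow> n \<in> carrier N \<Longrightarrow>
           \<phi> (x \<otimes> \<eta> n) y = \<phi> x (\<eta> n \<otimes> y)"
  shows "T.balanced G \<phi>"
  using assms by (intro T.balancedI) simp_all

lemma balD:
  assumes "T.balanced G \<phi>"
  shows "\<And>x y. x \<in> carrier M \<Longrightarrow> y \<in> carrier M \<Longrightarrow> \<phi> x y \<in> carrier G"
    and "\<And>x x' y. x \<in> carrier M \<Longrightarrow> x' \<in> carrier M \<Longrightarrow> y \<in> carrier M \<Longrightarrow>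
           \<phi> (x \<oplus> x') y = \<phi> x y \<oplus>\<^bsub>G\<^esub> \<phi> x' y"
    and "\<And>x y y'. x \<in> carrier M \<Longrightarrow> y \<in> carrier M \<Longrightarrow> y' \<in> carrier M \<Longrightarrow>
           \<phi> x (y \<oplus> y') = \<phi> x y \<oplus>\<^bsub>G\<^esub> \<phi> x y'"
    and "\<And>x y n. x \<in> carrier M \<Longrightarrow> y \<in> carrier M \<Longrightarrow> n \<in> carrier N \<Longrightarrow>
           \<phi> (x \<otimes> \<eta> n) y = \<phi> x (\<eta> n \<otimes> y)"
  using T.balanced_closed[OF assms] T.balanced_add_left[OF assms] T.balanced_add_right[OF assms]
    T.balanced_scalar[OF assms] by simp_all

lemma lift_pt: "abelian_group G \<Longrightarrow> T.balanced G \<phi> \<Longrightarrow> x \<in> carrier M \<Longrightarrow> y \<in> carrier M \<Longrightarrow>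
    lft G \<phi> (pt x y) = \<phi> x y"
  by (rule T.lift_pure) simp_all

lemma lift_unique:
  assumes "abelian_group G" "T.balanced G \<phi>" "additive_map XY G h"
    "\<And>x y. x \<in> carrier M \<Longrightarrow> y \<in> carrier M \<Longrightarrow> h (pt x y) = \<phi> x y" "z \<in> carrier XY"
  shows "h z = lft G \<phi> z"
  by (rule T.lift_eqI) (use assms in simp_all)

lemma lift_cong_M:
  assumes "abelian_group G" "T.balanced G \<phi>" "z \<in> carrier XY"
    "\<And>x y. x \<in> carrier M \<Longrightarrow> y \<in> carrier M \<Longrightarrow> \<phi>' x y = \<phi> x y"
  shows "lft G \<phi>' z = lft G \<phi> z"
  by (rule T.lift_cong) (use assms in simp_all)

text \<open>Linearity on the inner side: a map applied to the left tensor factor must be right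
  \<open>N\<close>-linear, and one applied to the right factor left \<open>N\<close>-linear.
  \<open>balanced_mult\<close> and \<open>balanced_pt\<close> consume these two properties.\<close>

definition right_linear :: "('m \<Rightarrow> 'm) \<Rightarrow> bool" where
  "right_linear f \<longleftrightarrow> additive_map M M f \<and> (\<forall>x\<in>carrier M. \<forall>n\<in>carrier N. f (x \<otimes> \<eta> n) = f x \<otimes> \<eta> n)"

definition left_linear :: "('m \<Rightarrow> 'm) \<Rightarrow> bool" where
  "left_linear f \<longleftrightarrow> additive_map M M f \<and> (\<forall>x\<in>carrier M. \<forall>n\<in>carrier N. f (\<eta> n \<otimes> x) = \<eta> n \<otimes> f x)"

lemma right_linear_id [simp]: "right_linear (\<lambda>x. x)"
  by (simp add: right_linear_def additive_map_def)

lemma left_linear_id [simp]: "left_linear (\<lambda>x. x)"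
  by (simp add: left_linear_def additive_map_def)

lemma right_linear_mult [simp]: "m \<in> carrier M \<Longrightarrow> right_linear f \<Longrightarrow> right_linear (\<lambda>x. m \<otimes> f x)"
  by (simp add: right_linear_def additive_map_def M.r_distr M.m_assoc)

lemma left_linear_mult [simp]: "m \<in> carrier M \<Longrightarrow> left_linear f \<Longrightarrow> left_linear (\<lambda>x. f x \<otimes> m)"
  by (simp add: left_linear_def additive_map_def M.l_distr M.m_assoc)

lemma right_linear_comp: "right_linear f \<Longrightarrow> right_linear g \<Longrightarrow> right_linear (\<lambda>x. f (g x))"
  by (simp add: right_linear_def additive_map_def)

lemma left_linear_comp: "left_linear f \<Longrightarrow> left_linear g \<Longrightarrow> left_linear (\<lambda>x. f (g x))"
  by (simp add: left_linear_def additive_map_def)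

lemma balanced_mult [simp]:
  assumes "right_linear f" "left_linear g"
  shows "T.balanced M (\<lambda>x y. f x \<otimes> g y)"
  using assms unfolding right_linear_def left_linear_def additive_map_def
  by (intro balI) (simp_all add: M.l_distr M.r_distr M.m_assoc)

lemma pt_add_left: "x \<in> carrier M \<Longrightarrow> x' \<in> carrier M \<Longrightarrow> y \<in> carrier M \<Longrightarrow>
    pt (x \<oplus> x') y = pt x y \<oplus>\<^bsub>XY\<^esub> pt x' y"
  using T.pure_add_left[of x x' y] by simp

lemma pt_add_right: "x \<in> carrier M \<Longrightarrow> y \<in> carrier M \<Longrightarrow> y' \<in> carrier M \<Longrightarrow>
    pt x (y \<oplus> y') = pt x y \<oplus>\<^bsub>XY\<^esub> pt x y'"
  using T.pure_add_right[of x y y'] by simp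

lemma balanced_pt [simp]:
  assumes "right_linear f" "left_linear g"
  shows "T.balanced XY (\<lambda>x y. pt (f x) (g y))"
  using assms unfolding right_linear_def left_linear_def additive_map_def
  by (intro balI) (simp_all add: pt_add_left pt_add_right pt_eta)

lemma lm_eq: "lm l z = LT (\<lambda>x y. pt (l \<otimes> x) y) z"
  by (simp add: lm_def tensor_def)

lemma rm_eq: "rm z m = LT (\<lambda>x y. pt x (y \<otimes> m)) z"
  by (simp add: rm_def tensor_def)

lemma lm_pt [simp]: "l \<in> carrier M \<Longrightarrow> x \<in> carrier M \<Longrightarrow> y \<in> carrier M \<Longrightarrow>
    lm l (pt x y) = pt (l \<otimes> x) y"
  unfolding lm_eq by (rule lift_pt[OF XY_ab]) simp_all

lemma rm_pt [simp]: "m \<in> carrier M \<Longrightarrow> x \<in> carrier M \<Longrightarrow> y \<in> carrier M \<Longrightarrow>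
    rm (pt x y) m = pt x (y \<otimes> m)"
  unfolding rm_eq by (rule lift_pt[OF XY_ab]) simp_all

lemma lm_additive: "l \<in> carrier M \<Longrightarrow> additive_map XY XY (lm l)"
  unfolding lm_eq by (rule T.lift_additive[OF XY_ab]) simp

lemma rm_additive: "m \<in> carrier M \<Longrightarrow> additive_map XY XY (\<lambda>z. rm z m)"
  unfolding rm_eq by (rule T.lift_additive[OF XY_ab]) simp

lemma lm_closed [simp]: "l \<in> carrier M \<Longrightarrow> z \<in> carrier XY \<Longrightarrow> lm l z \<in> carrier XY"
  by (rule additive_map_closed[OF lm_additive])

lemma rm_closed [simp]: "m \<in> carrier M \<Longrightarrow> z \<in> carrier XY \<Longrightarrow> rm z m \<in> carrier XY"
  by (rule additive_map_closed[OF rm_additive])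

lemma lm_add [simp]: "l \<in> carrier M \<Longrightarrow> z \<in> carrier XY \<Longrightarrow> w \<in> carrier XY \<Longrightarrow>
    lm l (z \<oplus>\<^bsub>XY\<^esub> w) = lm l z \<oplus>\<^bsub>XY\<^esub> lm l w"
  by (rule additive_map_add[OF lm_additive])

lemma rm_add [simp]: "m \<in> carrier M \<Longrightarrow> z \<in> carrier XY \<Longrightarrow> w \<in> carrier XY \<Longrightarrow>
    rm (z \<oplus>\<^bsub>XY\<^esub> w) m = rm z m \<oplus>\<^bsub>XY\<^esub> rm w m"
  by (rule additive_map_add[OF rm_additive])

lemma lm_lm: "z \<in> carrier XY \<Longrightarrow> l \<in> carrier M \<Longrightarrow> l' \<in> carrier M \<Longrightarrow> lm l (lm l' z) = lm (l \<otimes> l') z"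
  by (induction z rule: XY_induct) (simp_all add: M.m_assoc)

lemma rm_rm: "z \<in> carrier XY \<Longrightarrow> m \<in> carrier M \<Longrightarrow> m' \<in> carrier M \<Longrightarrow> rm (rm z m) m' = rm z (m \<otimes> m')"
  by (induction z rule: XY_induct) (simp_all add: M.m_assoc)

lemma lm_rm: "z \<in> carrier XY \<Longrightarrow> l \<in> carrier M \<Longrightarrow> m \<in> carrier M \<Longrightarrow> lm l (rm z m) = rm (lm l z) m"
  by (induction z rule: XY_induct) simp_all

lemma lm_one [simp]: "z \<in> carrier XY \<Longrightarrow> lm \<one> z = z"
  by (induction z rule: XY_induct) simp_all

lemma rm_one [simp]: "z \<in> carrier XY \<Longrightarrow> rm z \<one> = z"
  by (induction z rule: XY_induct) simp_all

lemma add_swap: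
  assumes "z \<in> carrier XY" "z' \<in> carrier XY" "w \<in> carrier XY" "w' \<in> carrier XY"
  shows "(z \<oplus>\<^bsub>XY\<^esub> z') \<oplus>\<^bsub>XY\<^esub> (w \<oplus>\<^bsub>XY\<^esub> w') = (z \<oplus>\<^bsub>XY\<^esub> w) \<oplus>\<^bsub>XY\<^esub> (z' \<oplus>\<^bsub>XY\<^esub> w')"
  using assms by (simp add: T.XY.a_ac)

lemma lm_add_left: "z \<in> carrier XY \<Longrightarrow> l \<in> carrier M \<Longrightarrow> l' \<in> carrier M \<Longrightarrow>
    lm (l \<oplus> l') z = lm l z \<oplus>\<^bsub>XY\<^esub> lm l' z"
  by (induction z rule: XY_induct) (simp_all add: M.l_distr pt_add_left add_swap)

lemma rm_add_right: "z \<in> carrier XY \<Longrightarrow> m \<in> carrier M \<Longrightarrow> m' \<in> carrier M \<Longrightarrow>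
    rm z (m \<oplus> m') = rm z m \<oplus>\<^bsub>XY\<^esub> rm z m'"
  by (induction z rule: XY_induct) (simp_all add: M.r_distr pt_add_right add_swap)

lemma balanced_lmul: "T.balanced G \<phi> \<Longrightarrow> l \<in> carrier M \<Longrightarrow> T.balanced G (\<lambda>x y. \<phi> (l \<otimes> x) y)"
  by (rule balI) (simp_all add: balD M.r_distr M.m_assoc[symmetric])

lemma balanced_rmul: "T.balanced G \<phi> \<Longrightarrow> m \<in> carrier M \<Longrightarrow> T.balanced G (\<lambda>x y. \<phi> x (y \<otimes> m))"
  by (rule balI) (simp_all add: balD M.l_distr M.m_assoc)

lemma lift_lm:
  assumes "abelian_group G" "T.balanced G \<phi>" "z \<in> carrier XY" "l \<in> carrier M"
  shows "lft G \<phi> (lm l z) = lft G (\<lambda>x y. \<phi> (l \<otimes> x) y) z"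
  using assms
  by (intro lift_unique[OF assms(1) balanced_lmul[OF assms(2,4)]
        additive_map_compose[OF lm_additive T.lift_additive]])
     (simp_all add: lift_pt)

lemma lift_rm:
  assumes "abelian_group G" "T.balanced G \<phi>" "z \<in> carrier XY" "m \<in> carrier M"
  shows "lft G \<phi> (rm z m) = lft G (\<lambda>x y. \<phi> x (y \<otimes> m)) z"
  using assms
  by (intro lift_unique[OF assms(1) balanced_rmul[OF assms(2,4)]
        additive_map_compose[OF rm_additive T.lift_additive]])
     (simp_all add: lift_pt)

lemma lift_homogeneous_left:
  assumes "T.balanced M \<phi>" "z \<in> carrier XY" "l \<in> carrier M"
    "\<And>x y. x \<in> carrier M \<Longrightarrow> y \<in> carrier M \<Longrightarrow> \<phi> (l \<otimes> x) y = l \<otimes> \<phi> x y"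
  shows "LM \<phi> (lm l z) = l \<otimes> LM \<phi> z"
  using assms(2)
  by (induction z rule: XY_induct)
     (simp_all add: assms lift_pt[OF M_ab] additive_map_add[OF T.lift_additive[OF M_ab]] M.r_distr T.lift_closed[OF M_ab])

lemma lift_homogeneous_right:
  assumes "T.balanced M \<phi>" "z \<in> carrier XY" "m \<in> carrier M"
    "\<And>x y. x \<in> carrier M \<Longrightarrow> y \<in> carrier M \<Longrightarrow> \<phi> x (y \<otimes> m) = \<phi> x y \<otimes> m"
  shows "LM \<phi> (rm z m) = LM \<phi> z \<otimes> m"
  using assms(2)
  by (induction z rule: XY_induct)
     (simp_all add: assms lift_pt[OF M_ab] additive_map_add[OF T.lift_additive[OF M_ab]] M.l_distr T.lift_closed[OF M_ab])

lemma liftT_homogeneous_left: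
  assumes "T.balanced XY \<phi>" "z \<in> carrier XY" "l \<in> carrier M"
    "\<And>x y. x \<in> carrier M \<Longrightarrow> y \<in> carrier M \<Longrightarrow> \<phi> (l \<otimes> x) y = lm l (\<phi> x y)"
  shows "LT \<phi> (lm l z) = lm l (LT \<phi> z)"
  using assms(2)
  by (induction z rule: XY_induct)
     (simp_all add: assms lift_pt[OF XY_ab] additive_map_add[OF T.lift_additive[OF XY_ab]] T.lift_closed[OF XY_ab])

lemma liftT_homogeneous_right:
  assumes "T.balanced XY \<phi>" "z \<in> carrier XY" "m \<in> carrier M"
    "\<And>x y. x \<in> carrier M \<Longrightarrow> y \<in> carrier M \<Longrightarrow> \<phi> x (y \<otimes> m) = rm (\<phi> x y) m"
  shows "LT \<phi> (rm z m) = rm (LT \<phi> z) m"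
  using assms(2)
  by (induction z rule: XY_induct)
     (simp_all add: assms lift_pt[OF XY_ab] additive_map_add[OF T.lift_additive[OF XY_ab]] T.lift_closed[OF XY_ab])

section \<open>The centralizer \<open>R\<close>, the endomorphisms \<open>E\<close> and the
  \<open>N\<close>-central tensors \<open>B\<close>\<close>

lemma R_simps [simp]:
  "\<zero>\<^bsub>R\<^esub> = \<zero>" "\<one>\<^bsub>R\<^esub> = \<one>" "add R = add M" "monoid.mult R = monoid.mult M"
  by (simp_all add: centralizer_ring_def)

lemma R_iff: "r \<in> carrier R \<longleftrightarrow> r \<in> carrier M \<and> (\<forall>n\<in>carrier N. \<eta> n \<otimes> r = r \<otimes> \<eta> n)"
  by (simp add: centralizer_ring_def commutant_def)

lemma R_M [simp]: "r \<in> carrier R \<Longrightarrow> r \<in> carrier M"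
  by (simp add: R_iff)

lemma R_comm: "r \<in> carrier R \<Longrightarrow> n \<in> carrier N \<Longrightarrow> \<eta> n \<otimes> r = r \<otimes> \<eta> n"
  by (simp add: R_iff)

lemma R_add [simp]: "r \<in> carrier R \<Longrightarrow> r' \<in> carrier R \<Longrightarrow> r \<oplus> r' \<in> carrier R"
  by (simp add: R_iff M.l_distr M.r_distr)

lemma R_mult [simp]: "r \<in> carrier R \<Longrightarrow> r' \<in> carrier R \<Longrightarrow> r \<otimes> r' \<in> carrier R"
  unfolding R_iff
proof (intro conjI ballI; elim conjE)
  fix n assume *: "n \<in> carrier N" "r \<in> carrier M" "r' \<in> carrier M"
    "\<forall>n\<in>carrier N. \<eta> n \<otimes> r = r \<otimes> \<eta> n" "\<forall>n\<in>carrier N. \<eta> n \<otimes> r' = r' \<otimes> \<eta> n"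
  then have "\<eta> n \<otimes> (r \<otimes> r') = (r \<otimes> \<eta> n) \<otimes> r'" by (simp add: M.m_assoc[symmetric])
  also have "\<dots> = r \<otimes> (r' \<otimes> \<eta> n)" using * by (simp add: M.m_assoc)
  finally show "\<eta> n \<otimes> (r \<otimes> r') = r \<otimes> r' \<otimes> \<eta> n" using * by (simp add: M.m_assoc)
qed simp

lemma R_ab: "abelian_group R"
proof (rule abelian_groupI)
  fix r assume r: "r \<in> carrier R"
  then have "\<ominus> r \<in> carrier R"
    by (simp add: R_iff M.l_minus M.r_minus)
  then show "\<exists>r'\<in>carrier R. r' \<oplus>\<^bsub>R\<^esub> r = \<zero>\<^bsub>R\<^esub>"
    using r by (intro bexI[of _ "\<ominus> r"]) (simp_all add: M.l_neg)
qed (auto simp: R_iff M.l_distr M.r_distr M.a_ac)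

lemma R_finsum:
  assumes "finite I" "\<And>i. i \<in> I \<Longrightarrow> f i \<in> carrier R"
  shows "(\<Oplus>\<^bsub>R\<^esub>i\<in>I. f i) = (\<Oplus>i\<in>I. f i)"
  using additive_map_finsum[OF R_ab M_ab _ assms, of "\<lambda>x. x"] by (simp add: additive_map_def)

lemma E_iff: "\<alpha> \<in> carrier E \<longleftrightarrow> \<alpha> \<in> extensional (carrier M) \<and> right_linear \<alpha> \<and> left_linear \<alpha>"
  by (auto simp: End_NMN_def bimod_hom_def right_linear_def left_linear_def additive_map_def)

lemma E_simps:
  "\<zero>\<^bsub>E\<^esub> = (\<lambda>m\<in>carrier M. \<zero>)" "\<one>\<^bsub>E\<^esub> = (\<lambda>m\<in>carrier M. m)"
  "\<alpha> \<oplus>\<^bsub>E\<^esub> \<beta> = (\<lambda>m\<in>carrier M. \<alpha> m \<oplus> \<beta> m)" "\<alpha> \<otimes>\<^bsub>E\<^esub> \<beta> = (\<lambda>m\<in>carrier M. \<alpha> (\<beta> m))"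
  by (simp_all add: End_NMN_def compose_def)

lemma E_right_linear [simp]: "\<alpha> \<in> carrier E \<Longrightarrow> right_linear \<alpha>"
  and E_left_linear [simp]: "\<alpha> \<in> carrier E \<Longrightarrow> left_linear \<alpha>"
  and E_extensional: "\<alpha> \<in> carrier E \<Longrightarrow> \<alpha> \<in> extensional (carrier M)"
  by (simp_all add: E_iff)

lemma E_add: "\<alpha> \<in> carrier E \<Longrightarrow> m \<in> carrier M \<Longrightarrow> m' \<in> carrier M \<Longrightarrow> \<alpha> (m \<oplus> m') = \<alpha> m \<oplus> \<alpha> m'"
  by (simp add: E_iff right_linear_def additive_map_def)

lemma E_left: "\<alpha> \<in> carrier E \<Longrightarrow> m \<in> carrier M \<Longrightarrow> n \<in> carrier N \<Longrightarrow> \<alpha> (\<eta> n \<otimes> m) = \<eta> n \<otimes> \<alpha> m"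
  by (simp add: E_iff left_linear_def)

lemma E_right: "\<alpha> \<in> carrier E \<Longrightarrow> m \<in> carrier M \<Longrightarrow> n \<in> carrier N \<Longrightarrow> \<alpha> (m \<otimes> \<eta> n) = \<alpha> m \<otimes> \<eta> n"
  by (simp add: E_iff right_linear_def)

lemma E_restrictI:
  assumes "right_linear f" "left_linear f"
  shows "(\<lambda>m\<in>carrier M. f m) \<in> carrier E"
  using assms by (simp add: E_iff right_linear_def left_linear_def additive_map_def)

lemma E_closed [simp]: "\<alpha> \<in> carrier E \<Longrightarrow> m \<in> carrier M \<Longrightarrow> \<alpha> m \<in> carrier M"
  by (simp add: E_iff right_linear_def additive_map_def)

lemma E_ext:
  assumes "\<alpha> \<in> carrier E" "\<beta> \<in> carrier E" "\<And>m. m \<in> carrier M \<Longrightarrow> \<alpha> m = \<beta> m"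
  shows "\<alpha> = \<beta>"
  using assms(3) by (rule extensionalityI[OF E_extensional[OF assms(1)] E_extensional[OF assms(2)]])

lemma linear_add:
  "right_linear f \<Longrightarrow> right_linear g \<Longrightarrow> right_linear (\<lambda>m. f m \<oplus> g m)"
  "left_linear f \<Longrightarrow> left_linear g \<Longrightarrow> left_linear (\<lambda>m. f m \<oplus> g m)"
  by (auto simp: right_linear_def left_linear_def additive_map_def M.l_distr M.r_distr M.a_ac)

text \<open>The factor \<open>r\<close> stands between f x and \<eta> n, and can be moved past
  \<eta> n because it commutes with the image of \<open>N\<close>.\<close>

lemma right_linear_mult_R: "r \<in> carrier R \<Longrightarrow> right_linear f \<Longrightarrow> right_linear (\<lambda>x. f x \<otimes> r)"
  by (simp add: right_linear_def additive_map_def M.l_distr M.m_assoc R_comm)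

lemma left_linear_mult_R: "r \<in> carrier R \<Longrightarrow> left_linear f \<Longrightarrow> left_linear (\<lambda>x. r \<otimes> f x)"
  by (simp add: left_linear_def additive_map_def M.r_distr M.m_assoc[symmetric] R_comm)

lemma E_plus [simp]: "\<alpha> \<in> carrier E \<Longrightarrow> \<beta> \<in> carrier E \<Longrightarrow> \<alpha> \<oplus>\<^bsub>E\<^esub> \<beta> \<in> carrier E"
  unfolding E_simps by (intro E_restrictI linear_add) simp_all

lemma E_mult [simp]: "\<alpha> \<in> carrier E \<Longrightarrow> \<beta> \<in> carrier E \<Longrightarrow> \<alpha> \<otimes>\<^bsub>E\<^esub> \<beta> \<in> carrier E"
  unfolding E_simps by (intro E_restrictI right_linear_comp[of \<alpha> \<beta>] left_linear_comp[of \<alpha> \<beta>]) simp_all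

lemma E_one [simp]: "\<one>\<^bsub>E\<^esub> \<in> carrier E"
  unfolding E_simps by (intro E_restrictI) simp_all

lemma E_ab: "abelian_group E"
proof (rule abelian_groupI)
  show zero: "\<zero>\<^bsub>E\<^esub> \<in> carrier E"
    unfolding E_simps by (intro E_restrictI) (simp_all add: left_linear_def right_linear_def additive_map_def)
  fix \<alpha> assume a: "\<alpha> \<in> carrier E"
  show "\<zero>\<^bsub>E\<^esub> \<oplus>\<^bsub>E\<^esub> \<alpha> = \<alpha>"
    by (rule E_ext) (simp_all add: zero a, simp add: E_simps a)
  have c: "(\<lambda>m\<in>carrier M. \<ominus> \<alpha> m) \<in> carrier E"
    by (rule E_restrictI)
       (use a in \<open>simp_all add: left_linear_def right_linear_def additive_map_def E_add E_left E_right
          M.minus_add M.l_minus M.r_minus M.a_comm\<close>)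
  have "(\<lambda>m\<in>carrier M. \<ominus> \<alpha> m) \<oplus>\<^bsub>E\<^esub> \<alpha> = \<zero>\<^bsub>E\<^esub>"
    by (rule E_ext) (simp_all add: zero a c, simp add: E_simps a M.l_neg)
  with c show "\<exists>\<beta>\<in>carrier E. \<beta> \<oplus>\<^bsub>E\<^esub> \<alpha> = \<zero>\<^bsub>E\<^esub>" by blast
next
  fix \<alpha> \<beta> \<gamma> assume a: "\<alpha> \<in> carrier E" "\<beta> \<in> carrier E" "\<gamma> \<in> carrier E"
  show "\<alpha> \<oplus>\<^bsub>E\<^esub> \<beta> \<oplus>\<^bsub>E\<^esub> \<gamma> = \<alpha> \<oplus>\<^bsub>E\<^esub> (\<beta> \<oplus>\<^bsub>E\<^esub> \<gamma>)"
    by (rule E_ext) (simp_all add: a, simp add: E_simps a M.a_assoc)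
next
  fix \<alpha> \<beta> assume a: "\<alpha> \<in> carrier E" "\<beta> \<in> carrier E"
  show "\<alpha> \<oplus>\<^bsub>E\<^esub> \<beta> \<in> carrier E" using a by simp
  show "\<alpha> \<oplus>\<^bsub>E\<^esub> \<beta> = \<beta> \<oplus>\<^bsub>E\<^esub> \<alpha>"
    by (rule E_ext) (simp_all add: a, simp add: E_simps a M.a_comm)
qed

lemma E_finsum_apply:
  assumes "finite I" "\<And>i. i \<in> I \<Longrightarrow> \<alpha> i \<in> carrier E" "m \<in> carrier M"
  shows "(\<Oplus>\<^bsub>E\<^esub>i\<in>I. \<alpha> i) m = (\<Oplus>i\<in>I. \<alpha> i m)"
  by (rule additive_map_finsum[OF E_ab M_ab _ assms(1,2)])
     (use assms(3) in \<open>auto simp: additive_map_def E_simps\<close>)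

lemma B_simps: "\<zero>\<^bsub>B\<^esub> = \<zero>\<^bsub>XY\<^esub>" "add B = add XY" "\<one>\<^bsub>B\<^esub> = pt \<one> \<one>"
  by (simp_all add: MMN_ring_def MN_def NM_def)

lemma B_iff: "c \<in> carrier B \<longleftrightarrow> c \<in> carrier XY \<and> (\<forall>n\<in>carrier N. lm (\<eta> n) c = rm c (\<eta> n))"
  by (simp add: MMN_ring_def commutant_def lm_def rm_def MN_def NM_def)

lemma B_XY [simp]: "c \<in> carrier B \<Longrightarrow> c \<in> carrier XY"
  by (simp add: B_iff)

lemma B_comm: "c \<in> carrier B \<Longrightarrow> n \<in> carrier N \<Longrightarrow> lm (\<eta> n) c = rm c (\<eta> n)"
  by (simp add: B_iff)

lemma B_add [simp]: "c \<in> carrier B \<Longrightarrow> d \<in> carrier B \<Longrightarrow> c \<oplus>\<^bsub>XY\<^esub> d \<in> carrier B"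
  by (simp add: B_iff)

lemma B_one [simp]: "pt \<one> \<one> \<in> carrier B"
  unfolding B_iff using pt_eta[of \<one> \<one>] by simp

lemma B_ab: "abelian_group B"
proof (rule abelian_groupI)
  fix c assume c: "c \<in> carrier B"
  have "lm l (\<ominus>\<^bsub>XY\<^esub> c) = \<ominus>\<^bsub>XY\<^esub> lm l c" if "l \<in> carrier M" for l
  proof -
    have "lm l (\<ominus>\<^bsub>XY\<^esub> c) \<oplus>\<^bsub>XY\<^esub> lm l c = lm l (\<ominus>\<^bsub>XY\<^esub> c \<oplus>\<^bsub>XY\<^esub> c)" using that c by (subst lm_add) auto
    also have "\<dots> = \<zero>\<^bsub>XY\<^esub>"
      using c additive_map_zero[OF XY_ab XY_ab lm_additive[OF that]] by (simp add: T.XY.l_neg)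
    finally show ?thesis using that c by (simp add: T.XY.minus_equality)
  qed
  moreover have "rm (\<ominus>\<^bsub>XY\<^esub> c) l = \<ominus>\<^bsub>XY\<^esub> rm c l" if "l \<in> carrier M" for l
  proof -
    have "rm (\<ominus>\<^bsub>XY\<^esub> c) l \<oplus>\<^bsub>XY\<^esub> rm c l = rm (\<ominus>\<^bsub>XY\<^esub> c \<oplus>\<^bsub>XY\<^esub> c) l" using that c by (subst rm_add) auto
    also have "\<dots> = \<zero>\<^bsub>XY\<^esub>"
      using c additive_map_zero[OF XY_ab XY_ab rm_additive[OF that]] by (simp add: T.XY.l_neg)
    finally show ?thesis using that c by (simp add: T.XY.minus_equality)
  qed
  ultimately have "\<ominus>\<^bsub>XY\<^esub> c \<in> carrier B" using c by (simp add: B_iff)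
  then show "\<exists>d\<in>carrier B. d \<oplus>\<^bsub>B\<^esub> c = \<zero>\<^bsub>B\<^esub>"
    using c by (intro bexI[of _ "\<ominus>\<^bsub>XY\<^esub> c"]) (simp_all add: B_simps T.XY.l_neg)
next
  show "\<zero>\<^bsub>B\<^esub> \<in> carrier B"
    using additive_map_zero[OF XY_ab XY_ab lm_additive] additive_map_zero[OF XY_ab XY_ab rm_additive]
    by (simp add: B_iff B_simps)
qed (auto simp: B_simps T.XY.a_ac)

text \<open>Left homogeneity moves \<eta> n inside, centrality of \<open>c\<close> carries it to the
  other side, and right homogeneity takes it out again.\<close>

lemma lift_B:
  assumes "T.balanced M \<phi>" "c \<in> carrier B"
    "\<And>x y n. x \<in> carrier M \<Longrightarrow> y \<in> carrier M \<Longrightarrow> n \<in> carrier N \<Longrightarrow> \<phi> (\<eta> n \<otimes> x) y = \<eta> n \<otimes> \<phi> x y"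
    "\<And>x y n. x \<in> carrier M \<Longrightarrow> y \<in> carrier M \<Longrightarrow> n \<in> carrier N \<Longrightarrow> \<phi> x (y \<otimes> \<eta> n) = \<phi> x y \<otimes> \<eta> n"
  shows "LM \<phi> c \<in> carrier R"
  unfolding R_iff
proof (intro conjI ballI)
  show "LM \<phi> c \<in> carrier M" using assms by (simp add: T.lift_closed[OF M_ab])
  fix n assume n: "n \<in> carrier N"
  have "\<eta> n \<otimes> LM \<phi> c = LM \<phi> (lm (\<eta> n) c)"
    by (rule lift_homogeneous_left[symmetric]) (use assms n in auto)
  also have "\<dots> = LM \<phi> (rm c (\<eta> n))" using assms(2) n by (simp add: B_comm)
  also have "\<dots> = LM \<phi> c \<otimes> \<eta> n"
    by (rule lift_homogeneous_right) (use assms n in auto)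
  finally show "\<eta> n \<otimes> LM \<phi> c = LM \<phi> c \<otimes> \<eta> n" .
qed

lemma liftT_B:
  assumes "T.balanced XY \<phi>" "c \<in> carrier B"
    "\<And>x y n. x \<in> carrier M \<Longrightarrow> y \<in> carrier M \<Longrightarrow> n \<in> carrier N \<Longrightarrow> \<phi> (\<eta> n \<otimes> x) y = lm (\<eta> n) (\<phi> x y)"
    "\<And>x y n. x \<in> carrier M \<Longrightarrow> y \<in> carrier M \<Longrightarrow> n \<in> carrier N \<Longrightarrow> \<phi> x (y \<otimes> \<eta> n) = rm (\<phi> x y) (\<eta> n)"
  shows "LT \<phi> c \<in> carrier B"
  unfolding B_iff
proof (intro conjI ballI)
  show "LT \<phi> c \<in> carrier XY" using assms by (simp add: T.lift_closed[OF XY_ab])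
  fix n assume n: "n \<in> carrier N"
  have "lm (\<eta> n) (LT \<phi> c) = LT \<phi> (lm (\<eta> n) c)"
    by (rule liftT_homogeneous_left[symmetric]) (use assms n in auto)
  also have "\<dots> = LT \<phi> (rm c (\<eta> n))" using assms(2) n by (simp add: B_comm)
  also have "\<dots> = rm (LT \<phi> c) (\<eta> n)"
    by (rule liftT_homogeneous_right) (use assms n in auto)
  finally show "lm (\<eta> n) (LT \<phi> c) = rm (LT \<phi> c) (\<eta> n)" .
qed

text \<open>Since r commutes with \<eta> n and c is central, \<eta>(n) r c = r \<eta>(n) c = r c
  \<eta>(n).\<close>

lemma lm_R_B [simp]: "r \<in> carrier R \<Longrightarrow> c \<in> carrier B \<Longrightarrow> lm r c \<in> carrier B"
  unfolding B_iff[of "lm r c"]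
  by (simp add: lm_lm R_comm) (simp add: lm_lm[symmetric] B_comm lm_rm)

lemma rm_R_B [simp]: "r \<in> carrier R \<Longrightarrow> c \<in> carrier B \<Longrightarrow> rm c r \<in> carrier B"
  unfolding B_iff[of "rm c r"]
  by (simp add: rm_rm R_comm[symmetric] lm_rm) (simp add: rm_rm[symmetric] B_comm)

section \<open>The two pairings of \<open>B\<close> with the endomorphisms\<close>

definition phi :: "('m, 'm) tens \<Rightarrow> ('m \<Rightarrow> 'm) \<Rightarrow> 'm" where
  "phi c \<alpha> = LM (\<lambda>x y. x \<otimes> \<alpha> y) c"

definition psi :: "('m, 'm) tens \<Rightarrow> ('m \<Rightarrow> 'm) \<Rightarrow> 'm" where
  "psi c \<alpha> = LM (\<lambda>x y. \<alpha> x \<otimes> y) c"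

lemma phi_R [simp]: "c \<in> carrier B \<Longrightarrow> \<alpha> \<in> carrier E \<Longrightarrow> phi c \<alpha> \<in> carrier R"
  unfolding phi_def by (rule lift_B) (simp_all add: M.m_assoc E_right)

lemma psi_R [simp]: "c \<in> carrier B \<Longrightarrow> \<alpha> \<in> carrier E \<Longrightarrow> psi c \<alpha> \<in> carrier R"
  unfolding psi_def by (rule lift_B) (simp_all add: M.m_assoc E_left)

text \<open>Centrality of \<open>c\<close> lets \<eta> n pass from one side to the other: x
  \<eta>(n) c y = x c \<eta>(n) y. The product of \<open>B\<close> rests on this.\<close>

lemma balanced_lm_rm:
  assumes "c \<in> carrier B"
  shows "T.balanced XY (\<lambda>x y. lm x (rm c y))"
proof (rule balI)
  fix x y n assume *: "x \<in> carrier M" "y \<in> carrier M" "n \<in> carrier N"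
  have "lm (x \<otimes> \<eta> n) (rm c y) = lm x (lm (\<eta> n) (rm c y))"
    using assms * by (simp add: lm_lm)
  also have "lm (\<eta> n) (rm c y) = rm c (\<eta> n \<otimes> y)"
    using assms * by (simp add: lm_rm B_comm rm_rm)
  finally show "lm (x \<otimes> \<eta> n) (rm c y) = lm x (rm c (\<eta> n \<otimes> y))" .
qed (use assms in \<open>simp_all add: lm_add_left rm_add_right\<close>)

text \<open>The product is d^1 c d^2: \<open>c\<close> is inserted between the legs of
  \<open>d\<close> by the outer actions. This removes the inner lift of the definition and leaves a
  lift over \<open>d\<close> alone.\<close>

lemma B_mult_eq:
  assumes "c \<in> carrier B" "d \<in> carrier XY"
  shows "c \<otimes>\<^bsub>B\<^esub> d = LT (\<lambda>x y. lm x (rm c y)) d"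
proof -
  have *: "LT (\<lambda>x y. pt (x' \<otimes> x) (y \<otimes> y')) c = lm x' (rm c y')" if "x' \<in> carrier M" "y' \<in> carrier M" for x' y'
    using that assms
    by (intro lift_unique[symmetric, where h = "\<lambda>z. lm x' (rm z y')"] XY_ab balanced_pt
        additive_map_compose[OF rm_additive lm_additive]) simp_all
  have "c \<otimes>\<^bsub>B\<^esub> d = LT (\<lambda>x' y'. LT (\<lambda>x y. pt (x' \<otimes> x) (y \<otimes> y')) c) d"
    by (simp add: MMN_ring_def MN_def NM_def)
  also have "\<dots> = LT (\<lambda>x y. lm x (rm c y)) d"
    by (rule lift_cong_M[OF XY_ab balanced_lm_rm[OF assms(1)] assms(2) *])
  finally show ?thesis .
qed

lemma LM_mult_left:
  assumes "T.balanced M \<phi>" "z \<in> carrier XY" "l \<in> carrier M"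
  shows "l \<otimes> LM \<phi> z = LM (\<lambda>x y. l \<otimes> \<phi> x y) z"
  by (rule T.lift_comp[OF M_ab assms(1) M_ab _ assms(2)])
     (simp add: additive_map_def assms(3) M.r_distr)

lemma LM_mult_right:
  assumes "T.balanced M \<phi>" "z \<in> carrier XY" "m \<in> carrier M"
  shows "LM \<phi> z \<otimes> m = LM (\<lambda>x y. \<phi> x y \<otimes> m) z"
  by (rule T.lift_comp[OF M_ab assms(1) M_ab _ assms(2)])
     (simp add: additive_map_def assms(3) M.l_distr)

lemma phi_lm: "z \<in> carrier XY \<Longrightarrow> \<alpha> \<in> carrier E \<Longrightarrow> l \<in> carrier M \<Longrightarrow> phi (lm l z) \<alpha> = l \<otimes> phi z \<alpha>"
  unfolding phi_def by (rule lift_homogeneous_left) (simp_all add: M.m_assoc)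

lemma psi_rm: "z \<in> carrier XY \<Longrightarrow> \<alpha> \<in> carrier E \<Longrightarrow> m \<in> carrier M \<Longrightarrow> psi (rm z m) \<alpha> = psi z \<alpha> \<otimes> m"
  unfolding psi_def by (rule lift_homogeneous_right) (simp_all add: M.m_assoc)

lemma phi_pt [simp]: "\<alpha> \<in> carrier E \<Longrightarrow> x \<in> carrier M \<Longrightarrow> y \<in> carrier M \<Longrightarrow> phi (pt x y) \<alpha> = x \<otimes> \<alpha> y"
  unfolding phi_def by (rule lift_pt[OF M_ab]) simp_all

lemma psi_pt [simp]: "\<alpha> \<in> carrier E \<Longrightarrow> x \<in> carrier M \<Longrightarrow> y \<in> carrier M \<Longrightarrow> psi (pt x y) \<alpha> = \<alpha> x \<otimes> y"
  unfolding psi_def by (rule lift_pt[OF M_ab]) simp_all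

lemma phi_additive: "\<alpha> \<in> carrier E \<Longrightarrow> additive_map XY M (\<lambda>z. phi z \<alpha>)"
  unfolding phi_def by (rule T.lift_additive[OF M_ab]) simp

lemma psi_additive: "\<alpha> \<in> carrier E \<Longrightarrow> additive_map XY M (\<lambda>z. psi z \<alpha>)"
  unfolding psi_def by (rule T.lift_additive[OF M_ab]) simp

lemma phi_M [simp]: "\<alpha> \<in> carrier E \<Longrightarrow> z \<in> carrier XY \<Longrightarrow> phi z \<alpha> \<in> carrier M"
  by (rule additive_map_closed[OF phi_additive])

lemma psi_M [simp]: "\<alpha> \<in> carrier E \<Longrightarrow> z \<in> carrier XY \<Longrightarrow> psi z \<alpha> \<in> carrier M"
  by (rule additive_map_closed[OF psi_additive])

lemma E_plus_apply: "m \<in> carrier M \<Longrightarrow> (\<alpha> \<oplus>\<^bsub>E\<^esub> \<beta>) m = \<alpha> m \<oplus> \<beta> m"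
  by (simp add: E_simps)

lemma phi_plus:
  assumes "z \<in> carrier XY" "\<alpha> \<in> carrier E" "\<beta> \<in> carrier E"
  shows "phi z (\<alpha> \<oplus>\<^bsub>E\<^esub> \<beta>) = phi z \<alpha> \<oplus> phi z \<beta>"
  using assms(1)
  by (induction z rule: XY_induct)
     (simp_all add: assms additive_map_add[OF phi_additive] M.r_distr M.add.m_ac E_plus_apply)

lemma psi_plus:
  assumes "z \<in> carrier XY" "\<alpha> \<in> carrier E" "\<beta> \<in> carrier E"
  shows "psi z (\<alpha> \<oplus>\<^bsub>E\<^esub> \<beta>) = psi z \<alpha> \<oplus> psi z \<beta>"
  using assms(1)
  by (induction z rule: XY_induct)
     (simp_all add: assms additive_map_add[OF psi_additive] M.l_distr M.add.m_ac E_plus_apply)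

text \<open>This and \<open>E_scale_right\<close> are the two \<open>R\<close>-actions on
  \<open>A\<close>, by composing s(r) or t(r) after an endomorphism. They are written pointwise so
  as to be available before the bialgebroid is set up; \<open>src_mult\<close> and
  \<open>tgt_mult\<close> identify them later.\<close>

definition E_scale_left :: "'m \<Rightarrow> ('m \<Rightarrow> 'm) \<Rightarrow> 'm \<Rightarrow> 'm" where
  "E_scale_left r \<alpha> = (\<lambda>m\<in>carrier M. r \<otimes> \<alpha> m)"

definition E_scale_right :: "'m \<Rightarrow> ('m \<Rightarrow> 'm) \<Rightarrow> 'm \<Rightarrow> 'm" where
  "E_scale_right r \<alpha> = (\<lambda>m\<in>carrier M. \<alpha> m \<otimes> r)"

lemma E_scale_left [simp]: "r \<in> carrier R \<Longrightarrow> \<alpha> \<in> carrier E \<Longrightarrow> E_scale_left r \<alpha> \<in> carrier E"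
  unfolding E_scale_left_def by (intro E_restrictI right_linear_mult left_linear_mult_R) simp_all

lemma E_scale_right [simp]: "r \<in> carrier R \<Longrightarrow> \<alpha> \<in> carrier E \<Longrightarrow> E_scale_right r \<alpha> \<in> carrier E"
  unfolding E_scale_right_def by (intro E_restrictI right_linear_mult_R left_linear_mult) simp_all

lemma E_scale_left_apply: "m \<in> carrier M \<Longrightarrow> E_scale_left r \<alpha> m = r \<otimes> \<alpha> m"
  by (simp add: E_scale_left_def)

lemma E_scale_right_apply: "m \<in> carrier M \<Longrightarrow> E_scale_right r \<alpha> m = \<alpha> m \<otimes> r"
  by (simp add: E_scale_right_def)

lemma E_scale_left_plus:
  "\<alpha> \<in> carrier E \<Longrightarrow> \<gamma> \<in> carrier E \<Longrightarrow> r \<in> carrier M \<Longrightarrow>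
     E_scale_left r (\<alpha> \<oplus>\<^bsub>E\<^esub> \<gamma>) = E_scale_left r \<alpha> \<oplus>\<^bsub>E\<^esub> E_scale_left r \<gamma>"
  by (auto simp: E_scale_left_def E_simps M.r_distr)

lemma E_scale_right_plus:
  "\<alpha> \<in> carrier E \<Longrightarrow> \<gamma> \<in> carrier E \<Longrightarrow> r \<in> carrier M \<Longrightarrow>
     E_scale_right r (\<alpha> \<oplus>\<^bsub>E\<^esub> \<gamma>) = E_scale_right r \<alpha> \<oplus>\<^bsub>E\<^esub> E_scale_right r \<gamma>"
  by (auto simp: E_scale_right_def E_simps M.l_distr)

lemma E_scale_left_add:
  "\<alpha> \<in> carrier E \<Longrightarrow> r \<in> carrier M \<Longrightarrow> s \<in> carrier M \<Longrightarrow>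
     E_scale_left (r \<oplus> s) \<alpha> = E_scale_left r \<alpha> \<oplus>\<^bsub>E\<^esub> E_scale_left s \<alpha>"
  by (auto simp: E_scale_left_def E_simps M.l_distr)

lemma E_scale_right_add:
  "\<alpha> \<in> carrier E \<Longrightarrow> r \<in> carrier M \<Longrightarrow> s \<in> carrier M \<Longrightarrow>
     E_scale_right (r \<oplus> s) \<alpha> = E_scale_right r \<alpha> \<oplus>\<^bsub>E\<^esub> E_scale_right s \<alpha>"
  by (auto simp: E_scale_right_def E_simps M.r_distr)

lemma E_scale_left_scale: "\<alpha> \<in> carrier E \<Longrightarrow> r \<in> carrier M \<Longrightarrow> s \<in> carrier M \<Longrightarrow>
     E_scale_left r (E_scale_left s \<alpha>) = E_scale_left (r \<otimes> s) \<alpha>"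
  by (auto simp: E_scale_left_def M.m_assoc)

text \<open>The order of the scalars reverses because t is a homomorphism from the opposite
  ring.\<close>

lemma E_scale_right_scale: "\<alpha> \<in> carrier E \<Longrightarrow> r \<in> carrier M \<Longrightarrow> s \<in> carrier M \<Longrightarrow>
     E_scale_right r (E_scale_right s \<alpha>) = E_scale_right (s \<otimes> r) \<alpha>"
  by (auto simp: E_scale_right_def M.m_assoc)

lemma phi_scale_right:
  assumes "z \<in> carrier XY" "\<alpha> \<in> carrier E" "r \<in> carrier R"
  shows "phi z (E_scale_right r \<alpha>) = phi z \<alpha> \<otimes> r"
  using assms(1)
  by (induction z rule: XY_induct)
     (simp_all add: assms additive_map_add[OF phi_additive] M.m_assoc M.l_distr, simp add: E_scale_right_def)

lemma psi_scale_left: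
  assumes "z \<in> carrier XY" "\<alpha> \<in> carrier E" "r \<in> carrier R"
  shows "psi z (E_scale_left r \<alpha>) = r \<otimes> psi z \<alpha>"
  using assms(1)
  by (induction z rule: XY_induct)
     (simp_all add: assms additive_map_add[OF psi_additive] M.m_assoc M.r_distr, simp add: E_scale_left_def M.m_assoc assms)

lemma B_finsum:
  assumes "finite I" "\<And>i. i \<in> I \<Longrightarrow> c i \<in> carrier B"
  shows "(\<Oplus>\<^bsub>XY\<^esub>i\<in>I. c i) \<in> carrier B"
proof -
  interpret B: abelian_group B by (rule B_ab)
  have "(\<Oplus>\<^bsub>B\<^esub>i\<in>I. c i) = (\<Oplus>\<^bsub>XY\<^esub>i\<in>I. c i)"
    using additive_map_finsum[OF B_ab XY_ab _ assms, of "\<lambda>x. x"]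
    by (simp add: additive_map_def B_simps)
  moreover have "(\<Oplus>\<^bsub>B\<^esub>i\<in>I. c i) \<in> carrier B" using assms by (intro B.finsum_closed) auto
  ultimately show ?thesis by simp
qed

lemma E_comp_mult_linear:
  assumes "\<alpha> \<in> carrier E" "m \<in> carrier M"
  shows "right_linear (\<lambda>x. \<alpha> (m \<otimes> x))" "left_linear (\<lambda>y. \<alpha> (y \<otimes> m))"
  using assms right_linear_comp[of \<alpha> "\<lambda>x. m \<otimes> x"] left_linear_comp[of \<alpha> "\<lambda>x. x \<otimes> m"] by simp_all

text \<open>Pairing d^1 c d^2 with \<alpha> gives d^1 c^1 \<alpha>(c^2 d^2). Balancedness of the
  outer map is exported because the comparison with the product of the right dual is made on the
  legs of \<open>d\<close>.\<close>

lemma phi_mult: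
  assumes "c \<in> carrier B" "d \<in> carrier B" "\<alpha> \<in> carrier E"
  shows "phi (c \<otimes>\<^bsub>B\<^esub> d) \<alpha> = LM (\<lambda>x' y'. x' \<otimes> LM (\<lambda>x y. x \<otimes> \<alpha> (y \<otimes> y')) c) d"
    and "T.balanced M (\<lambda>x' y'. x' \<otimes> LM (\<lambda>x y. x \<otimes> \<alpha> (y \<otimes> y')) c)"
proof -
  have *: "x' \<otimes> LM (\<lambda>x y. x \<otimes> \<alpha> (y \<otimes> y')) c = phi (lm x' (rm c y')) \<alpha>"
    if "x' \<in> carrier M" "y' \<in> carrier M" for x' y'
    using that assms by (simp add: phi_lm) (simp add: phi_def lift_rm[OF M_ab])
  have b: "T.balanced M (\<lambda>x y. phi (lm x (rm c y)) \<alpha>)"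
    by (rule T.balanced_comp[OF balanced_lm_rm[OF assms(1)] phi_additive[OF assms(3)]])
  show "T.balanced M (\<lambda>x' y'. x' \<otimes> LM (\<lambda>x y. x \<otimes> \<alpha> (y \<otimes> y')) c)"
    by (rule T.balanced_cong[OF b]) (simp add: *)
  have "phi (c \<otimes>\<^bsub>B\<^esub> d) \<alpha> = LM (\<lambda>x y. phi (lm x (rm c y)) \<alpha>) d"
    unfolding B_mult_eq[OF assms(1) B_XY[OF assms(2)]]
    by (rule T.lift_comp[OF XY_ab balanced_lm_rm[OF assms(1)] M_ab phi_additive[OF assms(3)] B_XY[OF assms(2)]])
  also have "\<dots> = LM (\<lambda>x' y'. x' \<otimes> LM (\<lambda>x y. x \<otimes> \<alpha> (y \<otimes> y')) c) d"
    using assms * by (intro lift_cong_M[symmetric, OF M_ab b]) simp_all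
  finally show "phi (c \<otimes>\<^bsub>B\<^esub> d) \<alpha> = LM (\<lambda>x' y'. x' \<otimes> LM (\<lambda>x y. x \<otimes> \<alpha> (y \<otimes> y')) c) d" .
qed

text \<open>Mirror image of \<open>phi_mult\<close>: pairing d^1 c d^2 with \<alpha> gives
  \<alpha>(d^1 c^1) c^2 d^2.\<close>

lemma psi_mult:
  assumes "c \<in> carrier B" "d \<in> carrier B" "\<alpha> \<in> carrier E"
  shows "psi (c \<otimes>\<^bsub>B\<^esub> d) \<alpha> = LM (\<lambda>x' y'. LM (\<lambda>x y. \<alpha> (x' \<otimes> x) \<otimes> y) c \<otimes> y') d"
    and "T.balanced M (\<lambda>x' y'. LM (\<lambda>x y. \<alpha> (x' \<otimes> x) \<otimes> y) c \<otimes> y')"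
proof -
  have *: "LM (\<lambda>x y. \<alpha> (x' \<otimes> x) \<otimes> y) c \<otimes> y' = psi (lm x' (rm c y')) \<alpha>"
    if "x' \<in> carrier M" "y' \<in> carrier M" for x' y'
    using that assms by (simp add: lm_rm psi_rm) (simp add: psi_def lift_lm[OF M_ab])
  have b: "T.balanced M (\<lambda>x y. psi (lm x (rm c y)) \<alpha>)"
    by (rule T.balanced_comp[OF balanced_lm_rm[OF assms(1)] psi_additive[OF assms(3)]])
  show "T.balanced M (\<lambda>x' y'. LM (\<lambda>x y. \<alpha> (x' \<otimes> x) \<otimes> y) c \<otimes> y')"
    by (rule T.balanced_cong[OF b]) (simp add: *)
  have "psi (c \<otimes>\<^bsub>B\<^esub> d) \<alpha> = LM (\<lambda>x y. psi (lm x (rm c y)) \<alpha>) d"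
    unfolding B_mult_eq[OF assms(1) B_XY[OF assms(2)]]
    by (rule T.lift_comp[OF XY_ab balanced_lm_rm[OF assms(1)] M_ab psi_additive[OF assms(3)] B_XY[OF assms(2)]])
  also have "\<dots> = LM (\<lambda>x' y'. LM (\<lambda>x y. \<alpha> (x' \<otimes> x) \<otimes> y) c \<otimes> y') d"
    using assms * by (intro lift_cong_M[symmetric, OF M_ab b]) simp_all
  finally show "psi (c \<otimes>\<^bsub>B\<^esub> d) \<alpha> = LM (\<lambda>x' y'. LM (\<lambda>x y. \<alpha> (x' \<otimes> x) \<otimes> y) c \<otimes> y') d" .
qed

end

section \<open>Left quasibases\<close>

locale left_quasibasis = ring_ext N M \<eta>
  for N :: "('n, 'p) ring_scheme" and M :: "('m, 'q) ring_scheme" (structure) and \<eta> :: "'n \<Rightarrow> 'm" +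
  fixes k :: nat and b :: "nat \<Rightarrow> ('m, 'm) tens" and \<beta> :: "nat \<Rightarrow> 'm \<Rightarrow> 'm"
  assumes quasibasis: "left_D2_quasibasis N M \<eta> k b \<beta>"
begin

lemma b_B [simp]: "i < k \<Longrightarrow> b i \<in> carrier B"
  and beta_E [simp]: "i < k \<Longrightarrow> \<beta> i \<in> carrier E"
  using quasibasis by (simp_all add: left_D2_quasibasis_def)

lemma quasibasis_sum: "m \<in> carrier M \<Longrightarrow> (\<Oplus>\<^bsub>XY\<^esub>i\<in>{..<k}. rm (b i) (\<beta> i m)) = pt m \<one>"
  using quasibasis by (simp add: left_D2_quasibasis_def MN_def NM_def rm_def)

text \<open>A contraction that is right \<open>M\<close>-linear in the second leg can be applied to
  the quasibasis identity, and the factor \<open>\<beta> i m\<close> comes out on the right.\<close>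

lemma quasibasis_lift:
  assumes "T.balanced M \<phi>" "m \<in> carrier M"
    "\<And>x y m. x \<in> carrier M \<Longrightarrow> y \<in> carrier M \<Longrightarrow> m \<in> carrier M \<Longrightarrow> \<phi> x (y \<otimes> m) = \<phi> x y \<otimes> m"
  shows "(\<Oplus>i\<in>{..<k}. LM \<phi> (b i) \<otimes> \<beta> i m) = \<phi> m \<one>"
proof -
  have "(\<Oplus>i\<in>{..<k}. LM \<phi> (b i) \<otimes> \<beta> i m) = (\<Oplus>i\<in>{..<k}. LM \<phi> (rm (b i) (\<beta> i m)))"
    using assms by (intro M.finsum_cong_all) (simp_all add: lift_homogeneous_right T.lift_closed[OF M_ab])
  also have "\<dots> = LM \<phi> (\<Oplus>\<^bsub>XY\<^esub>i\<in>{..<k}. rm (b i) (\<beta> i m))"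
    by (rule additive_map_finsum[OF XY_ab M_ab T.lift_additive[OF M_ab assms(1)], symmetric])
       (simp_all add: assms(2))
  also have "\<dots> = \<phi> m \<one>" using assms(2) by (simp add: quasibasis_sum lift_pt[OF M_ab assms(1)])
  finally show ?thesis .
qed

text \<open>For c = c^1 \<otimes> c^2 the i-th term is b_i \<beta>_i(c^1) g(c^2), so the quasibasis
  identity at m = c^1, multiplied on the right by g(c^2), gives c^1 \<otimes> g(c^2). With g the
  identity it inverts \<psi>; with g an endomorphism it computes the coproduct pairing for
  \<phi>.\<close>

lemma quasibasis_expand:
  assumes "left_linear g" "c \<in> carrier XY"
  shows "(\<Oplus>\<^bsub>XY\<^esub>i\<in>{..<k}. rm (b i) (LM (\<lambda>x y. \<beta> i x \<otimes> g y) c)) = LT (\<lambda>x y. pt x (g y)) c"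
proof -
  have g: "g y \<in> carrier M" if "y \<in> carrier M" for y
    using assms(1) that by (simp add: left_linear_def additive_map_def)
  have ad: "additive_map M XY (rm (b i))" if "i < k" for i
    using that by (simp add: additive_map_def rm_add_right)
  have bal: "T.balanced XY (\<lambda>x y. rm (b i) (\<beta> i x \<otimes> g y))" if "i \<in> {..<k}" for i
    using that assms(1) by (intro T.balanced_comp[OF balanced_mult ad]) simp_all
  have "(\<Oplus>\<^bsub>XY\<^esub>i\<in>{..<k}. rm (b i) (LM (\<lambda>x y. \<beta> i x \<otimes> g y) c)) =
      (\<Oplus>\<^bsub>XY\<^esub>i\<in>{..<k}. LT (\<lambda>x y. rm (b i) (\<beta> i x \<otimes> g y)) c)"
    using assms by (intro T.XY.finsum_cong_all T.lift_comp[OF M_ab balanced_mult XY_ab ad])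
       (simp_all add: T.lift_closed[OF XY_ab bal])
  also have "\<dots> = LT (\<lambda>x y. \<Oplus>\<^bsub>XY\<^esub>i\<in>{..<k}. rm (b i) (\<beta> i x \<otimes> g y)) c"
    by (rule T.lift_finsum(1)[OF XY_ab _ bal assms(2), symmetric]) simp_all
  also have "\<dots> = LT (\<lambda>x y. pt x (g y)) c"
  proof (rule lift_cong_M[OF XY_ab balanced_pt assms(2)])
    fix x y assume xy: "x \<in> carrier M" "y \<in> carrier M"
    have "(\<Oplus>\<^bsub>XY\<^esub>i\<in>{..<k}. rm (b i) (\<beta> i x \<otimes> g y)) = (\<Oplus>\<^bsub>XY\<^esub>i\<in>{..<k}. rm (rm (b i) (\<beta> i x)) (g y))"
      using xy g by (intro T.XY.finsum_cong_all) (simp_all add: rm_rm)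
    also have "\<dots> = rm (\<Oplus>\<^bsub>XY\<^esub>i\<in>{..<k}. rm (b i) (\<beta> i x)) (g y)"
      by (rule additive_map_finsum[OF XY_ab XY_ab rm_additive, symmetric]) (simp_all add: xy g)
    also have "\<dots> = pt x (g y)" using xy g by (simp add: quasibasis_sum)
    finally show "(\<Oplus>\<^bsub>XY\<^esub>i\<in>{..<k}. rm (b i) (\<beta> i x \<otimes> g y)) = pt x (g y)" .
  qed (simp_all add: assms(1))
  finally show ?thesis .
qed

lemma psi_reconstruct: "c \<in> carrier XY \<Longrightarrow> (\<Oplus>\<^bsub>XY\<^esub>i\<in>{..<k}. rm (b i) (psi c (\<beta> i))) = c"
  using quasibasis_expand[of "\<lambda>x. x" c] by (simp add: psi_def T.lift_id)

text \<open>The left tensor factor of the i-th summand in the coproduct of \<open>A\<close>; the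
  right factor is \<open>\<beta> i\<close>.\<close>

definition cop :: "('m \<Rightarrow> 'm) \<Rightarrow> nat \<Rightarrow> 'm \<Rightarrow> 'm" where
  "cop \<alpha> i = (\<lambda>m\<in>carrier M. LM (\<lambda>x y. \<alpha> (m \<otimes> x) \<otimes> y) (b i))"

text \<open>The argument m \<eta>(n) sends \<eta>(n) to the first leg of \<open>b i\<close>;
  centrality carries it to the second leg, where it leaves as a right factor. Left linearity is
  inherited from \<alpha>.\<close>

lemma cop_E [simp]:
  assumes "\<alpha> \<in> carrier E" "i < k"
  shows "cop \<alpha> i \<in> carrier E"
proof -
  have bal: "T.balanced M (\<lambda>x y. \<alpha> (m \<otimes> x) \<otimes> y)" if "m \<in> carrier M" for m
    using assms that by (intro balanced_mult E_comp_mult_linear) simp_all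
  have add: "additive_map M M (\<lambda>m. LM (\<lambda>x y. \<alpha> (m \<otimes> x) \<otimes> y) (b i))"
  proof (rule additive_mapI)
    fix m m' assume m: "m \<in> carrier M" "m' \<in> carrier M"
    have "LM (\<lambda>x y. \<alpha> ((m \<oplus> m') \<otimes> x) \<otimes> y) (b i) =
       LM (\<lambda>x y. \<alpha> (m \<otimes> x) \<otimes> y \<oplus> \<alpha> (m' \<otimes> x) \<otimes> y) (b i)"
      by (rule lift_cong_M[symmetric, OF M_ab bal]) (use m assms in \<open>simp_all add: M.l_distr E_add\<close>)
    also have "\<dots> = LM (\<lambda>x y. \<alpha> (m \<otimes> x) \<otimes> y) (b i) \<oplus> LM (\<lambda>x y. \<alpha> (m' \<otimes> x) \<otimes> y) (b i)"
      using assms(2) by (intro T.lift_add M_ab bal m) simp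
    finally show "LM (\<lambda>x y. \<alpha> ((m \<oplus> m') \<otimes> x) \<otimes> y) (b i) =
       LM (\<lambda>x y. \<alpha> (m \<otimes> x) \<otimes> y) (b i) \<oplus> LM (\<lambda>x y. \<alpha> (m' \<otimes> x) \<otimes> y) (b i)" .
  qed (use assms(2) in \<open>simp add: T.lift_closed[OF M_ab bal]\<close>)
  show ?thesis
    unfolding cop_def
  proof (rule E_restrictI; unfold right_linear_def left_linear_def; intro conjI add ballI)
    fix m n assume mn: "m \<in> carrier M" "n \<in> carrier N"
    have "LM (\<lambda>x y. \<alpha> (m \<otimes> \<eta> n \<otimes> x) \<otimes> y) (b i) = LM (\<lambda>x y. \<alpha> (m \<otimes> (\<eta> n \<otimes> x)) \<otimes> y) (b i)"
      by (rule lift_cong_M[symmetric, OF M_ab bal]) (use mn assms in \<open>simp_all add: M.m_assoc\<close>)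
    also have "\<dots> = LM (\<lambda>x y. \<alpha> (m \<otimes> x) \<otimes> y) (lm (\<eta> n) (b i))"
      using mn assms bal by (simp add: lift_lm[OF M_ab])
    also have "\<dots> = LM (\<lambda>x y. \<alpha> (m \<otimes> x) \<otimes> y) (b i) \<otimes> \<eta> n"
      using mn assms bal by (simp add: B_comm lift_homogeneous_right M.m_assoc)
    finally show "LM (\<lambda>x y. \<alpha> (m \<otimes> \<eta> n \<otimes> x) \<otimes> y) (b i) = LM (\<lambda>x y. \<alpha> (m \<otimes> x) \<otimes> y) (b i) \<otimes> \<eta> n" .
  next
    fix m n assume mn: "m \<in> carrier M" "n \<in> carrier N"
    show "LM (\<lambda>x y. \<alpha> (\<eta> n \<otimes> m \<otimes> x) \<otimes> y) (b i) = \<eta> n \<otimes> LM (\<lambda>x y. \<alpha> (m \<otimes> x) \<otimes> y) (b i)"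
      unfolding LM_mult_left[OF bal[OF mn(1)] B_XY[OF b_B[OF assms(2)]] eta_closed[OF mn(2)]]
      by (rule lift_cong_M[symmetric, OF M_ab bal]) (use mn assms in \<open>simp_all add: M.m_assoc E_left\<close>)
  qed
qed

text \<open>In coproduct notation, \<alpha>_(1)(y) \<alpha>_(2)(m) = \<alpha>(y m). The
  multiplications of both duals meet the coproduct of \<open>A\<close> in this form.\<close>

lemma cop_sum:
  assumes "\<alpha> \<in> carrier E" "y \<in> carrier M" "m \<in> carrier M"
  shows "(\<Oplus>i\<in>{..<k}. cop \<alpha> i y \<otimes> \<beta> i m) = \<alpha> (y \<otimes> m)"
  using quasibasis_lift[of "\<lambda>x z. \<alpha> (y \<otimes> x) \<otimes> z" m] assms
  by (simp add: cop_def E_comp_mult_linear M.m_assoc)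

text \<open>This is s(<c, \<alpha>_(1)>) \<alpha>_(2) evaluated at m, the argument occurring in the
  product of the right dual. Under the lift its terms become c^1 \<alpha>_(1)(c^2) \<alpha>_(2)(m),
  and \<open>cop_sum\<close> applies.\<close>

lemma phi_cop_sum:
  assumes "\<alpha> \<in> carrier E" "c \<in> carrier B" "m \<in> carrier M"
  shows "(\<Oplus>i\<in>{..<k}. phi c (cop \<alpha> i) \<otimes> \<beta> i m) = LM (\<lambda>x y. x \<otimes> \<alpha> (y \<otimes> m)) c"
proof -
  have bal: "T.balanced M (\<lambda>x y. x \<otimes> cop \<alpha> i y \<otimes> \<beta> i m)" if "i \<in> {..<k}" for i
    using that assms T.balanced_comp[OF balanced_mult, of "\<lambda>x. x" "cop \<alpha> i" M "\<lambda>z. z \<otimes> \<beta> i m"]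
    by (simp add: additive_map_def M.l_distr)
  have "(\<Oplus>i\<in>{..<k}. phi c (cop \<alpha> i) \<otimes> \<beta> i m) = (\<Oplus>i\<in>{..<k}. LM (\<lambda>x y. x \<otimes> cop \<alpha> i y \<otimes> \<beta> i m) c)"
    unfolding phi_def using assms bal
    by (intro M.finsum_cong_all LM_mult_right) (simp_all add: T.lift_closed[OF M_ab])
  also have "\<dots> = LM (\<lambda>x y. \<Oplus>i\<in>{..<k}. x \<otimes> cop \<alpha> i y \<otimes> \<beta> i m) c"
    using assms by (intro T.lift_finsum(1)[OF M_ab _ bal, symmetric]) simp_all
  also have "\<dots> = LM (\<lambda>x y. x \<otimes> \<alpha> (y \<otimes> m)) c"
  proof (rule lift_cong_M[OF M_ab])
    fix x y assume xy: "x \<in> carrier M" "y \<in> carrier M"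
    have "(\<Oplus>i\<in>{..<k}. x \<otimes> cop \<alpha> i y \<otimes> \<beta> i m) = (\<Oplus>i\<in>{..<k}. x \<otimes> (cop \<alpha> i y \<otimes> \<beta> i m))"
      using xy assms by (intro M.finsum_cong_all) (simp_all add: M.m_assoc)
    also have "\<dots> = x \<otimes> (\<Oplus>i\<in>{..<k}. cop \<alpha> i y \<otimes> \<beta> i m)"
      using xy assms by (intro additive_map_finsum[OF M_ab M_ab, symmetric]) (simp_all add: additive_map_def M.r_distr)
    finally show "(\<Oplus>i\<in>{..<k}. x \<otimes> cop \<alpha> i y \<otimes> \<beta> i m) = x \<otimes> \<alpha> (y \<otimes> m)"
      using xy assms by (simp add: cop_sum)
  qed (use assms in \<open>simp_all add: E_comp_mult_linear\<close>)
  finally show ?thesis .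
qed

text \<open>This is t([\<alpha>_(2), c]) \<alpha>_(1) evaluated at m, the argument occurring in the
  product of the left dual; here \<open>cop_sum\<close> applies to \<alpha>_(1)(m)
  \<alpha>_(2)(c^1), with c^2 as a right factor.\<close>

lemma psi_cop_sum:
  assumes "\<alpha> \<in> carrier E" "c \<in> carrier B" "m \<in> carrier M"
  shows "(\<Oplus>i\<in>{..<k}. cop \<alpha> i m \<otimes> psi c (\<beta> i)) = LM (\<lambda>x y. \<alpha> (m \<otimes> x) \<otimes> y) c"
proof -
  have bal: "T.balanced M (\<lambda>x y. cop \<alpha> i m \<otimes> (\<beta> i x \<otimes> y))" if "i \<in> {..<k}" for i
    using that assms T.balanced_comp[OF balanced_mult, of "\<beta> i" "\<lambda>x. x" M "\<lambda>z. cop \<alpha> i m \<otimes> z"]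
    by (simp add: additive_map_def M.r_distr)
  have "(\<Oplus>i\<in>{..<k}. cop \<alpha> i m \<otimes> psi c (\<beta> i)) = (\<Oplus>i\<in>{..<k}. LM (\<lambda>x y. cop \<alpha> i m \<otimes> (\<beta> i x \<otimes> y)) c)"
    unfolding psi_def using assms bal
    by (intro M.finsum_cong_all LM_mult_left) (simp_all add: T.lift_closed[OF M_ab])
  also have "\<dots> = LM (\<lambda>x y. \<Oplus>i\<in>{..<k}. cop \<alpha> i m \<otimes> (\<beta> i x \<otimes> y)) c"
    using assms by (intro T.lift_finsum(1)[OF M_ab _ bal, symmetric]) simp_all
  also have "\<dots> = LM (\<lambda>x y. \<alpha> (m \<otimes> x) \<otimes> y) c"
  proof (rule lift_cong_M[OF M_ab])
    fix x y assume xy: "x \<in> carrier M" "y \<in> carrier M"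
    have "(\<Oplus>i\<in>{..<k}. cop \<alpha> i m \<otimes> (\<beta> i x \<otimes> y)) = (\<Oplus>i\<in>{..<k}. (cop \<alpha> i m \<otimes> \<beta> i x) \<otimes> y)"
      using xy assms by (intro M.finsum_cong_all) (simp_all add: M.m_assoc)
    also have "\<dots> = (\<Oplus>i\<in>{..<k}. cop \<alpha> i m \<otimes> \<beta> i x) \<otimes> y"
      using xy assms by (intro additive_map_finsum[OF M_ab M_ab, symmetric, where h = "\<lambda>z. z \<otimes> y"])
         (simp_all add: additive_map_def M.l_distr)
    finally show "(\<Oplus>i\<in>{..<k}. cop \<alpha> i m \<otimes> (\<beta> i x \<otimes> y)) = \<alpha> (m \<otimes> x) \<otimes> y"
      using xy assms by (simp add: cop_sum)
  qed (use assms in \<open>simp_all add: E_comp_mult_linear\<close>)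
  finally show ?thesis .
qed

end

section \<open>The bialgebroid structures and their tensor squares\<close>

lemma left_bimod_simps [simp]:
  "carrier (left_bimod H s t) = carrier H" "\<zero>\<^bsub>left_bimod H s t\<^esub> = \<zero>\<^bsub>H\<^esub>"
  "add (left_bimod H s t) = add H"
  "lact (left_bimod H s t) r a = s r \<otimes>\<^bsub>H\<^esub> a" "ract (left_bimod H s t) a r = t r \<otimes>\<^bsub>H\<^esub> a"
  by (simp_all add: left_bimod_def)

lemma right_bimod_simps [simp]:
  "carrier (right_bimod H s t) = carrier H" "\<zero>\<^bsub>right_bimod H s t\<^esub> = \<zero>\<^bsub>H\<^esub>"
  "add (right_bimod H s t) = add H"
  "lact (right_bimod H s t) r a = a \<otimes>\<^bsub>H\<^esub> t r" "ract (right_bimod H s t) a r = a \<otimes>\<^bsub>H\<^esub> s r"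
  by (simp_all add: right_bimod_def)

text \<open>The relators involve the inner actions only at elements of the carriers. This matters
  for a dual, where multiplying by source or target agrees with the explicit action only
  there.\<close>

lemma tensor_rel_cong:
  assumes "carrier X = carrier X'" "add X = add X'" "carrier Y = carrier Y'" "add Y = add Y'"
    and "\<And>x r. x \<in> carrier X \<Longrightarrow> r \<in> carrier R \<Longrightarrow> ract X x r = ract X' x r"
    and "\<And>y r. y \<in> carrier Y \<Longrightarrow> r \<in> carrier R \<Longrightarrow> lact Y r y = lact Y' r y"
  shows "tensor_rel R X Y = tensor_rel R X' Y'"
proof -
  have *: "{frag_of (ract X x r, y) - frag_of (x, lact Y r y) | x r y.
         x \<in> carrier X \<and> r \<in> carrier R \<and> y \<in> carrier Y} =
     {frag_of (ract X' x r, y) - frag_of (x, lact Y' r y) | x r y.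
         x \<in> carrier X' \<and> r \<in> carrier R \<and> y \<in> carrier Y'}"
    unfolding assms(1,3)[symmetric] using assms(5,6) by (intro Collect_cong) (metis)
  show ?thesis
    unfolding tensor_rel_def * by (simp add: assms(1-4))
qed

lemma tensor_cong:
  assumes "carrier X = carrier X'" "add X = add X'" "carrier Y = carrier Y'" "add Y = add Y'"
    and "\<And>x r. x \<in> carrier X \<Longrightarrow> r \<in> carrier R \<Longrightarrow> ract X x r = ract X' x r"
    and "\<And>y r. y \<in> carrier Y \<Longrightarrow> r \<in> carrier R \<Longrightarrow> lact Y r y = lact Y' r y"
  shows "tensor_ab R X Y = tensor_ab R X' Y'" "pure_tensor R X Y = pure_tensor R X' Y'"
proof -
  have rel: "tensor_rel R X Y = tensor_rel R X' Y'"
    by (rule tensor_rel_cong[OF assms])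
  show "tensor_ab R X Y = tensor_ab R X' Y'" "pure_tensor R X Y = pure_tensor R X' Y'"
    by (simp_all add: rel assms(1,3) tensor_ab_def tensor_grp_def pure_tensor_def fun_eq_iff)
qed

context left_quasibasis
begin

abbreviation "A \<equiv> D2_left_bialgebroid N M \<eta> k b \<beta>"
abbreviation "BB \<equiv> D2_right_bialgebroid N M \<eta> k b \<beta>"
abbreviation "AL \<equiv> left_bimod_of A"
abbreviation "BR \<equiv> right_bimod_of BB"

lemma A_simps [simp]:
  "carrier A = carrier E" "\<zero>\<^bsub>A\<^esub> = \<zero>\<^bsub>E\<^esub>" "\<one>\<^bsub>A\<^esub> = \<one>\<^bsub>E\<^esub>" "add A = add E" "monoid.mult A = monoid.mult E"
  "counit A \<alpha> = \<alpha> \<one>"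
  by (simp_all add: D2_left_bialgebroid_def Let_def)

lemma A_src_tgt: "src A r = (\<lambda>m\<in>carrier M. r \<otimes> m)" "tgt A r = (\<lambda>m\<in>carrier M. m \<otimes> r)"
  by (simp_all add: D2_left_bialgebroid_def Let_def)

lemma A_coprod: "coprod A \<alpha> = (\<Oplus>\<^bsub>tensor_ab R AL AL\<^esub>i\<in>{..<k}. pure_tensor R AL AL (cop \<alpha> i) (\<beta> i))"
proof -
  have "AL = left_bimod E (\<lambda>r. \<lambda>m\<in>carrier M. r \<otimes> m) (\<lambda>r. \<lambda>m\<in>carrier M. m \<otimes> r)"
    by (simp add: left_bimod_def A_src_tgt[abs_def])
  then show ?thesis
    by (simp add: D2_left_bialgebroid_def Let_def cop_def MN_def NM_def)
qed

lemma src_mult [simp]: "\<alpha> \<in> carrier E \<Longrightarrow> src A r \<otimes>\<^bsub>E\<^esub> \<alpha> = E_scale_left r \<alpha>"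
  by (auto simp: E_simps A_src_tgt E_scale_left_def)

lemma tgt_mult [simp]: "\<alpha> \<in> carrier E \<Longrightarrow> tgt A r \<otimes>\<^bsub>E\<^esub> \<alpha> = E_scale_right r \<alpha>"
  by (auto simp: E_simps A_src_tgt E_scale_right_def)

lemma src_E [simp]: "r \<in> carrier R \<Longrightarrow> src A r \<in> carrier E"
  unfolding A_src_tgt by (intro E_restrictI left_linear_mult_R) simp_all

lemma tgt_E [simp]: "r \<in> carrier R \<Longrightarrow> tgt A r \<in> carrier E"
  unfolding A_src_tgt by (intro E_restrictI right_linear_mult_R) simp_all

lemma A_ab: "abelian_group A"
  by (rule abelian_group_eqI[OF E_ab]) simp_all

sublocale AL: tensor_pair R AL AL
  by (rule tensor_pair.intro; (rule abelian_group_eqI[OF E_ab])?; simp)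

lemma BB_simps [simp]:
  "carrier BB = carrier B" "\<zero>\<^bsub>BB\<^esub> = \<zero>\<^bsub>XY\<^esub>" "\<one>\<^bsub>BB\<^esub> = pt \<one> \<one>" "add BB = add XY"
  "monoid.mult BB = monoid.mult B" "src BB r = pt \<one> r" "tgt BB r = pt r \<one>"
  by (simp_all add: D2_right_bialgebroid_def Let_def B_simps MN_def NM_def)

lemma BB_counit: "counit BB = LM (\<lambda>x y. x \<otimes> y)"
  by (simp add: D2_right_bialgebroid_def Let_def MN_def NM_def)

text \<open>For d = 1 \<otimes> r the product d^1 c d^2 is c r. With \<open>B_mult_tgt\<close>, this
  turns the bimodule structure that source and target put on \<open>B\<close> into outer
  multiplication.\<close>

lemma B_mult_src [simp]: "c \<in> carrier B \<Longrightarrow> r \<in> carrier R \<Longrightarrow> c \<otimes>\<^bsub>B\<^esub> pt \<one> r = rm c r"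
  by (simp add: B_mult_eq lift_pt[OF XY_ab balanced_lm_rm])

lemma B_mult_tgt [simp]: "c \<in> carrier B \<Longrightarrow> r \<in> carrier R \<Longrightarrow> c \<otimes>\<^bsub>B\<^esub> pt r \<one> = lm r c"
  by (simp add: B_mult_eq lift_pt[OF XY_ab balanced_lm_rm])

sublocale BR: tensor_pair R BR BR
  by (rule tensor_pair.intro; (rule abelian_group_eqI[OF B_ab])?; simp add: B_simps)

text \<open>The right tensor factor of the i-th summand in the coproduct of \<open>B\<close>; the
  left factor is \<open>b i\<close>.\<close>

definition bcop :: "('m, 'm) tens \<Rightarrow> nat \<Rightarrow> ('m, 'm) tens" where
  "bcop c i = LT (\<lambda>x y. pt (\<beta> i x) y) c"

lemma bcop_B [simp]: "c \<in> carrier B \<Longrightarrow> i < k \<Longrightarrow> bcop c i \<in> carrier B"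
  unfolding bcop_def by (rule liftT_B) (simp_all add: E_left)

lemma BB_coprod: "coprod BB c = (\<Oplus>\<^bsub>tensor_ab R BR BR\<^esub>i\<in>{..<k}. pure_tensor R BR BR (b i) (bcop c i))"
proof -
  have "BR = right_bimod B (\<lambda>r. pt \<one> r) (\<lambda>r. pt r \<one>)"
    by (simp add: right_bimod_def B_simps)
  then show ?thesis
    by (simp add: D2_right_bialgebroid_def Let_def bcop_def MN_def NM_def)
qed

lemma lift_coprod_A:
  assumes "\<alpha> \<in> carrier E" "AL.balanced A \<phi>"
  shows "tensor_lift R AL AL A \<phi> (coprod A \<alpha>) = (\<Oplus>\<^bsub>E\<^esub>i\<in>{..<k}. \<phi> (cop \<alpha> i) (\<beta> i))"
  unfolding A_coprod
  by (subst AL.lift_sum[OF A_ab assms(2)]) (simp_all add: assms(1) finsum_eqI[of A E])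

lemma bcop_phi: "c \<in> carrier B \<Longrightarrow> i < k \<Longrightarrow> \<alpha> \<in> carrier E \<Longrightarrow>
    phi (bcop c i) \<alpha> = LM (\<lambda>x y. \<beta> i x \<otimes> \<alpha> y) c"
  unfolding bcop_def
  by (subst T.lift_comp[OF XY_ab _ M_ab phi_additive]) (auto intro!: lift_cong_M[OF M_ab])

lemma bcop_psi: "c \<in> carrier B \<Longrightarrow> i < k \<Longrightarrow> \<alpha> \<in> carrier E \<Longrightarrow>
    psi (bcop c i) \<alpha> = LM (\<lambda>x y. \<alpha> (\<beta> i x) \<otimes> y) c"
  unfolding bcop_def
  by (subst T.lift_comp[OF XY_ab _ M_ab psi_additive])
     (auto intro!: lift_cong_M[OF M_ab] balanced_mult right_linear_comp[of \<alpha> "\<beta> i"])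

section \<open>The left dual\<close>

abbreviation "D \<equiv> left_dual_bimod R A"
abbreviation "C \<equiv> left_dual R A"
abbreviation "Psi \<equiv> (\<lambda>c. \<lambda>\<alpha>\<in>carrier E. psi c \<alpha>)"

lemma D_iff: "f \<in> carrier D \<longleftrightarrow> f \<in> carrier E \<rightarrow>\<^sub>E carrier R \<and>
    (\<forall>a\<in>carrier E. \<forall>a'\<in>carrier E. f (a \<oplus>\<^bsub>E\<^esub> a') = f a \<oplus> f a') \<and>
    (\<forall>a\<in>carrier E. \<forall>r\<in>carrier R. f (E_scale_left r a) = r \<otimes> f a)"
  by (simp add: left_dual_bimod_def)

lemma D_simps [simp]:
  "\<zero>\<^bsub>D\<^esub> = (\<lambda>a\<in>carrier E. \<zero>)" "f \<oplus>\<^bsub>D\<^esub> g = (\<lambda>a\<in>carrier E. f a \<oplus> g a)"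
  "lact D r f = (\<lambda>a\<in>carrier E. f (a \<otimes>\<^bsub>E\<^esub> src A r))" "ract D f r = (\<lambda>a\<in>carrier E. f a \<otimes> r)"
  by (simp_all add: left_dual_bimod_def)

lemma D_R [simp]: "f \<in> carrier D \<Longrightarrow> a \<in> carrier E \<Longrightarrow> f a \<in> carrier R"
  by (auto simp: D_iff)

lemma D_additive: "f \<in> carrier D \<Longrightarrow> additive_map E R f"
  by (simp add: additive_map_def) (simp add: D_iff)

lemma D_scale: "f \<in> carrier D \<Longrightarrow> a \<in> carrier E \<Longrightarrow> r \<in> carrier R \<Longrightarrow> f (E_scale_left r a) = r \<otimes> f a"
  by (simp add: D_iff)

lemma D_add: "f \<in> carrier D \<Longrightarrow> a \<in> carrier E \<Longrightarrow> a' \<in> carrier E \<Longrightarrow> f (a \<oplus>\<^bsub>E\<^esub> a') = f a \<oplus> f a'"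
  by (simp add: D_iff)

lemma D_ext: "f \<in> carrier D \<Longrightarrow> g \<in> carrier D \<Longrightarrow> (\<And>a. a \<in> carrier E \<Longrightarrow> f a = g a) \<Longrightarrow> f = g"
  by (rule PiE_ext[of _ "carrier E" "\<lambda>_. carrier R"]) (simp_all add: D_iff)

lemma D_I:
  assumes "\<And>a. a \<in> carrier E \<Longrightarrow> f a \<in> carrier R"
    "\<And>a a'. a \<in> carrier E \<Longrightarrow> a' \<in> carrier E \<Longrightarrow> f (a \<oplus>\<^bsub>E\<^esub> a') = f a \<oplus> f a'"
    "\<And>a r. a \<in> carrier E \<Longrightarrow> r \<in> carrier R \<Longrightarrow> f (E_scale_left r a) = r \<otimes> f a"
  shows "(\<lambda>a\<in>carrier E. f a) \<in> carrier D"
  using assms by (simp add: D_iff)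

lemma D_restrict [simp]: "f \<in> carrier D \<Longrightarrow> (\<lambda>a\<in>carrier E. f a) = f"
  by (simp add: D_iff PiE_def extensional_restrict)

lemma D_ab: "abelian_group D"
proof (rule abelian_groupI)
  fix f g assume f: "f \<in> carrier D" and g: "g \<in> carrier D"
  show "f \<oplus>\<^bsub>D\<^esub> g \<in> carrier D"
    unfolding D_simps by (rule D_I) (use f g in \<open>simp_all add: D_add D_scale M.r_distr M.a_ac\<close>)
  show "f \<oplus>\<^bsub>D\<^esub> g = g \<oplus>\<^bsub>D\<^esub> f"
    using f g by (auto simp: M.a_comm)
next
  show z: "\<zero>\<^bsub>D\<^esub> \<in> carrier D"
    unfolding D_simps by (rule D_I) (use R_ab[THEN abelian_groupE(2)] in simp_all)
  fix f assume f: "f \<in> carrier D"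
  show "\<zero>\<^bsub>D\<^esub> \<oplus>\<^bsub>D\<^esub> f = f"
  proof -
    have "\<zero>\<^bsub>D\<^esub> \<oplus>\<^bsub>D\<^esub> f = (\<lambda>a\<in>carrier E. f a)" using f by (auto simp del: D_restrict)
    then show ?thesis using f by simp
  qed
  have m: "\<ominus> r \<in> carrier R" if "r \<in> carrier R" for r
    using that by (simp add: R_iff M.l_minus M.r_minus)
  have "(\<lambda>a\<in>carrier E. \<ominus> f a) \<in> carrier D"
    by (rule D_I) (use f in \<open>simp_all add: m D_add D_scale M.minus_add M.r_minus M.a_comm\<close>)
  moreover have "(\<lambda>a\<in>carrier E. \<ominus> f a) \<oplus>\<^bsub>D\<^esub> f = \<zero>\<^bsub>D\<^esub>"
    using f by (auto simp: M.l_neg)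
  ultimately show "\<exists>g\<in>carrier D. g \<oplus>\<^bsub>D\<^esub> f = \<zero>\<^bsub>D\<^esub>" by blast
next
  fix f g h assume "f \<in> carrier D" "g \<in> carrier D" "h \<in> carrier D"
  then show "f \<oplus>\<^bsub>D\<^esub> g \<oplus>\<^bsub>D\<^esub> h = f \<oplus>\<^bsub>D\<^esub> (g \<oplus>\<^bsub>D\<^esub> h)"
    by (auto simp: M.a_assoc)
qed

lemma E_src_assoc:
  assumes "a \<in> carrier E" "r \<in> carrier R"
  shows "E_scale_left r' a \<otimes>\<^bsub>E\<^esub> src A r = E_scale_left r' (a \<otimes>\<^bsub>E\<^esub> src A r)"
    "(a \<oplus>\<^bsub>E\<^esub> a') \<otimes>\<^bsub>E\<^esub> src A r = (a \<otimes>\<^bsub>E\<^esub> src A r) \<oplus>\<^bsub>E\<^esub> (a' \<otimes>\<^bsub>E\<^esub> src A r)"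
  using assms by (auto simp: E_simps A_src_tgt E_scale_left_def)

lemma D_ract [simp]: "f \<in> carrier D \<Longrightarrow> r \<in> carrier R \<Longrightarrow> (\<lambda>a\<in>carrier E. f a \<otimes> r) \<in> carrier D"
  by (rule D_I) (simp_all add: D_add D_scale M.l_distr M.m_assoc)

lemma D_lact [simp]: "f \<in> carrier D \<Longrightarrow> r \<in> carrier R \<Longrightarrow>
    (\<lambda>a\<in>carrier E. f (a \<otimes>\<^bsub>E\<^esub> src A r)) \<in> carrier D"
  by (rule D_I) (simp_all add: E_src_assoc D_add D_scale)

sublocale D: tensor_pair R D D
  by (rule tensor_pair.intro[OF D_ab D_ab]) simp_all

lemma Psi_D [simp]: "c \<in> carrier B \<Longrightarrow> Psi c \<in> carrier D"
  by (rule D_I) (simp_all add: psi_plus psi_scale_left)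

lemma C_simps [simp]:
  "carrier C = carrier D" "add C = add D" "\<zero>\<^bsub>C\<^esub> = \<zero>\<^bsub>D\<^esub>"
  "\<one>\<^bsub>C\<^esub> = (\<lambda>a\<in>carrier E. a \<one>)"
  "src C r = (\<lambda>a\<in>carrier E. a \<one> \<otimes> r)" "tgt C r = (\<lambda>a\<in>carrier E. (a \<otimes>\<^bsub>E\<^esub> src A r) \<one>)"
  "counit C f = f \<one>\<^bsub>E\<^esub>"
  by (simp_all add: left_dual_def Let_def)

lemma C_mult: "f \<otimes>\<^bsub>C\<^esub> g = (\<lambda>a\<in>carrier E. g (tensor_lift R AL AL A
             (\<lambda>a\<^sub>1 a\<^sub>2. tgt A (f a\<^sub>2) \<otimes>\<^bsub>E\<^esub> a\<^sub>1) (coprod A a)))"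
  by (simp add: left_dual_def Let_def)

text \<open>Left \<open>R\<close>-linearity of f gives t(f(s(r) a_2)) = t(r f(a_2)), and t reverses
  products, so this equals t(f(a_2)) t(r): the scalar has moved to a_1.\<close>

lemma balanced_C_mult: "f \<in> carrier D \<Longrightarrow> AL.balanced A (\<lambda>a\<^sub>1 a\<^sub>2. tgt A (f a\<^sub>2) \<otimes>\<^bsub>E\<^esub> a\<^sub>1)"
  by (rule AL.balancedI)
     (simp_all add: D_add D_scale E_scale_right_plus E_scale_right_add E_scale_right_scale)

text \<open>By \<open>psi_cop_sum\<close> the product of the dual evaluates \<psi>(d) at the
  endomorphism m \<mapsto> \<alpha>(m c^1) c^2. The result \<alpha>(d^1 c^1) c^2 d^2 is what
  \<open>psi_mult\<close> gives for the product in \<open>B\<close>.\<close>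

lemma Psi_mult:
  assumes "c \<in> carrier B" "d \<in> carrier B"
  shows "Psi (c \<otimes>\<^bsub>B\<^esub> d) = Psi c \<otimes>\<^bsub>C\<^esub> Psi d"
  unfolding C_mult
proof (rule restrict_ext)
  fix \<alpha> assume \<alpha>: "\<alpha> \<in> carrier E"
  let ?g = "\<Oplus>\<^bsub>E\<^esub>i\<in>{..<k}. E_scale_right (psi c (\<beta> i)) (cop \<alpha> i)"
  interpret E: abelian_group E by (rule E_ab)
  have g: "?g \<in> carrier E" using assms \<alpha> by (intro E.finsum_closed) auto
  have gm: "?g m = LM (\<lambda>x y. \<alpha> (m \<otimes> x) \<otimes> y) c" if "m \<in> carrier M" for m
  proof -
    have "?g m = (\<Oplus>i\<in>{..<k}. cop \<alpha> i m \<otimes> psi c (\<beta> i))"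
      using that assms \<alpha> by (subst E_finsum_apply) (auto intro!: M.finsum_cong_all simp: E_scale_right_apply)
    then show ?thesis using that assms \<alpha> by (simp add: psi_cop_sum)
  qed
  have "tensor_lift R AL AL A (\<lambda>a\<^sub>1 a\<^sub>2. tgt A (Psi c a\<^sub>2) \<otimes>\<^bsub>E\<^esub> a\<^sub>1) (coprod A \<alpha>) =
     (\<Oplus>\<^bsub>E\<^esub>i\<in>{..<k}. tgt A (Psi c (\<beta> i)) \<otimes>\<^bsub>E\<^esub> cop \<alpha> i)"
    by (rule lift_coprod_A[OF \<alpha> balanced_C_mult[OF Psi_D[OF assms(1)]]])
  also have "\<dots> = ?g"
    using assms \<alpha> by (intro E.finsum_cong_all) simp_all
  finally have e: "tensor_lift R AL AL A (\<lambda>a\<^sub>1 a\<^sub>2. tgt A (Psi c a\<^sub>2) \<otimes>\<^bsub>E\<^esub> a\<^sub>1) (coprod A \<alpha>) = ?g" .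
  have "psi (c \<otimes>\<^bsub>B\<^esub> d) \<alpha> = LM (\<lambda>x' y'. LM (\<lambda>x y. \<alpha> (x' \<otimes> x) \<otimes> y) c \<otimes> y') d"
    by (rule psi_mult(1)[OF assms \<alpha>])
  also have "\<dots> = psi d ?g"
    unfolding psi_def[of d] using assms \<alpha> by (intro lift_cong_M[symmetric, OF M_ab psi_mult(2)]) (simp_all add: gm)
  finally show "psi (c \<otimes>\<^bsub>B\<^esub> d) \<alpha> = Psi d (tensor_lift R AL AL A (\<lambda>a\<^sub>1 a\<^sub>2. tgt A (Psi c a\<^sub>2) \<otimes>\<^bsub>E\<^esub> a\<^sub>1) (coprod A \<alpha>))"
    unfolding e using g by simp
qed

text \<open>Pointwise this is the quasibasis identity with \<alpha> applied to the first leg; read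
  in \<open>A\<close>, it expands \<alpha> over the \<beta>_i with coefficients from
  \<open>R\<close>.\<close>

lemma left_expand:
  assumes "\<alpha> \<in> carrier E"
  shows "(\<Oplus>\<^bsub>E\<^esub>i\<in>{..<k}. E_scale_left (psi (b i) \<alpha>) (\<beta> i)) = \<alpha>"
proof (rule E_ext)
  interpret E: abelian_group E by (rule E_ab)
  show "(\<Oplus>\<^bsub>E\<^esub>i\<in>{..<k}. E_scale_left (psi (b i) \<alpha>) (\<beta> i)) \<in> carrier E"
    using assms by (intro E.finsum_closed) auto
  fix m assume m: "m \<in> carrier M"
  have "(\<Oplus>\<^bsub>E\<^esub>i\<in>{..<k}. E_scale_left (psi (b i) \<alpha>) (\<beta> i)) m = (\<Oplus>i\<in>{..<k}. psi (b i) \<alpha> \<otimes> \<beta> i m)"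
    using m assms by (subst E_finsum_apply) (auto intro!: M.finsum_cong_all simp: E_scale_left_apply)
  also have "\<dots> = \<alpha> m"
    unfolding psi_def using quasibasis_lift[of "\<lambda>x y. \<alpha> x \<otimes> y" m] m assms by (simp add: M.m_assoc)
  finally show "(\<Oplus>\<^bsub>E\<^esub>i\<in>{..<k}. E_scale_left (psi (b i) \<alpha>) (\<beta> i)) m = \<alpha> m" .
qed (rule assms)

text \<open>Apply f to \<open>left_expand\<close> and use left \<open>R\<close>-linearity. The
  intermediate step trades a sum formed in \<open>R\<close> for the same sum formed in
  \<open>M\<close>.\<close>

lemma D_expand:
  assumes "f \<in> carrier D" "\<alpha> \<in> carrier E"
  shows "(\<Oplus>i\<in>{..<k}. psi (b i) \<alpha> \<otimes> f (\<beta> i)) = f \<alpha>"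
proof -
  have "f \<alpha> = f (\<Oplus>\<^bsub>E\<^esub>i\<in>{..<k}. E_scale_left (psi (b i) \<alpha>) (\<beta> i))"
    using left_expand[OF assms(2)] by simp
  also have "\<dots> = (\<Oplus>\<^bsub>R\<^esub>i\<in>{..<k}. f (E_scale_left (psi (b i) \<alpha>) (\<beta> i)))"
    by (rule additive_map_finsum[OF E_ab R_ab D_additive[OF assms(1)]]) (simp_all add: assms)
  also have "\<dots> = (\<Oplus>i\<in>{..<k}. f (E_scale_left (psi (b i) \<alpha>) (\<beta> i)))"
    by (rule R_finsum) (simp_all add: assms)
  also have "\<dots> = (\<Oplus>i\<in>{..<k}. psi (b i) \<alpha> \<otimes> f (\<beta> i))"
    using assms by (intro M.finsum_cong_all) (simp_all add: D_scale)
  finally show ?thesis by simp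
qed

lemma Psi_bij: "bij_betw Psi (carrier B) (carrier D)"
proof (rule bij_betwI')
  fix c d assume cd: "c \<in> carrier B" "d \<in> carrier B"
  show "(Psi c = Psi d) = (c = d)"
  proof
    assume eq: "Psi c = Psi d"
    have "psi c (\<beta> i) = psi d (\<beta> i)" if "i < k" for i
      using fun_cong[OF eq, of "\<beta> i"] that by simp
    then have "(\<Oplus>\<^bsub>XY\<^esub>i\<in>{..<k}. rm (b i) (psi c (\<beta> i))) = (\<Oplus>\<^bsub>XY\<^esub>i\<in>{..<k}. rm (b i) (psi d (\<beta> i)))"
      using cd by (intro T.XY.finsum_cong_all) simp_all
    then show "c = d" using cd by (simp add: psi_reconstruct)
  qed simp
next
  fix f assume f: "f \<in> carrier D"
  let ?c = "\<Oplus>\<^bsub>XY\<^esub>i\<in>{..<k}. rm (b i) (f (\<beta> i))"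
  have c: "?c \<in> carrier B" using f by (intro B_finsum) simp_all
  have "f = Psi ?c"
  proof (rule D_ext[OF f])
    fix \<alpha> assume \<alpha>: "\<alpha> \<in> carrier E"
    have "psi ?c \<alpha> = (\<Oplus>i\<in>{..<k}. psi (rm (b i) (f (\<beta> i))) \<alpha>)"
      by (rule additive_map_finsum[OF XY_ab M_ab psi_additive[OF \<alpha>]]) (simp_all add: f)
    also have "\<dots> = (\<Oplus>i\<in>{..<k}. psi (b i) \<alpha> \<otimes> f (\<beta> i))"
      using f \<alpha> by (intro M.finsum_cong_all) (simp_all add: psi_rm)
    finally show "f \<alpha> = Psi ?c \<alpha>" using f \<alpha> by (simp add: D_expand)
  qed (simp add: c)
  then show "\<exists>c\<in>carrier B. f = Psi c" using c by blast
qed simp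

lemma Psi_plus: "c \<in> carrier B \<Longrightarrow> d \<in> carrier B \<Longrightarrow> Psi (c \<oplus>\<^bsub>XY\<^esub> d) = Psi c \<oplus>\<^bsub>D\<^esub> Psi d"
  by (auto simp: additive_map_add[OF psi_additive])

text \<open>The left action on \<open>D\<close> precomposes the argument with s(r), which under the
  pairing multiplies the first leg of \<open>c\<close> by r.\<close>

lemma Psi_lm: "c \<in> carrier B \<Longrightarrow> r \<in> carrier R \<Longrightarrow> Psi (lm r c) = lact D r (Psi c)"
proof -
  assume c: "c \<in> carrier B" "r \<in> carrier R"
  show ?thesis
    unfolding D_simps
  proof (rule restrict_ext)
    fix \<alpha> assume \<alpha>: "\<alpha> \<in> carrier E"
    have "psi (lm r c) \<alpha> = LM (\<lambda>x y. \<alpha> (r \<otimes> x) \<otimes> y) c"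
      unfolding psi_def using c \<alpha> by (intro lift_lm[OF M_ab]) simp_all
    also have "\<dots> = psi c (\<alpha> \<otimes>\<^bsub>E\<^esub> src A r)"
      unfolding psi_def using c \<alpha>
      by (intro lift_cong_M[OF M_ab balanced_mult]) (simp_all, simp add: E_simps A_src_tgt)
    finally show "psi (lm r c) \<alpha> = Psi c (\<alpha> \<otimes>\<^bsub>E\<^esub> src A r)" using c \<alpha> by simp
  qed
qed

lemma Psi_rm: "c \<in> carrier B \<Longrightarrow> r \<in> carrier R \<Longrightarrow> Psi (rm c r) = ract D (Psi c) r"
  unfolding D_simps by (rule restrict_ext) (simp add: psi_rm)

text \<open>Source and target of the dual are the images of 1 \<otimes> r and r \<otimes> 1, so
  multiplicativity of \<psi> reduces their action on \<psi>(c) to the outer actions of r on c, which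
  \<psi> turns into the actions of \<open>D\<close>. Thus the tensor square in the isomorphism
  condition is the one carrying the coproduct of the dual.\<close>

lemma C_right_bimod:
  "tensor_ab R (right_bimod_of C) (right_bimod_of C) = D.XY"
  "pure_tensor R (right_bimod_of C) (right_bimod_of C) = D.pt"
proof -
  have st: "src C r = Psi (pt \<one> r)" "tgt C r = Psi (pt r \<one>)" if "r \<in> carrier R" for r
    using that by (auto simp: E_simps A_src_tgt)
  have R: "pt \<one> r \<in> carrier B" "pt r \<one> \<in> carrier B" if "r \<in> carrier R" for r
    using that lm_R_B[OF that B_one] rm_R_B[OF that B_one] by simp_all
  have *: "f \<otimes>\<^bsub>C\<^esub> src C r = ract D f r" "f \<otimes>\<^bsub>C\<^esub> tgt C r = lact D r f" if "f \<in> carrier D" "r \<in> carrier R" for f r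
  proof -
    \<comment> \<open>Surjectivity of \<psi> reduces the claim about f to one about an element of
      \<open>B\<close>.\<close>
    have "f \<in> Psi ` carrier B" using that(1) Psi_bij by (simp add: bij_betw_def)
    then obtain c where c: "f = Psi c" "c \<in> carrier B" by (rule imageE)
    show "f \<otimes>\<^bsub>C\<^esub> src C r = ract D f r" "f \<otimes>\<^bsub>C\<^esub> tgt C r = lact D r f"
      unfolding st[OF that(2)] c(1) using c R that
      by (simp_all only: Psi_mult[symmetric] Psi_lm[symmetric] Psi_rm[symmetric] B_mult_src B_mult_tgt)
  qed
  show "tensor_ab R (right_bimod_of C) (right_bimod_of C) = D.XY"
    by (rule tensor_cong) (simp_all only: right_bimod_simps * C_simps(1-3))
  show "pure_tensor R (right_bimod_of C) (right_bimod_of C) = D.pt"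
    by (rule tensor_cong) (simp_all only: right_bimod_simps * C_simps(1-3))
qed

section \<open>Tensors over the left dual and its coproduct\<close>

lemma E_src:
  assumes "a \<in> carrier E" "r \<in> carrier R" "s \<in> carrier R"
  shows "a \<otimes>\<^bsub>E\<^esub> src A (r \<oplus> s) = (a \<otimes>\<^bsub>E\<^esub> src A r) \<oplus>\<^bsub>E\<^esub> (a \<otimes>\<^bsub>E\<^esub> src A s)"
    "(a \<otimes>\<^bsub>E\<^esub> src A r) \<otimes>\<^bsub>E\<^esub> src A s = a \<otimes>\<^bsub>E\<^esub> src A (r \<otimes> s)"
  using assms by (auto simp: E_simps A_src_tgt M.l_distr E_add M.m_assoc)

text \<open>Compatibility with scalars amounts to multiplicativity of s, in the form of
  \<open>E_src\<close>.\<close>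

lemma balanced_D_contract:
  assumes "a' \<in> carrier E"
  shows "D.balanced D (\<lambda>f g. lact D (f a') g)"
  by (rule D.balancedI; unfold D_simps) (use assms in \<open>auto simp: D_add E_src\<close>)

text \<open>Pairs the first leg with \<open>a'\<close> and keeps the second leg as a functional. Its
  value at \<open>a\<close> is the expression in the equation that determines the coproduct of the
  left dual.\<close>

definition D_contract :: "('m \<Rightarrow> 'm) \<Rightarrow> (('m \<Rightarrow> 'm) \<Rightarrow> 'm, ('m \<Rightarrow> 'm) \<Rightarrow> 'm) tens \<Rightarrow> ('m \<Rightarrow> 'm) \<Rightarrow> 'm" where
  "D_contract a' = tensor_lift R D D D (\<lambda>f g. lact D (f a') g)"

lemma D_contract_additive: "a' \<in> carrier E \<Longrightarrow> additive_map D.XY D (D_contract a')"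
  unfolding D_contract_def by (rule D.lift_additive[OF D_ab balanced_D_contract])

lemma D_contract_pure: "a' \<in> carrier E \<Longrightarrow> f \<in> carrier D \<Longrightarrow> g \<in> carrier D \<Longrightarrow>
    D_contract a' (D.pt f g) = lact D (f a') g"
  unfolding D_contract_def by (rule D.lift_pure[OF D_ab balanced_D_contract])

lemma D_eval_additive: "a \<in> carrier E \<Longrightarrow> additive_map D R (\<lambda>f. f a)"
  by (simp add: additive_map_def)

lemma D_contract_apply:
  assumes "a \<in> carrier E" "a' \<in> carrier E" "z \<in> carrier D.XY"
  shows "D_contract a' z a = tensor_lift R D D R (\<lambda>f g. (lact D (f a') g) a) z"
  unfolding D_contract_def
  by (rule D.lift_comp[OF D_ab balanced_D_contract[OF assms(2)] R_ab D_eval_additive[OF assms(1)] assms(3)])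

text \<open>The dual basis \<open>\<psi>(b\<^sub>i), \<beta>\<^sub>i\<close> rebuilds a tensor from its pairings, whence the uniqueness of coproducts in
  the left dual.\<close>

lemma D_tensor_expand:
  assumes "z \<in> carrier D.XY"
  shows "(\<Oplus>\<^bsub>D.XY\<^esub>i\<in>{..<k}. D.pt (Psi (b i)) (D_contract (\<beta> i) z)) = z"
proof (rule D.tensor_hom_ext[OF _ _ _ assms, where g = "\<lambda>z. z"])
  have pr: "additive_map D D.XY (D.pt f)" if "f \<in> carrier D" for f
    using that by (simp add: additive_map_def D.pure_add_right del: D_simps)
  have pl: "additive_map D D.XY (\<lambda>f. D.pt f g)" if "g \<in> carrier D" for g
    using that by (simp add: additive_map_def D.pure_add_left del: D_simps)
  show "additive_map D.XY D.XY
     (\<lambda>z. \<Oplus>\<^bsub>D.XY\<^esub>i\<in>{..<k}. D.pt (Psi (b i)) (D_contract (\<beta> i) z))"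
    by (intro additive_map_sum D.XY.abelian_group_axioms additive_map_compose[OF D_contract_additive pr]) auto
  show "additive_map D.XY D.XY (\<lambda>z. z)"
    by (simp add: additive_map_def)
  fix f g assume f: "f \<in> carrier D" and g: "g \<in> carrier D"
  \<comment> \<open>Dual basis expansion of the functional f itself, obtained from
    \<open>D_expand\<close> at each endomorphism.\<close>
  have s: "(\<Oplus>\<^bsub>D\<^esub>i\<in>{..<k}. ract D (Psi (b i)) (f (\<beta> i))) = f"
  proof (rule D_ext[OF _ f])
    show "(\<Oplus>\<^bsub>D\<^esub>i\<in>{..<k}. ract D (Psi (b i)) (f (\<beta> i))) \<in> carrier D"
      using f by (intro D.X.finsum_closed Pi_I D.ract_closed) simp_all
    fix a assume a: "a \<in> carrier E"
    have "(\<Oplus>\<^bsub>D\<^esub>i\<in>{..<k}. ract D (Psi (b i)) (f (\<beta> i))) a = (\<Oplus>\<^bsub>R\<^esub>i\<in>{..<k}. (ract D (Psi (b i)) (f (\<beta> i))) a)"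
      by (rule additive_map_finsum[OF D_ab R_ab D_eval_additive[OF a]]) (use f in \<open>auto intro!: D.ract_closed simp del: D_simps\<close>)
    also have "\<dots> = (\<Oplus>i\<in>{..<k}. (ract D (Psi (b i)) (f (\<beta> i))) a)"
      by (rule R_finsum) (use f a in auto)
    also have "\<dots> = (\<Oplus>i\<in>{..<k}. psi (b i) a \<otimes> f (\<beta> i))"
      using f a by (intro M.finsum_cong_all) auto
    finally show "(\<Oplus>\<^bsub>D\<^esub>i\<in>{..<k}. ract D (Psi (b i)) (f (\<beta> i))) a = f a"
      using f a by (simp add: D_expand)
  qed
  \<comment> \<open>The scalar f(\<beta>_i) crosses the tensor sign from g to \<psi>(b_i), where the
    sum over i restores f.\<close>
  have "(\<Oplus>\<^bsub>D.XY\<^esub>i\<in>{..<k}. D.pt (Psi (b i)) (D_contract (\<beta> i) (D.pt f g))) =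
     (\<Oplus>\<^bsub>D.XY\<^esub>i\<in>{..<k}. D.pt (ract D (Psi (b i)) (f (\<beta> i))) g)"
  proof (rule D.XY.finsum_cong_all)
    fix i assume i: "i \<in> {..<k}"
    then show "D.pt (Psi (b i)) (D_contract (\<beta> i) (D.pt f g)) = D.pt (ract D (Psi (b i)) (f (\<beta> i))) g"
      using f g by (subst D.pure_balanced) (simp_all add: D_contract_pure del: D_simps)
    show "D.pt (ract D (Psi (b i)) (f (\<beta> i))) g \<in> carrier D.XY"
      using i f g by (intro D.pure_closed D.ract_closed) auto
  qed
  also have "\<dots> = D.pt (\<Oplus>\<^bsub>D\<^esub>i\<in>{..<k}. ract D (Psi (b i)) (f (\<beta> i))) g"
    by (rule additive_map_finsum[OF D_ab D.XY.abelian_group_axioms pl[OF g], symmetric])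
       (use f in \<open>auto intro!: D.ract_closed simp del: D_simps\<close>)
  finally show "(\<Oplus>\<^bsub>D.XY\<^esub>i\<in>{..<k}. D.pt (Psi (b i)) (D_contract (\<beta> i) (D.pt f g))) = D.pt f g"
    unfolding s .
qed

text \<open>Equal pairings make the contractions at each \<beta>_i equal as functionals, and by
  \<open>D_tensor_expand\<close> these determine the tensor.\<close>

lemma D_tensor_eqI:
  assumes "z \<in> carrier D.XY" "w \<in> carrier D.XY"
    and "\<And>a a'. a \<in> carrier E \<Longrightarrow> a' \<in> carrier E \<Longrightarrow>
      tensor_lift R D D R (\<lambda>f g. (lact D (f a') g) a) z = tensor_lift R D D R (\<lambda>f g. (lact D (f a') g) a) w"
  shows "z = w"
proof -
  have "D_contract a' z = D_contract a' w" if "a' \<in> carrier E" for a'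
    by (rule D_ext) (use assms that in \<open>simp_all add: additive_map_closed[OF D_contract_additive] D_contract_apply del: D_simps\<close>)
  then have "(\<Oplus>\<^bsub>D.XY\<^esub>i\<in>{..<k}. D.pt (Psi (b i)) (D_contract (\<beta> i) z)) =
    (\<Oplus>\<^bsub>D.XY\<^esub>i\<in>{..<k}. D.pt (Psi (b i)) (D_contract (\<beta> i) w))"
    using assms(2) by (intro D.XY.finsum_cong_all D.pure_closed)
      (simp_all add: additive_map_closed[OF D_contract_additive])
  then show ?thesis using assms(1,2) by (simp add: D_tensor_expand)
qed

text \<open>\<open>Psi_rm\<close> and \<open>Psi_lm\<close> make the map induced by \<psi> on both
  legs well defined; the coproduct of \<open>B\<close> is then evaluated term by term.\<close>

lemma Psi_coprod_eq:
  assumes "c \<in> carrier B"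
  shows "tensor_lift R BR BR D.XY (\<lambda>x y. D.pt (Psi x) (Psi y)) (coprod BB c) =
    (\<Oplus>\<^bsub>D.XY\<^esub>i\<in>{..<k}. D.pt (Psi (b i)) (Psi (bcop c i)))"
  unfolding BB_coprod
proof (rule BR.lift_sum[OF D.XY.abelian_group_axioms])
  have add: "additive_map BR D Psi"
    using Psi_plus by (intro additive_mapI) (simp_all del: D_simps)
  show "BR.balanced D.XY (\<lambda>x y. D.pt (Psi x) (Psi y))"
    using Psi_rm Psi_lm
    by (intro BR.balanced_pure_map D.tensor_pair_axioms add) (simp_all del: D_simps)
qed (simp_all add: assms)

text \<open>With r_i = \<psi>(b_i)(a'), the left side is the sum of the a(r_i \<beta>_i(c^1)) c^2.
  The quasibasis identity with a' on the first leg collapses the sum of the r_i \<beta>_i to a',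
  leaving a(a'(c^1)) c^2.\<close>

lemma psi_coprod_sum:
  assumes "c \<in> carrier B" "a \<in> carrier E" "a' \<in> carrier E"
  shows "(\<Oplus>i\<in>{..<k}. psi (bcop c i) (a \<otimes>\<^bsub>E\<^esub> src A (psi (b i) a'))) = psi c (a \<otimes>\<^bsub>E\<^esub> a')"
proof -
  let ?r = "\<lambda>i. psi (b i) a'"
  have rl: "right_linear (\<lambda>x. a (?r i \<otimes> \<beta> i x))" if "i < k" for i
    using that assms by (intro right_linear_comp[of a "\<lambda>x. ?r i \<otimes> \<beta> i x"] right_linear_mult) simp_all
  have bal: "T.balanced M (\<lambda>x y. a (?r i \<otimes> \<beta> i x) \<otimes> y)" if "i \<in> {..<k}" for i
    using that by (intro balanced_mult rl) simp_all
  have "(\<Oplus>i\<in>{..<k}. psi (bcop c i) (a \<otimes>\<^bsub>E\<^esub> src A (?r i))) =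
     (\<Oplus>i\<in>{..<k}. LM (\<lambda>x y. a (?r i \<otimes> \<beta> i x) \<otimes> y) c)"
  proof (rule M.finsum_cong_all)
    fix i assume i: "i \<in> {..<k}"
    then show "psi (bcop c i) (a \<otimes>\<^bsub>E\<^esub> src A (?r i)) = LM (\<lambda>x y. a (?r i \<otimes> \<beta> i x) \<otimes> y) c"
      using assms by (subst bcop_psi) (auto intro!: lift_cong_M[OF M_ab bal], simp_all add: E_simps A_src_tgt)
    show "LM (\<lambda>x y. a (?r i \<otimes> \<beta> i x) \<otimes> y) c \<in> carrier M"
      using assms by (intro T.lift_closed[OF M_ab bal[OF i]]) simp
  qed
  also have "\<dots> = LM (\<lambda>x y. \<Oplus>i\<in>{..<k}. a (?r i \<otimes> \<beta> i x) \<otimes> y) c"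
    using assms by (intro T.lift_finsum(1)[OF M_ab _ bal, symmetric]) simp_all
  also have "\<dots> = LM (\<lambda>x y. a (a' x) \<otimes> y) c"
  proof (rule lift_cong_M[OF M_ab])
    fix x y assume xy: "x \<in> carrier M" "y \<in> carrier M"
    have "(\<Oplus>i\<in>{..<k}. a (?r i \<otimes> \<beta> i x) \<otimes> y) = a (\<Oplus>i\<in>{..<k}. ?r i \<otimes> \<beta> i x) \<otimes> y"
      using xy assms by (intro additive_map_finsum[OF M_ab M_ab, symmetric, where h = "\<lambda>z. a z \<otimes> y"])
         (simp_all add: additive_map_def M.l_distr E_add)
    also have "(\<Oplus>i\<in>{..<k}. ?r i \<otimes> \<beta> i x) = a' x"
      unfolding psi_def using quasibasis_lift[of "\<lambda>x y. a' x \<otimes> y" x] xy assms by (simp add: M.m_assoc)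
    finally show "(\<Oplus>i\<in>{..<k}. a (?r i \<otimes> \<beta> i x) \<otimes> y) = a (a' x) \<otimes> y" .
  qed (use assms right_linear_comp[of a a'] in simp_all)
  also have "\<dots> = psi c (a \<otimes>\<^bsub>E\<^esub> a')"
    unfolding psi_def using assms right_linear_comp[of a a']
    by (intro lift_cong_M[symmetric, OF M_ab]) (simp_all, simp add: E_simps)
  finally show ?thesis .
qed

text \<open>The image of the coproduct of \<open>B\<close> is the candidate for the definite
  description: it satisfies the defining equations by \<open>psi_coprod_sum\<close> and is the only
  solution by \<open>D_tensor_eqI\<close>.\<close>

lemma Psi_coprod:
  assumes "c \<in> carrier B"
  shows "coprod C (Psi c) =
    tensor_lift R BR BR D.XY (\<lambda>x y. D.pt (Psi x) (Psi y)) (coprod BB c)"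
proof -
  let ?z = "\<Oplus>\<^bsub>D.XY\<^esub>i\<in>{..<k}. D.pt (Psi (b i)) (Psi (bcop c i))"
  have z: "?z \<in> carrier D.XY"
    using assms by (intro D.XY.finsum_closed) auto
  have bal: "D.balanced R (\<lambda>f g. (lact D (f a') g) a)" if "a \<in> carrier E" "a' \<in> carrier E" for a a'
    by (rule D.balanced_comp[OF balanced_D_contract D_eval_additive]) (use that in auto)
  have ev: "tensor_lift R D D R (\<lambda>f g. (lact D (f a') g) a) ?z = Psi c (a \<otimes>\<^bsub>E\<^esub> a')"
    if a: "a \<in> carrier E" "a' \<in> carrier E" for a a'
  proof -
    have "tensor_lift R D D R (\<lambda>f g. (lact D (f a') g) a) ?z =
       (\<Oplus>\<^bsub>R\<^esub>i\<in>{..<k}. (lact D (Psi (b i) a') (Psi (bcop c i))) a)"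
      using assms by (intro D.lift_sum[OF R_ab bal[OF a]]) simp_all
    also have "\<dots> = (\<Oplus>i\<in>{..<k}. (lact D (Psi (b i) a') (Psi (bcop c i))) a)"
      using assms a by (intro R_finsum) auto
    also have "\<dots> = (\<Oplus>i\<in>{..<k}. psi (bcop c i) (a \<otimes>\<^bsub>E\<^esub> src A (psi (b i) a')))"
      using assms a by (intro M.finsum_cong_all) auto
    finally show ?thesis using assms a by (simp add: psi_coprod_sum)
  qed
  have "coprod C (Psi c) = (THE z. z \<in> carrier D.XY \<and>
        (\<forall>a\<in>carrier E. \<forall>a'\<in>carrier E.
           tensor_lift R D D R (\<lambda>f g. (lact D (f a') g) a) z = Psi c (a \<otimes>\<^bsub>E\<^esub> a')))"
    by (simp only: left_dual_def Let_def bialgebroid.simps A_simps)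
  also have "\<dots> = ?z"
  proof (rule the_equality)
    show "?z \<in> carrier D.XY \<and> (\<forall>a\<in>carrier E. \<forall>a'\<in>carrier E.
           tensor_lift R D D R (\<lambda>f g. (lact D (f a') g) a) ?z = Psi c (a \<otimes>\<^bsub>E\<^esub> a'))"
      using z ev by blast
    fix w assume w: "w \<in> carrier D.XY \<and> (\<forall>a\<in>carrier E. \<forall>a'\<in>carrier E.
           tensor_lift R D D R (\<lambda>f g. (lact D (f a') g) a) w = Psi c (a \<otimes>\<^bsub>E\<^esub> a'))"
    show "w = ?z"
    proof (rule D_tensor_eqI[OF conjunct1[OF w] z])
      fix a a' assume a: "a \<in> carrier E" "a' \<in> carrier E"
      show "tensor_lift R D D R (\<lambda>f g. (lact D (f a') g) a) w = tensor_lift R D D R (\<lambda>f g. (lact D (f a') g) a) ?z"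
        unfolding ev[OF a] by (rule conjunct2[OF w, rule_format, OF a])
    qed
  qed
  finally show ?thesis using Psi_coprod_eq[OF assms] by simp
qed

lemma Psi_iso: "right_bialgebroid_iso R BB C Psi"
  unfolding right_bialgebroid_iso_def
proof (intro conjI ballI)
  show "Psi \<in> ring_iso BB C"
    unfolding ring_iso_def
  proof (intro CollectI conjI ring_hom_memI)
    show "bij_betw Psi (carrier BB) (carrier C)" using Psi_bij by simp
    show "Psi \<one>\<^bsub>BB\<^esub> = \<one>\<^bsub>C\<^esub>" by auto
  qed (simp_all only: BB_simps C_simps Psi_mult Psi_plus Psi_D)
next
  fix c assume "c \<in> carrier BB"
  then have c: "c \<in> carrier B" by simp
  show "coprod C (Psi c) = tensor_lift R BR BR (tensor_ab R (right_bimod_of C) (right_bimod_of C))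
       (\<lambda>x y. pure_tensor R (right_bimod_of C) (right_bimod_of C) (Psi x) (Psi y)) (coprod BB c)"
    unfolding C_right_bimod by (rule Psi_coprod[OF c])
  \<comment> \<open>The counit of the dual evaluates at the identity map, where the pairing is c^1
    c^2.\<close>
  have "psi c \<one>\<^bsub>E\<^esub> = LM (\<lambda>x y. x \<otimes> y) c"
    unfolding psi_def using c by (intro lift_cong_M[OF M_ab]) (simp_all, simp add: E_simps)
  then show "counit C (Psi c) = counit BB c" by (simp add: BB_counit)
qed (auto simp: E_simps A_src_tgt)

end

text \<open>The right quasibasis has its own length and is unrelated to the left one, which is
  prescribed with the bialgebroid structures.\<close>

locale two_quasibases = left_quasibasis N M \<eta> k b \<beta>
  for N :: "('n, 'p) ring_scheme" and M :: "('m, 'q) ring_scheme" (structure) and \<eta> :: "'n \<Rightarrow> 'm"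
    and k :: nat and b :: "nat \<Rightarrow> ('m, 'm) tens" and \<beta> :: "nat \<Rightarrow> 'm \<Rightarrow> 'm" +
  fixes l :: nat and e :: "nat \<Rightarrow> ('m, 'm) tens" and \<gamma> :: "nat \<Rightarrow> 'm \<Rightarrow> 'm"
  assumes e_B [simp]: "\<And>j. j < l \<Longrightarrow> e j \<in> carrier B"
    and gamma_E [simp]: "\<And>j. j < l \<Longrightarrow> \<gamma> j \<in> carrier E"
    and right_quasibasis_sum:
      "\<And>m. m \<in> carrier M \<Longrightarrow> (\<Oplus>\<^bsub>XY\<^esub>j\<in>{..<l}. lm (\<gamma> j m) (e j)) = pt \<one> m"
begin

text \<open>Pairing with \<alpha> through \<phi> is left \<open>M\<close>-linear, so it can be
  applied termwise to the right quasibasis identity, whose value 1 \<otimes> m goes to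
  \<alpha>(m).\<close>

lemma right_quasibasis_phi:
  assumes "\<alpha> \<in> carrier E" "m \<in> carrier M"
  shows "(\<Oplus>j\<in>{..<l}. \<gamma> j m \<otimes> phi (e j) \<alpha>) = \<alpha> m"
proof -
  have "(\<Oplus>j\<in>{..<l}. \<gamma> j m \<otimes> phi (e j) \<alpha>) = (\<Oplus>j\<in>{..<l}. phi (lm (\<gamma> j m) (e j)) \<alpha>)"
    using assms by (intro M.finsum_cong_all) (simp_all add: phi_lm)
  also have "\<dots> = phi (\<Oplus>\<^bsub>XY\<^esub>j\<in>{..<l}. lm (\<gamma> j m) (e j)) \<alpha>"
    by (rule additive_map_finsum[OF XY_ab M_ab phi_additive, symmetric]) (simp_all add: assms)
  finally show ?thesis using assms by (simp add: right_quasibasis_sum)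
qed

text \<open>The j-th term is c^1 \<gamma>_j(c^2) e_j, so the right quasibasis identity at m = c^2,
  multiplied on the left by c^1, gives back c^1 \<otimes> c^2.\<close>

lemma phi_reconstruct:
  assumes "c \<in> carrier XY"
  shows "(\<Oplus>\<^bsub>XY\<^esub>j\<in>{..<l}. lm (phi c (\<gamma> j)) (e j)) = c"
proof -
  have ad: "additive_map M XY (\<lambda>m. lm m (e j))" if "j < l" for j
    using that by (simp add: additive_map_def lm_add_left)
  have bal: "T.balanced XY (\<lambda>x y. lm (x \<otimes> \<gamma> j y) (e j))" if "j \<in> {..<l}" for j
    using that by (intro T.balanced_comp[OF balanced_mult ad]) simp_all
  have "(\<Oplus>\<^bsub>XY\<^esub>j\<in>{..<l}. lm (phi c (\<gamma> j)) (e j)) = (\<Oplus>\<^bsub>XY\<^esub>j\<in>{..<l}. LT (\<lambda>x y. lm (x \<otimes> \<gamma> j y) (e j)) c)"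
  proof (rule T.XY.finsum_cong_all)
    fix j assume j: "j \<in> {..<l}"
    show "lm (phi c (\<gamma> j)) (e j) = LT (\<lambda>x y. lm (x \<otimes> \<gamma> j y) (e j)) c"
      unfolding phi_def using j by (intro T.lift_comp[OF M_ab balanced_mult XY_ab ad] assms) simp_all
    show "LT (\<lambda>x y. lm (x \<otimes> \<gamma> j y) (e j)) c \<in> carrier XY"
      by (rule T.lift_closed[OF XY_ab bal[OF j] assms])
  qed
  also have "\<dots> = LT (\<lambda>x y. \<Oplus>\<^bsub>XY\<^esub>j\<in>{..<l}. lm (x \<otimes> \<gamma> j y) (e j)) c"
    by (rule T.lift_finsum(1)[OF XY_ab _ bal assms, symmetric]) simp_all
  also have "\<dots> = LT pt c"
  proof (rule lift_cong_M[OF XY_ab _ assms])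
    fix x y assume xy: "x \<in> carrier M" "y \<in> carrier M"
    have "(\<Oplus>\<^bsub>XY\<^esub>j\<in>{..<l}. lm (x \<otimes> \<gamma> j y) (e j)) = (\<Oplus>\<^bsub>XY\<^esub>j\<in>{..<l}. lm x (lm (\<gamma> j y) (e j)))"
      using xy by (intro T.XY.finsum_cong_all) (simp_all add: lm_lm)
    also have "\<dots> = lm x (\<Oplus>\<^bsub>XY\<^esub>j\<in>{..<l}. lm (\<gamma> j y) (e j))"
      by (rule additive_map_finsum[OF XY_ab XY_ab lm_additive, symmetric]) (simp_all add: xy)
    finally show "(\<Oplus>\<^bsub>XY\<^esub>j\<in>{..<l}. lm (x \<otimes> \<gamma> j y) (e j)) = pt x y"
      using xy by (simp add: right_quasibasis_sum)
  qed (rule T.balanced_pure)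
  also have "\<dots> = c" by (rule T.lift_id[OF assms])
  finally show ?thesis .
qed

section \<open>The right dual\<close>

abbreviation "D' \<equiv> right_dual_bimod R A"
abbreviation "C' \<equiv> right_dual R A"
abbreviation "Phi \<equiv> (\<lambda>c. \<lambda>\<alpha>\<in>carrier E. phi c \<alpha>)"

lemma D'_iff: "f \<in> carrier D' \<longleftrightarrow> f \<in> carrier E \<rightarrow>\<^sub>E carrier R \<and>
    (\<forall>a\<in>carrier E. \<forall>a'\<in>carrier E. f (a \<oplus>\<^bsub>E\<^esub> a') = f a \<oplus> f a') \<and>
    (\<forall>a\<in>carrier E. \<forall>r\<in>carrier R. f (E_scale_right r a) = f a \<otimes> r)"
  by (simp add: right_dual_bimod_def)

lemma D'_simps [simp]:
  "\<zero>\<^bsub>D'\<^esub> = (\<lambda>a\<in>carrier E. \<zero>)" "f \<oplus>\<^bsub>D'\<^esub> g = (\<lambda>a\<in>carrier E. f a \<oplus> g a)"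
  "lact D' r f = (\<lambda>a\<in>carrier E. r \<otimes> f a)" "ract D' f r = (\<lambda>a\<in>carrier E. f (a \<otimes>\<^bsub>E\<^esub> tgt A r))"
  by (simp_all add: right_dual_bimod_def)

lemma D'_R [simp]: "f \<in> carrier D' \<Longrightarrow> a \<in> carrier E \<Longrightarrow> f a \<in> carrier R"
  by (auto simp: D'_iff)

lemma D'_additive: "f \<in> carrier D' \<Longrightarrow> additive_map E R f"
  by (simp add: additive_map_def) (simp add: D'_iff)

lemma D'_scale: "f \<in> carrier D' \<Longrightarrow> a \<in> carrier E \<Longrightarrow> r \<in> carrier R \<Longrightarrow> f (E_scale_right r a) = f a \<otimes> r"
  by (simp add: D'_iff)

lemma D'_add: "f \<in> carrier D' \<Longrightarrow> a \<in> carrier E \<Longrightarrow> a' \<in> carrier E \<Longrightarrow> f (a \<oplus>\<^bsub>E\<^esub> a') = f a \<oplus> f a'"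
  by (simp add: D'_iff)

lemma D'_ext: "f \<in> carrier D' \<Longrightarrow> g \<in> carrier D' \<Longrightarrow> (\<And>a. a \<in> carrier E \<Longrightarrow> f a = g a) \<Longrightarrow> f = g"
  by (rule PiE_ext[of _ "carrier E" "\<lambda>_. carrier R"]) (simp_all add: D'_iff)

lemma D'_I:
  assumes "\<And>a. a \<in> carrier E \<Longrightarrow> f a \<in> carrier R"
    "\<And>a a'. a \<in> carrier E \<Longrightarrow> a' \<in> carrier E \<Longrightarrow> f (a \<oplus>\<^bsub>E\<^esub> a') = f a \<oplus> f a'"
    "\<And>a r. a \<in> carrier E \<Longrightarrow> r \<in> carrier R \<Longrightarrow> f (E_scale_right r a) = f a \<otimes> r"
  shows "(\<lambda>a\<in>carrier E. f a) \<in> carrier D'"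
  using assms by (simp add: D'_iff)

lemma D'_restrict [simp]: "f \<in> carrier D' \<Longrightarrow> (\<lambda>a\<in>carrier E. f a) = f"
  by (simp add: D'_iff PiE_def extensional_restrict)

lemma D'_ab: "abelian_group D'"
proof (rule abelian_groupI)
  fix f g assume f: "f \<in> carrier D'" and g: "g \<in> carrier D'"
  show "f \<oplus>\<^bsub>D'\<^esub> g \<in> carrier D'"
    unfolding D'_simps by (rule D'_I) (use f g in \<open>simp_all add: D'_add D'_scale M.l_distr M.a_ac\<close>)
  show "f \<oplus>\<^bsub>D'\<^esub> g = g \<oplus>\<^bsub>D'\<^esub> f"
    using f g by (auto simp: M.a_comm)
next
  show z: "\<zero>\<^bsub>D'\<^esub> \<in> carrier D'"
    unfolding D'_simps by (rule D'_I) (use R_ab[THEN abelian_groupE(2)] in simp_all)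
  fix f assume f: "f \<in> carrier D'"
  show "\<zero>\<^bsub>D'\<^esub> \<oplus>\<^bsub>D'\<^esub> f = f"
  proof -
    have "\<zero>\<^bsub>D'\<^esub> \<oplus>\<^bsub>D'\<^esub> f = (\<lambda>a\<in>carrier E. f a)" using f by (auto simp del: D'_restrict)
    then show ?thesis using f by simp
  qed
  have m: "\<ominus> r \<in> carrier R" if "r \<in> carrier R" for r
    using that by (simp add: R_iff M.l_minus M.r_minus)
  have "(\<lambda>a\<in>carrier E. \<ominus> f a) \<in> carrier D'"
    by (rule D'_I) (use f in \<open>simp_all add: m D'_add D'_scale M.minus_add M.l_minus M.a_comm\<close>)
  moreover have "(\<lambda>a\<in>carrier E. \<ominus> f a) \<oplus>\<^bsub>D'\<^esub> f = \<zero>\<^bsub>D'\<^esub>"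
    using f by (auto simp: M.l_neg)
  ultimately show "\<exists>g\<in>carrier D'. g \<oplus>\<^bsub>D'\<^esub> f = \<zero>\<^bsub>D'\<^esub>" by blast
next
  fix f g h assume "f \<in> carrier D'" "g \<in> carrier D'" "h \<in> carrier D'"
  then show "f \<oplus>\<^bsub>D'\<^esub> g \<oplus>\<^bsub>D'\<^esub> h = f \<oplus>\<^bsub>D'\<^esub> (g \<oplus>\<^bsub>D'\<^esub> h)"
    by (auto simp: M.a_assoc)
qed

lemma E_tgt_assoc:
  assumes "a \<in> carrier E" "r \<in> carrier R"
  shows "E_scale_right r' a \<otimes>\<^bsub>E\<^esub> tgt A r = E_scale_right r' (a \<otimes>\<^bsub>E\<^esub> tgt A r)"
    "(a \<oplus>\<^bsub>E\<^esub> a') \<otimes>\<^bsub>E\<^esub> tgt A r = (a \<otimes>\<^bsub>E\<^esub> tgt A r) \<oplus>\<^bsub>E\<^esub> (a' \<otimes>\<^bsub>E\<^esub> tgt A r)"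
  using assms by (auto simp: E_simps A_src_tgt E_scale_right_def)

lemma D'_lact [simp]: "f \<in> carrier D' \<Longrightarrow> r \<in> carrier R \<Longrightarrow> (\<lambda>a\<in>carrier E. r \<otimes> f a) \<in> carrier D'"
  by (rule D'_I) (simp_all add: D'_add D'_scale M.r_distr M.m_assoc)

lemma D'_ract [simp]: "f \<in> carrier D' \<Longrightarrow> r \<in> carrier R \<Longrightarrow>
    (\<lambda>a\<in>carrier E. f (a \<otimes>\<^bsub>E\<^esub> tgt A r)) \<in> carrier D'"
  by (rule D'_I) (simp_all add: E_tgt_assoc D'_add D'_scale)

sublocale D': tensor_pair R D' D'
  by (rule tensor_pair.intro[OF D'_ab D'_ab]) simp_all

lemma Phi_D [simp]: "c \<in> carrier B \<Longrightarrow> Phi c \<in> carrier D'"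
  by (rule D'_I) (simp_all add: phi_plus phi_scale_right)

lemma C'_simps [simp]:
  "carrier C' = carrier D'" "add C' = add D'" "\<zero>\<^bsub>C'\<^esub> = \<zero>\<^bsub>D'\<^esub>"
  "\<one>\<^bsub>C'\<^esub> = (\<lambda>a\<in>carrier E. a \<one>)"
  "src C' r = (\<lambda>a\<in>carrier E. (a \<otimes>\<^bsub>E\<^esub> tgt A r) \<one>)" "tgt C' r = (\<lambda>a\<in>carrier E. r \<otimes> a \<one>)"
  "counit C' f = f \<one>\<^bsub>E\<^esub>"
  by (simp_all add: right_dual_def Let_def)

lemma C'_mult: "f \<otimes>\<^bsub>C'\<^esub> g = (\<lambda>a\<in>carrier E. g (tensor_lift R AL AL A
             (\<lambda>a\<^sub>1 a\<^sub>2. src A (f a\<^sub>1) \<otimes>\<^bsub>E\<^esub> a\<^sub>2) (coprod A a)))"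
  by (simp add: right_dual_def Let_def)

text \<open>Right \<open>R\<close>-linearity of f gives s(f(t(r) a_1)) = s(f(a_1) r) = s(f(a_1))
  s(r), which moves the scalar to a_2.\<close>

lemma balanced_C'_mult: "f \<in> carrier D' \<Longrightarrow> AL.balanced A (\<lambda>a\<^sub>1 a\<^sub>2. src A (f a\<^sub>1) \<otimes>\<^bsub>E\<^esub> a\<^sub>2)"
  by (rule AL.balancedI)
     (simp_all add: D'_add D'_scale E_scale_left_plus E_scale_left_add E_scale_left_scale)

text \<open>By \<open>phi_cop_sum\<close> the product of the dual evaluates \<phi>(d) at the
  endomorphism m \<mapsto> c^1 \<alpha>(c^2 m). The result d^1 c^1 \<alpha>(c^2 d^2) is what
  \<open>phi_mult\<close> gives for the product in \<open>B\<close>.\<close>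

lemma Phi_mult:
  assumes "c \<in> carrier B" "d \<in> carrier B"
  shows "Phi (c \<otimes>\<^bsub>B\<^esub> d) = Phi c \<otimes>\<^bsub>C'\<^esub> Phi d"
  unfolding C'_mult
proof (rule restrict_ext)
  fix \<alpha> assume \<alpha>: "\<alpha> \<in> carrier E"
  let ?g = "\<Oplus>\<^bsub>E\<^esub>i\<in>{..<k}. E_scale_left (phi c (cop \<alpha> i)) (\<beta> i)"
  interpret E: abelian_group E by (rule E_ab)
  have g: "?g \<in> carrier E" using assms \<alpha> by (intro E.finsum_closed) auto
  have gm: "?g m = LM (\<lambda>x y. x \<otimes> \<alpha> (y \<otimes> m)) c" if "m \<in> carrier M" for m
  proof -
    have "?g m = (\<Oplus>i\<in>{..<k}. phi c (cop \<alpha> i) \<otimes> \<beta> i m)"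
      using that assms \<alpha> by (subst E_finsum_apply) (auto intro!: M.finsum_cong_all simp: E_scale_left_apply)
    then show ?thesis using that assms \<alpha> by (simp add: phi_cop_sum)
  qed
  have "tensor_lift R AL AL A (\<lambda>a\<^sub>1 a\<^sub>2. src A (Phi c a\<^sub>1) \<otimes>\<^bsub>E\<^esub> a\<^sub>2) (coprod A \<alpha>) =
     (\<Oplus>\<^bsub>E\<^esub>i\<in>{..<k}. src A (Phi c (cop \<alpha> i)) \<otimes>\<^bsub>E\<^esub> \<beta> i)"
    by (rule lift_coprod_A[OF \<alpha> balanced_C'_mult[OF Phi_D[OF assms(1)]]])
  also have "\<dots> = ?g"
    using assms \<alpha> by (intro E.finsum_cong_all) simp_all
  finally have e: "tensor_lift R AL AL A (\<lambda>a\<^sub>1 a\<^sub>2. src A (Phi c a\<^sub>1) \<otimes>\<^bsub>E\<^esub> a\<^sub>2) (coprod A \<alpha>) = ?g" .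
  have "phi (c \<otimes>\<^bsub>B\<^esub> d) \<alpha> = LM (\<lambda>x' y'. x' \<otimes> LM (\<lambda>x y. x \<otimes> \<alpha> (y \<otimes> y')) c) d"
    by (rule phi_mult(1)[OF assms \<alpha>])
  also have "\<dots> = phi d ?g"
    unfolding phi_def[of d] using assms \<alpha> by (intro lift_cong_M[symmetric, OF M_ab phi_mult(2)]) (simp_all add: gm)
  finally show "phi (c \<otimes>\<^bsub>B\<^esub> d) \<alpha> = Phi d (tensor_lift R AL AL A (\<lambda>a\<^sub>1 a\<^sub>2. src A (Phi c a\<^sub>1) \<otimes>\<^bsub>E\<^esub> a\<^sub>2) (coprod A \<alpha>))"
    unfolding e using g by simp
qed

lemma right_expand:
  assumes "\<alpha> \<in> carrier E"
  shows "(\<Oplus>\<^bsub>E\<^esub>j\<in>{..<l}. E_scale_right (phi (e j) \<alpha>) (\<gamma> j)) = \<alpha>"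
proof (rule E_ext)
  interpret E: abelian_group E by (rule E_ab)
  show "(\<Oplus>\<^bsub>E\<^esub>j\<in>{..<l}. E_scale_right (phi (e j) \<alpha>) (\<gamma> j)) \<in> carrier E"
    using assms by (intro E.finsum_closed) auto
  fix m assume m: "m \<in> carrier M"
  have "(\<Oplus>\<^bsub>E\<^esub>j\<in>{..<l}. E_scale_right (phi (e j) \<alpha>) (\<gamma> j)) m = (\<Oplus>j\<in>{..<l}. \<gamma> j m \<otimes> phi (e j) \<alpha>)"
    using m assms by (subst E_finsum_apply) (auto intro!: M.finsum_cong_all simp: E_scale_right_apply)
  then show "(\<Oplus>\<^bsub>E\<^esub>j\<in>{..<l}. E_scale_right (phi (e j) \<alpha>) (\<gamma> j)) m = \<alpha> m"
    using m assms by (simp add: right_quasibasis_phi)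
qed (rule assms)

lemma D'_expand:
  assumes "f \<in> carrier D'" "\<alpha> \<in> carrier E"
  shows "(\<Oplus>j\<in>{..<l}. f (\<gamma> j) \<otimes> phi (e j) \<alpha>) = f \<alpha>"
proof -
  have "f \<alpha> = f (\<Oplus>\<^bsub>E\<^esub>j\<in>{..<l}. E_scale_right (phi (e j) \<alpha>) (\<gamma> j))"
    using right_expand[OF assms(2)] by simp
  also have "\<dots> = (\<Oplus>\<^bsub>R\<^esub>j\<in>{..<l}. f (E_scale_right (phi (e j) \<alpha>) (\<gamma> j)))"
    by (rule additive_map_finsum[OF E_ab R_ab D'_additive[OF assms(1)]]) (simp_all add: assms)
  also have "\<dots> = (\<Oplus>j\<in>{..<l}. f (E_scale_right (phi (e j) \<alpha>) (\<gamma> j)))"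
    by (rule R_finsum) (simp_all add: assms)
  also have "\<dots> = (\<Oplus>j\<in>{..<l}. f (\<gamma> j) \<otimes> phi (e j) \<alpha>)"
    using assms by (intro M.finsum_cong_all) (simp_all add: D'_scale)
  finally show ?thesis by simp
qed

lemma Phi_bij: "bij_betw Phi (carrier B) (carrier D')"
proof (rule bij_betwI')
  fix c d assume cd: "c \<in> carrier B" "d \<in> carrier B"
  show "(Phi c = Phi d) = (c = d)"
  proof
    assume eq: "Phi c = Phi d"
    have "phi c (\<gamma> j) = phi d (\<gamma> j)" if "j < l" for j
      using fun_cong[OF eq, of "\<gamma> j"] that by simp
    then have "(\<Oplus>\<^bsub>XY\<^esub>j\<in>{..<l}. lm (phi c (\<gamma> j)) (e j)) = (\<Oplus>\<^bsub>XY\<^esub>j\<in>{..<l}. lm (phi d (\<gamma> j)) (e j))"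
      using cd by (intro T.XY.finsum_cong_all) simp_all
    then show "c = d" using cd by (simp add: phi_reconstruct)
  qed simp
next
  fix f assume f: "f \<in> carrier D'"
  let ?c = "\<Oplus>\<^bsub>XY\<^esub>j\<in>{..<l}. lm (f (\<gamma> j)) (e j)"
  have c: "?c \<in> carrier B" using f by (intro B_finsum) simp_all
  have "f = Phi ?c"
  proof (rule D'_ext[OF f])
    fix \<alpha> assume \<alpha>: "\<alpha> \<in> carrier E"
    have "phi ?c \<alpha> = (\<Oplus>j\<in>{..<l}. phi (lm (f (\<gamma> j)) (e j)) \<alpha>)"
      by (rule additive_map_finsum[OF XY_ab M_ab phi_additive[OF \<alpha>]]) (simp_all add: f)
    also have "\<dots> = (\<Oplus>j\<in>{..<l}. f (\<gamma> j) \<otimes> phi (e j) \<alpha>)"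
      using f \<alpha> by (intro M.finsum_cong_all) (simp_all add: phi_lm)
    finally show "f \<alpha> = Phi ?c \<alpha>" using f \<alpha> by (simp add: D'_expand)
  qed (simp add: c)
  then show "\<exists>c\<in>carrier B. f = Phi c" using c by blast
qed simp

lemma Phi_plus: "c \<in> carrier B \<Longrightarrow> d \<in> carrier B \<Longrightarrow> Phi (c \<oplus>\<^bsub>XY\<^esub> d) = Phi c \<oplus>\<^bsub>D'\<^esub> Phi d"
  by (auto simp: additive_map_add[OF phi_additive])

text \<open>Both sides are c^1 \<alpha>(c^2 r). Precomposition with t(r) is the right action on the
  right dual, so this makes \<phi> compatible with it.\<close>

lemma phi_rm:
  assumes "c \<in> carrier XY" "r \<in> carrier R" "\<alpha> \<in> carrier E"
  shows "phi c (\<alpha> \<otimes>\<^bsub>E\<^esub> tgt A r) = phi (rm c r) \<alpha>"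
proof -
  have "phi (rm c r) \<alpha> = LM (\<lambda>x y. x \<otimes> \<alpha> (y \<otimes> r)) c"
    unfolding phi_def using assms by (intro lift_rm[OF M_ab]) simp_all
  also have "\<dots> = phi c (\<alpha> \<otimes>\<^bsub>E\<^esub> tgt A r)"
    unfolding phi_def using assms
    by (intro lift_cong_M[OF M_ab balanced_mult]) (simp_all, simp add: E_simps A_src_tgt)
  finally show ?thesis by simp
qed

lemma Phi_rm: "c \<in> carrier B \<Longrightarrow> r \<in> carrier R \<Longrightarrow> Phi (rm c r) = ract D' (Phi c) r"
  unfolding D'_simps by (rule restrict_ext) (simp add: phi_rm)

lemma Phi_lm: "c \<in> carrier B \<Longrightarrow> r \<in> carrier R \<Longrightarrow> Phi (lm r c) = lact D' r (Phi c)"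
  unfolding D'_simps by (rule restrict_ext) (simp add: phi_lm)

text \<open>The transport argument of \<open>C_right_bimod\<close>, now through the multiplicative
  bijection \<phi>.\<close>

lemma C'_right_bimod:
  "tensor_ab R (right_bimod_of C') (right_bimod_of C') = D'.XY"
  "pure_tensor R (right_bimod_of C') (right_bimod_of C') = D'.pt"
proof -
  have st: "src C' r = Phi (pt \<one> r)" "tgt C' r = Phi (pt r \<one>)" if "r \<in> carrier R" for r
    using that by (auto simp: E_simps A_src_tgt)
  have R: "pt \<one> r \<in> carrier B" "pt r \<one> \<in> carrier B" if "r \<in> carrier R" for r
    using that lm_R_B[OF that B_one] rm_R_B[OF that B_one] by simp_all
  have *: "f \<otimes>\<^bsub>C'\<^esub> src C' r = ract D' f r" "f \<otimes>\<^bsub>C'\<^esub> tgt C' r = lact D' r f" if "f \<in> carrier D'" "r \<in> carrier R" for f r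
  proof -
    have "f \<in> Phi ` carrier B" using that(1) Phi_bij by (simp add: bij_betw_def)
    then obtain c where c: "f = Phi c" "c \<in> carrier B" by (rule imageE)
    show "f \<otimes>\<^bsub>C'\<^esub> src C' r = ract D' f r" "f \<otimes>\<^bsub>C'\<^esub> tgt C' r = lact D' r f"
      unfolding st[OF that(2)] c(1) using c R that
      by (simp_all only: Phi_mult[symmetric] Phi_lm[symmetric] Phi_rm[symmetric] B_mult_src B_mult_tgt)
  qed
  show "tensor_ab R (right_bimod_of C') (right_bimod_of C') = D'.XY"
    by (rule tensor_cong) (simp_all only: right_bimod_simps * C'_simps(1-3))
  show "pure_tensor R (right_bimod_of C') (right_bimod_of C') = D'.pt"
    by (rule tensor_cong) (simp_all only: right_bimod_simps * C'_simps(1-3))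
qed

section \<open>Tensors over the right dual and its coproduct\<close>

lemma E_tgt:
  assumes "a \<in> carrier E" "r \<in> carrier R" "s \<in> carrier R"
  shows "a \<otimes>\<^bsub>E\<^esub> tgt A (r \<oplus> s) = (a \<otimes>\<^bsub>E\<^esub> tgt A r) \<oplus>\<^bsub>E\<^esub> (a \<otimes>\<^bsub>E\<^esub> tgt A s)"
    "(a \<otimes>\<^bsub>E\<^esub> tgt A r) \<otimes>\<^bsub>E\<^esub> tgt A s = a \<otimes>\<^bsub>E\<^esub> tgt A (s \<otimes> r)"
  using assms by (auto simp: E_simps A_src_tgt M.r_distr E_add M.m_assoc)

text \<open>The order reversal in \<open>E_tgt\<close> makes both placements of a scalar r give f(a
  t(r g(a'))) at the argument a.\<close>

lemma balanced_D'_contract: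
  assumes "a' \<in> carrier E"
  shows "D'.balanced D' (\<lambda>f g. ract D' f (g a'))"
  by (rule D'.balancedI; unfold D'_simps) (use assms in \<open>auto simp: D'_add E_tgt\<close>)

text \<open>Here the second leg is paired with \<open>a'\<close> and the first survives, because the
  coproduct equation of the right dual lets the value of the second leg act on the first from the
  right.\<close>

definition D'_contract :: "('m \<Rightarrow> 'm) \<Rightarrow> (('m \<Rightarrow> 'm) \<Rightarrow> 'm, ('m \<Rightarrow> 'm) \<Rightarrow> 'm) tens \<Rightarrow> ('m \<Rightarrow> 'm) \<Rightarrow> 'm" where
  "D'_contract a' = tensor_lift R D' D' D' (\<lambda>f g. ract D' f (g a'))"

lemma D'_contract_additive: "a' \<in> carrier E \<Longrightarrow> additive_map D'.XY D' (D'_contract a')"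
  unfolding D'_contract_def by (rule D'.lift_additive[OF D'_ab balanced_D'_contract])

lemma D'_contract_pure: "a' \<in> carrier E \<Longrightarrow> f \<in> carrier D' \<Longrightarrow> g \<in> carrier D' \<Longrightarrow>
    D'_contract a' (D'.pt f g) = ract D' f (g a')"
  unfolding D'_contract_def by (rule D'.lift_pure[OF D'_ab balanced_D'_contract])

lemma D'_eval_additive: "a \<in> carrier E \<Longrightarrow> additive_map D' R (\<lambda>f. f a)"
  by (simp add: additive_map_def)

lemma D'_contract_apply:
  assumes "a \<in> carrier E" "a' \<in> carrier E" "z \<in> carrier D'.XY"
  shows "D'_contract a' z a = tensor_lift R D' D' R (\<lambda>f g. (ract D' f (g a')) a) z"
  unfolding D'_contract_def
  by (rule D'.lift_comp[OF D'_ab balanced_D'_contract[OF assms(2)] R_ab D'_eval_additive[OF assms(1)] assms(3)])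

text \<open>The dual basis \<phi>(e_j), \<gamma>_j expands the second leg g of a pure tensor; the
  scalars g(\<gamma>_j) cross the tensor sign to the first leg, where they form the
  contraction.\<close>

lemma D'_tensor_expand:
  assumes "z \<in> carrier D'.XY"
  shows "(\<Oplus>\<^bsub>D'.XY\<^esub>j\<in>{..<l}. D'.pt (D'_contract (\<gamma> j) z) (Phi (e j))) = z"
proof (rule D'.tensor_hom_ext[OF _ _ _ assms, where g = "\<lambda>z. z"])
  have pr: "additive_map D' D'.XY (D'.pt f)" if "f \<in> carrier D'" for f
    using that by (simp add: additive_map_def D'.pure_add_right del: D'_simps)
  have pl: "additive_map D' D'.XY (\<lambda>f. D'.pt f g)" if "g \<in> carrier D'" for g
    using that by (simp add: additive_map_def D'.pure_add_left del: D'_simps)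
  show "additive_map D'.XY D'.XY
     (\<lambda>z. \<Oplus>\<^bsub>D'.XY\<^esub>j\<in>{..<l}. D'.pt (D'_contract (\<gamma> j) z) (Phi (e j)))"
    by (intro additive_map_sum D'.XY.abelian_group_axioms additive_map_compose[OF D'_contract_additive pl]) auto
  show "additive_map D'.XY D'.XY (\<lambda>z. z)"
    by (simp add: additive_map_def)
  fix f g assume f: "f \<in> carrier D'" and g: "g \<in> carrier D'"
  have s: "(\<Oplus>\<^bsub>D'\<^esub>j\<in>{..<l}. lact D' (g (\<gamma> j)) (Phi (e j))) = g"
  proof (rule D'_ext[OF _ g])
    show "(\<Oplus>\<^bsub>D'\<^esub>j\<in>{..<l}. lact D' (g (\<gamma> j)) (Phi (e j))) \<in> carrier D'"
      using g by (intro D'.X.finsum_closed Pi_I D'.lact_closed) simp_all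
    fix a assume a: "a \<in> carrier E"
    have "(\<Oplus>\<^bsub>D'\<^esub>j\<in>{..<l}. lact D' (g (\<gamma> j)) (Phi (e j))) a = (\<Oplus>\<^bsub>R\<^esub>j\<in>{..<l}. (lact D' (g (\<gamma> j)) (Phi (e j))) a)"
      by (rule additive_map_finsum[OF D'_ab R_ab D'_eval_additive[OF a]]) (use g in \<open>auto intro!: D'.lact_closed simp del: D'_simps\<close>)
    also have "\<dots> = (\<Oplus>j\<in>{..<l}. (lact D' (g (\<gamma> j)) (Phi (e j))) a)"
      by (rule R_finsum) (use g a in auto)
    also have "\<dots> = (\<Oplus>j\<in>{..<l}. g (\<gamma> j) \<otimes> phi (e j) a)"
      using g a by (intro M.finsum_cong_all) auto
    finally show "(\<Oplus>\<^bsub>D'\<^esub>j\<in>{..<l}. lact D' (g (\<gamma> j)) (Phi (e j))) a = g a"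
      using g a by (simp add: D'_expand)
  qed
  have "(\<Oplus>\<^bsub>D'.XY\<^esub>j\<in>{..<l}. D'.pt (D'_contract (\<gamma> j) (D'.pt f g)) (Phi (e j))) =
     (\<Oplus>\<^bsub>D'.XY\<^esub>j\<in>{..<l}. D'.pt f (lact D' (g (\<gamma> j)) (Phi (e j))))"
  proof (rule D'.XY.finsum_cong_all)
    fix j assume j: "j \<in> {..<l}"
    then show "D'.pt (D'_contract (\<gamma> j) (D'.pt f g)) (Phi (e j)) = D'.pt f (lact D' (g (\<gamma> j)) (Phi (e j)))"
      using f g by (subst D'.pure_balanced[symmetric]) (simp_all add: D'_contract_pure del: D'_simps)
    show "D'.pt f (lact D' (g (\<gamma> j)) (Phi (e j))) \<in> carrier D'.XY"
      using j f g by (intro D'.pure_closed D'.lact_closed) auto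
  qed
  also have "\<dots> = D'.pt f (\<Oplus>\<^bsub>D'\<^esub>j\<in>{..<l}. lact D' (g (\<gamma> j)) (Phi (e j)))"
    by (rule additive_map_finsum[OF D'_ab D'.XY.abelian_group_axioms pr[OF f], symmetric])
       (use g in \<open>auto intro!: D'.lact_closed simp del: D'_simps\<close>)
  finally show "(\<Oplus>\<^bsub>D'.XY\<^esub>j\<in>{..<l}. D'.pt (D'_contract (\<gamma> j) (D'.pt f g)) (Phi (e j))) = D'.pt f g"
    unfolding s .
qed

lemma D'_tensor_eqI:
  assumes "z \<in> carrier D'.XY" "w \<in> carrier D'.XY"
    and "\<And>a a'. a \<in> carrier E \<Longrightarrow> a' \<in> carrier E \<Longrightarrow>
      tensor_lift R D' D' R (\<lambda>f g. (ract D' f (g a')) a) z = tensor_lift R D' D' R (\<lambda>f g. (ract D' f (g a')) a) w"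
  shows "z = w"
proof -
  have "D'_contract a' z = D'_contract a' w" if "a' \<in> carrier E" for a'
    by (rule D'_ext) (use assms that in \<open>simp_all add: additive_map_closed[OF D'_contract_additive] D'_contract_apply del: D'_simps\<close>)
  then have "(\<Oplus>\<^bsub>D'.XY\<^esub>j\<in>{..<l}. D'.pt (D'_contract (\<gamma> j) z) (Phi (e j))) =
    (\<Oplus>\<^bsub>D'.XY\<^esub>j\<in>{..<l}. D'.pt (D'_contract (\<gamma> j) w) (Phi (e j)))"
    using assms(2) by (intro D'.XY.finsum_cong_all D'.pure_closed)
      (simp_all add: additive_map_closed[OF D'_contract_additive])
  then show ?thesis using assms(1,2) by (simp add: D'_tensor_expand)
qed

lemma Phi_coprod_eq:
  assumes "c \<in> carrier B"
  shows "tensor_lift R BR BR D'.XY (\<lambda>x y. D'.pt (Phi x) (Phi y)) (coprod BB c) =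
    (\<Oplus>\<^bsub>D'.XY\<^esub>i\<in>{..<k}. D'.pt (Phi (b i)) (Phi (bcop c i)))"
  unfolding BB_coprod
proof (rule BR.lift_sum[OF D'.XY.abelian_group_axioms])
  have add: "additive_map BR D' Phi"
    using Phi_plus by (intro additive_mapI) (simp_all del: D'_simps)
  show "BR.balanced D'.XY (\<lambda>x y. D'.pt (Phi x) (Phi y))"
    using Phi_rm Phi_lm
    by (intro BR.balanced_pure_map D'.tensor_pair_axioms add) (simp_all del: D'_simps)
qed (simp_all add: assms)

text \<open>The scalar \<beta>_i(c^1) a'(c^2) from the second leg of the coproduct multiplies b_i on
  the right, so the left quasibasis acts before \<phi> is taken: \<open>quasibasis_expand\<close>
  yields c^1 \<otimes> a'(c^2), and pairing it with a gives c^1 a(a'(c^2)).\<close>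

lemma phi_coprod_sum:
  assumes "c \<in> carrier B" "a \<in> carrier E" "a' \<in> carrier E"
  shows "(\<Oplus>i\<in>{..<k}. phi (b i) (a \<otimes>\<^bsub>E\<^esub> tgt A (phi (bcop c i) a'))) = phi c (a \<otimes>\<^bsub>E\<^esub> a')"
proof -
  let ?r = "\<lambda>i. phi (bcop c i) a'"
  have "(\<Oplus>i\<in>{..<k}. phi (b i) (a \<otimes>\<^bsub>E\<^esub> tgt A (?r i))) = (\<Oplus>i\<in>{..<k}. phi (rm (b i) (?r i)) a)"
    using assms by (intro M.finsum_cong_all) (simp_all add: phi_rm)
  also have "\<dots> = phi (\<Oplus>\<^bsub>XY\<^esub>i\<in>{..<k}. rm (b i) (?r i)) a"
    by (rule additive_map_finsum[OF XY_ab M_ab phi_additive, symmetric]) (simp_all add: assms)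
  also have "(\<Oplus>\<^bsub>XY\<^esub>i\<in>{..<k}. rm (b i) (?r i)) = (\<Oplus>\<^bsub>XY\<^esub>i\<in>{..<k}. rm (b i) (LM (\<lambda>x y. \<beta> i x \<otimes> a' y) c))"
    using assms by (intro T.XY.finsum_cong_all) (simp_all add: bcop_phi[symmetric])
  also have "\<dots> = LT (\<lambda>x y. pt x (a' y)) c"
    using assms by (intro quasibasis_expand) simp_all
  also have "phi \<dots> a = LM (\<lambda>x y. phi (pt x (a' y)) a) c"
    using assms by (intro T.lift_comp[OF XY_ab balanced_pt M_ab phi_additive]) simp_all
  also have "\<dots> = phi c (a \<otimes>\<^bsub>E\<^esub> a')"
    unfolding phi_def[of c] using assms
    by (intro lift_cong_M[OF M_ab balanced_mult]) (simp_all, simp add: E_simps)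
  finally show ?thesis .
qed

text \<open>As for \<psi>: \<open>phi_coprod_sum\<close> shows that the image of the coproduct of
  \<open>B\<close> solves the defining equations, and \<open>D'_tensor_eqI\<close> that the solution
  is unique.\<close>

lemma Phi_coprod:
  assumes "c \<in> carrier B"
  shows "coprod C' (Phi c) =
    tensor_lift R BR BR D'.XY (\<lambda>x y. D'.pt (Phi x) (Phi y)) (coprod BB c)"
proof -
  let ?z = "\<Oplus>\<^bsub>D'.XY\<^esub>i\<in>{..<k}. D'.pt (Phi (b i)) (Phi (bcop c i))"
  have z: "?z \<in> carrier D'.XY"
    using assms by (intro D'.XY.finsum_closed) auto
  have bal: "D'.balanced R (\<lambda>f g. (ract D' f (g a')) a)" if "a \<in> carrier E" "a' \<in> carrier E" for a a'
    by (rule D'.balanced_comp[OF balanced_D'_contract D'_eval_additive]) (use that in auto)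
  have ev: "tensor_lift R D' D' R (\<lambda>f g. (ract D' f (g a')) a) ?z = Phi c (a \<otimes>\<^bsub>E\<^esub> a')"
    if a: "a \<in> carrier E" "a' \<in> carrier E" for a a'
  proof -
    have "tensor_lift R D' D' R (\<lambda>f g. (ract D' f (g a')) a) ?z =
       (\<Oplus>\<^bsub>R\<^esub>i\<in>{..<k}. (ract D' (Phi (b i)) (Phi (bcop c i) a')) a)"
      using assms by (intro D'.lift_sum[OF R_ab bal[OF a]]) simp_all
    also have "\<dots> = (\<Oplus>i\<in>{..<k}. (ract D' (Phi (b i)) (Phi (bcop c i) a')) a)"
      using assms a by (intro R_finsum) auto
    also have "\<dots> = (\<Oplus>i\<in>{..<k}. phi (b i) (a \<otimes>\<^bsub>E\<^esub> tgt A (phi (bcop c i) a')))"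
      using assms a by (intro M.finsum_cong_all) auto
    finally show ?thesis using assms a by (simp add: phi_coprod_sum)
  qed
  have "coprod C' (Phi c) = (THE z. z \<in> carrier D'.XY \<and>
        (\<forall>a\<in>carrier E. \<forall>a'\<in>carrier E.
           tensor_lift R D' D' R (\<lambda>f g. (ract D' f (g a')) a) z = Phi c (a \<otimes>\<^bsub>E\<^esub> a')))"
    by (simp only: right_dual_def Let_def bialgebroid.simps A_simps)
  also have "\<dots> = ?z"
  proof (rule the_equality)
    show "?z \<in> carrier D'.XY \<and> (\<forall>a\<in>carrier E. \<forall>a'\<in>carrier E.
           tensor_lift R D' D' R (\<lambda>f g. (ract D' f (g a')) a) ?z = Phi c (a \<otimes>\<^bsub>E\<^esub> a'))"
      using z ev by blast
    fix w assume w: "w \<in> carrier D'.XY \<and> (\<forall>a\<in>carrier E. \<forall>a'\<in>carrier E.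
           tensor_lift R D' D' R (\<lambda>f g. (ract D' f (g a')) a) w = Phi c (a \<otimes>\<^bsub>E\<^esub> a'))"
    show "w = ?z"
    proof (rule D'_tensor_eqI[OF conjunct1[OF w] z])
      fix a a' assume a: "a \<in> carrier E" "a' \<in> carrier E"
      show "tensor_lift R D' D' R (\<lambda>f g. (ract D' f (g a')) a) w = tensor_lift R D' D' R (\<lambda>f g. (ract D' f (g a')) a) ?z"
        unfolding ev[OF a] by (rule conjunct2[OF w, rule_format, OF a])
    qed
  qed
  finally show ?thesis using Phi_coprod_eq[OF assms] by simp
qed

lemma Phi_iso: "right_bialgebroid_iso R BB C' Phi"
  unfolding right_bialgebroid_iso_def
proof (intro conjI ballI)
  show "Phi \<in> ring_iso BB C'"
    unfolding ring_iso_def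
  proof (intro CollectI conjI ring_hom_memI)
    show "bij_betw Phi (carrier BB) (carrier C')" using Phi_bij by simp
    show "Phi \<one>\<^bsub>BB\<^esub> = \<one>\<^bsub>C'\<^esub>" by auto
  qed (simp_all only: BB_simps C'_simps Phi_mult Phi_plus Phi_D)
next
  fix c assume "c \<in> carrier BB"
  then have c: "c \<in> carrier B" by simp
  show "coprod C' (Phi c) = tensor_lift R BR BR (tensor_ab R (right_bimod_of C') (right_bimod_of C'))
       (\<lambda>x y. pure_tensor R (right_bimod_of C') (right_bimod_of C') (Phi x) (Phi y)) (coprod BB c)"
    unfolding C'_right_bimod by (rule Phi_coprod[OF c])
  have "phi c \<one>\<^bsub>E\<^esub> = LM (\<lambda>x y. x \<otimes> y) c"
    unfolding phi_def using c by (intro lift_cong_M[OF M_ab]) (simp_all, simp add: E_simps)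
  then show "counit C' (Phi c) = counit BB c" by (simp add: BB_counit)
qed (auto simp: E_simps A_src_tgt)

end

section \<open>Existence of quasibases\<close>

text \<open>f is the given isomorphism onto \<open>U\<close> followed by inclusion, and g is the
  projection onto \<open>U\<close> along a complement followed by the inverse of f. Only this
  splitting is used later.\<close>

lemma direct_summand_retraction:
  assumes Y: "abelian_group Y"
    and lact_Y: "\<And>l. l \<in> carrier L \<Longrightarrow> additive_map Y Y (lact Y l)"
    and ract_Y: "\<And>r. r \<in> carrier K \<Longrightarrow> additive_map Y Y (\<lambda>y. ract Y y r)"
    and lact_X: "\<And>l x. l \<in> carrier L \<Longrightarrow> x \<in> carrier X \<Longrightarrow> lact X l x \<in> carrier X"
    and ract_X: "\<And>r x. r \<in> carrier K \<Longrightarrow> x \<in> carrier X \<Longrightarrow> ract X x r \<in> carrier X"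
    and add_X: "\<And>x y. x \<in> carrier X \<Longrightarrow> y \<in> carrier X \<Longrightarrow> x \<oplus>\<^bsub>X\<^esub> y \<in> carrier X"
    and iso: "iso_to_direct_summand L K X Y"
  obtains f g where "f \<in> bimod_hom L K X Y" "g \<in> bimod_hom L K Y X"
    "\<And>x. x \<in> carrier X \<Longrightarrow> g (f x) = x"
proof -
  interpret Y: abelian_group Y by fact
  obtain U V f where UV: "subbimodule L K U Y" "subbimodule L K V Y" "U <+>\<^bsub>Y\<^esub> V = carrier Y" "U \<inter> V = {\<zero>\<^bsub>Y\<^esub>}"
    and f: "f \<in> bimod_hom L K X (Y\<lparr>carrier := U\<rparr>)" "bij_betw f (carrier X) U"
    using iso by (auto simp: iso_to_direct_summand_def direct_summand_def bimod_isomorphic_def)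
  have sub: "subgroup U (add_monoid Y)" "subgroup V (add_monoid Y)"
    using UV(1,2) by (simp_all add: subbimodule_def additive_subgroup_def)
  have U: "u \<in> carrier Y" if "u \<in> U" for u using subgroup.mem_carrier[OF sub(1) that] by simp
  have V: "v \<in> carrier Y" if "v \<in> V" for v using subgroup.mem_carrier[OF sub(2) that] by simp
  have cl: "u \<oplus>\<^bsub>Y\<^esub> u' \<in> U" if "u \<in> U" "u' \<in> U" for u u'
    using subgroup.m_closed[OF sub(1) that] by simp
  have clV: "u \<oplus>\<^bsub>Y\<^esub> u' \<in> V" if "u \<in> V" "u' \<in> V" for u u'
    using subgroup.m_closed[OF sub(2) that] by simp
  have mi: "\<ominus>\<^bsub>Y\<^esub> u \<in> U" if "u \<in> U" for u
    using subgroup.m_inv_closed[OF sub(1) that] by (simp add: a_inv_def)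
  have miV: "\<ominus>\<^bsub>Y\<^esub> u \<in> V" if "u \<in> V" for u
    using subgroup.m_inv_closed[OF sub(2) that] by (simp add: a_inv_def)
  have zeroU: "\<zero>\<^bsub>Y\<^esub> \<in> U" and zeroV: "\<zero>\<^bsub>Y\<^esub> \<in> V" using UV(4) by auto
  have dec: "\<exists>u v. u \<in> U \<and> v \<in> V \<and> y = u \<oplus>\<^bsub>Y\<^esub> v" if "y \<in> carrier Y" for y
  proof -
    have "y \<in> U <+>\<^bsub>Y\<^esub> V" using that UV(3) by simp
    then show ?thesis by (auto simp: set_add_def set_mult_def)
  qed
  \<comment> \<open>Two decompositions of the same element have U-parts whose difference also lies
    in V, hence vanishes.\<close>
  have uniq: "u = u'" if "u \<in> U" "u' \<in> U" "v \<in> V" "v' \<in> V" "u \<oplus>\<^bsub>Y\<^esub> v = u' \<oplus>\<^bsub>Y\<^esub> v'" for u u' v v'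
  proof -
    have c: "u \<in> carrier Y" "u' \<in> carrier Y" "v \<in> carrier Y" "v' \<in> carrier Y" using that U V by auto
    have "\<ominus>\<^bsub>Y\<^esub> u' \<oplus>\<^bsub>Y\<^esub> u = \<ominus>\<^bsub>Y\<^esub> u' \<oplus>\<^bsub>Y\<^esub> (u \<oplus>\<^bsub>Y\<^esub> v) \<oplus>\<^bsub>Y\<^esub> \<ominus>\<^bsub>Y\<^esub> v"
      using c by (simp add: Y.a_assoc Y.r_neg)
    also have "\<dots> = v' \<oplus>\<^bsub>Y\<^esub> \<ominus>\<^bsub>Y\<^esub> v"
      unfolding that(5) using c by (simp add: Y.a_assoc[symmetric] Y.l_neg)
    finally have "\<ominus>\<^bsub>Y\<^esub> u' \<oplus>\<^bsub>Y\<^esub> u \<in> U \<inter> V"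
      using that cl mi clV miV by (metis IntI)
    then have "\<ominus>\<^bsub>Y\<^esub> u' \<oplus>\<^bsub>Y\<^esub> u = \<zero>\<^bsub>Y\<^esub>" using UV(4) by auto
    then show "u = u'" using c
      by (metis Y.a_inv_closed Y.minus_equality Y.minus_minus Y.a_comm)
  qed
  \<comment> \<open>The projection onto U along V.\<close>
  define p where "p y = (THE u. u \<in> U \<and> (\<exists>v\<in>V. y = u \<oplus>\<^bsub>Y\<^esub> v))" for y
  have p: "p (u \<oplus>\<^bsub>Y\<^esub> v) = u" if "u \<in> U" "v \<in> V" for u v
    unfolding p_def by (rule the_equality) (use that uniq in blast)+
  have pU: "p u = u" if "u \<in> U" for u using p[OF that zeroV] U[OF that] by simp
  have fX: "f x \<in> U" if "x \<in> carrier X" for x using f(1) that by (auto simp: bimod_hom_def)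
  define g where "g y = inv_into (carrier X) f (p y)" for y
  have gf: "g (f x) = x" if "x \<in> carrier X" for x
    using that fX f(2) by (simp add: g_def pU bij_betw_def)
  have surj: "\<exists>x\<in>carrier X. u = f x" if "u \<in> U" for u using f(2) that by (auto simp: bij_betw_def)
  \<comment> \<open>With every element of Y in the form f x + v, all homomorphism laws for g reduce
    to g (f x + v) = x.\<close>
  have decX: "\<exists>x\<in>carrier X. \<exists>v\<in>V. y = f x \<oplus>\<^bsub>Y\<^esub> v" if "y \<in> carrier Y" for y
    using dec[OF that] surj by metis
  have g: "g (f x \<oplus>\<^bsub>Y\<^esub> v) = x" if "x \<in> carrier X" "v \<in> V" for x v
    using that fX p gf by (simp add: g_def pU)
  have f': "f (x \<oplus>\<^bsub>X\<^esub> x') = f x \<oplus>\<^bsub>Y\<^esub> f x'" "l \<in> carrier L \<Longrightarrow> f (lact X l x) = lact Y l (f x)"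
     "r \<in> carrier K \<Longrightarrow> f (ract X x r) = ract Y (f x) r"
    if "x \<in> carrier X" "x' \<in> carrier X" for x x' l r
    using f(1) that by (auto simp: bimod_hom_def)
  show ?thesis
  proof
    show "f \<in> bimod_hom L K X Y"
      using f(1) U by (auto simp: bimod_hom_def)
    show "g (f x) = x" if "x \<in> carrier X" for x by (rule gf[OF that])
    show "g \<in> bimod_hom L K Y X"
      unfolding bimod_hom_def
    proof (intro CollectI conjI ballI Pi_I)
      fix y assume "y \<in> carrier Y"
      then obtain x v where y: "x \<in> carrier X" "v \<in> V" "y = f x \<oplus>\<^bsub>Y\<^esub> v" using decX by blast
      have fy: "f x \<in> carrier Y" "v \<in> carrier Y" using y fX U V by auto
      show "g y \<in> carrier X" using y g by simp
      show "g (lact Y l y) = lact X l (g y)" if "l \<in> carrier L" for l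
      proof -
        have "lact Y l y = f (lact X l x) \<oplus>\<^bsub>Y\<^esub> lact Y l v"
          using y fy that f' by (simp add: additive_map_add[OF lact_Y])
        moreover have "lact Y l v \<in> V" using UV(2) that y by (simp add: subbimodule_def)
        ultimately show ?thesis using y g that lact_X by simp
      qed
      show "g (ract Y y r) = ract X (g y) r" if "r \<in> carrier K" for r
      proof -
        have "ract Y y r = f (ract X x r) \<oplus>\<^bsub>Y\<^esub> ract Y v r"
          using y fy that f' by (simp add: additive_map_add[OF ract_Y])
        moreover have "ract Y v r \<in> V" using UV(2) that y by (simp add: subbimodule_def)
        ultimately show ?thesis using y g that ract_X by simp
      qed
      fix y' assume "y' \<in> carrier Y"
      then obtain x' v' where y': "x' \<in> carrier X" "v' \<in> V" "y' = f x' \<oplus>\<^bsub>Y\<^esub> v'" using decX by blast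
      have fy': "f x' \<in> carrier Y" "v' \<in> carrier Y" using y' fX U V by auto
      have "y \<oplus>\<^bsub>Y\<^esub> y' = f (x \<oplus>\<^bsub>X\<^esub> x') \<oplus>\<^bsub>Y\<^esub> (v \<oplus>\<^bsub>Y\<^esub> v')"
        using y y' fy fy' f' by (simp add: Y.a_ac)
      then show "g (y \<oplus>\<^bsub>Y\<^esub> y') = g y \<oplus>\<^bsub>X\<^esub> g y'"
        using y y' g add_X clV by simp
    qed
  qed
qed

section \<open>Powers of a bimodule\<close>

lemma bimod_power_simps [simp]:
  "carrier (bimod_power n X) = {..<n} \<rightarrow>\<^sub>E carrier X"
  "\<zero>\<^bsub>bimod_power n X\<^esub> = (\<lambda>i\<in>{..<n}. \<zero>\<^bsub>X\<^esub>)"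
  "u \<oplus>\<^bsub>bimod_power n X\<^esub> v = (\<lambda>i\<in>{..<n}. u i \<oplus>\<^bsub>X\<^esub> v i)"
  "lact (bimod_power n X) l u = (\<lambda>i\<in>{..<n}. lact X l (u i))"
  "ract (bimod_power n X) u r = (\<lambda>i\<in>{..<n}. ract X (u i) r)"
  by (simp_all add: bimod_power_def)

lemma bimod_power_abelian_group:
  assumes "abelian_group X"
  shows "abelian_group (bimod_power n X)"
proof -
  interpret X: abelian_group X by fact
  have mem: "u i \<in> carrier X" if "u \<in> {..<n} \<rightarrow>\<^sub>E carrier X" "i \<in> {..<n}" for u i
    using that by (rule PiE_mem)
  show ?thesis
  proof (rule abelian_groupI; unfold bimod_power_simps)
    fix u v assume u: "u \<in> {..<n} \<rightarrow>\<^sub>E carrier X" and v: "v \<in> {..<n} \<rightarrow>\<^sub>E carrier X"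
    show "(\<lambda>i\<in>{..<n}. u i \<oplus>\<^bsub>X\<^esub> v i) \<in> {..<n} \<rightarrow>\<^sub>E carrier X"
      by (simp add: mem[OF u] mem[OF v])
    show "(\<lambda>i\<in>{..<n}. u i \<oplus>\<^bsub>X\<^esub> v i) = (\<lambda>i\<in>{..<n}. v i \<oplus>\<^bsub>X\<^esub> u i)"
      by (intro restrict_ext X.a_comm mem[OF u] mem[OF v])
    fix w assume w: "w \<in> {..<n} \<rightarrow>\<^sub>E carrier X"
    show "(\<lambda>i\<in>{..<n}. (\<lambda>i\<in>{..<n}. u i \<oplus>\<^bsub>X\<^esub> v i) i \<oplus>\<^bsub>X\<^esub> w i) =
        (\<lambda>i\<in>{..<n}. u i \<oplus>\<^bsub>X\<^esub> (\<lambda>i\<in>{..<n}. v i \<oplus>\<^bsub>X\<^esub> w i) i)"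
      by (intro restrict_ext) (simp add: X.a_assoc mem[OF u] mem[OF v] mem[OF w])
  next
    fix u assume u: "u \<in> {..<n} \<rightarrow>\<^sub>E carrier X"
    show "\<exists>v\<in>{..<n} \<rightarrow>\<^sub>E carrier X. (\<lambda>i\<in>{..<n}. v i \<oplus>\<^bsub>X\<^esub> u i) = (\<lambda>i\<in>{..<n}. \<zero>\<^bsub>X\<^esub>)"
      by (intro bexI[of _ "\<lambda>i\<in>{..<n}. \<ominus>\<^bsub>X\<^esub> u i"] restrict_ext) (simp_all add: mem[OF u] X.l_neg)
    have "(\<lambda>i\<in>{..<n}. (\<lambda>i\<in>{..<n}. \<zero>\<^bsub>X\<^esub>) i \<oplus>\<^bsub>X\<^esub> u i) = restrict u {..<n}"
      by (intro restrict_ext) (simp add: mem[OF u])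
    then show "(\<lambda>i\<in>{..<n}. (\<lambda>i\<in>{..<n}. \<zero>\<^bsub>X\<^esub>) i \<oplus>\<^bsub>X\<^esub> u i) = u"
      using u by (simp add: PiE_def extensional_restrict)
  qed simp
qed

lemma additive_map_bimod_power:
  assumes "additive_map X X h"
  shows "additive_map (bimod_power n X) (bimod_power n X) (\<lambda>u. \<lambda>i\<in>{..<n}. h (u i))"
proof (rule additive_mapI; unfold bimod_power_simps)
  fix u v assume u: "u \<in> {..<n} \<rightarrow>\<^sub>E carrier X" and v: "v \<in> {..<n} \<rightarrow>\<^sub>E carrier X"
  show "(\<lambda>i\<in>{..<n}. h (u i)) \<in> {..<n} \<rightarrow>\<^sub>E carrier X"
    using additive_map_closed[OF assms PiE_mem[OF u]] by simp
  show "(\<lambda>i\<in>{..<n}. h ((\<lambda>i\<in>{..<n}. u i \<oplus>\<^bsub>X\<^esub> v i) i)) =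
      (\<lambda>i\<in>{..<n}. (\<lambda>i\<in>{..<n}. h (u i)) i \<oplus>\<^bsub>X\<^esub> (\<lambda>i\<in>{..<n}. h (v i)) i)"
    by (intro restrict_ext) (simp add: additive_map_add[OF assms] PiE_mem[OF u] PiE_mem[OF v])
qed

text \<open>Decomposition into coordinate vectors, which allows an additive map out of the power to
  be computed one coordinate at a time.\<close>

lemma bimod_power_expand:
  assumes "abelian_group X" "u \<in> carrier (bimod_power n X)"
  shows "(\<Oplus>\<^bsub>bimod_power n X\<^esub>i\<in>{..<n}. (\<lambda>j\<in>{..<n}. if j = i then u i else \<zero>\<^bsub>X\<^esub>)) = u"
proof -
  interpret X: abelian_group X by fact
  interpret P: abelian_group "bimod_power n X" by (rule bimod_power_abelian_group[OF assms(1)])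
  have mem: "u i \<in> carrier X" if "i < n" for i using assms(2) that by auto
  have c: "(\<lambda>j\<in>{..<n}. if j = i then u i else \<zero>\<^bsub>X\<^esub>) \<in> carrier (bimod_power n X)" if "i \<in> {..<n}" for i
    using that by (auto simp: mem)
  have cs: "(\<Oplus>\<^bsub>bimod_power n X\<^esub>i\<in>{..<n}. (\<lambda>j\<in>{..<n}. if j = i then u i else \<zero>\<^bsub>X\<^esub>)) \<in> carrier (bimod_power n X)"
    using c by (intro P.finsum_closed Pi_I) simp_all
  show ?thesis
  proof (rule PiE_ext)
    show "(\<Oplus>\<^bsub>bimod_power n X\<^esub>i\<in>{..<n}. (\<lambda>j\<in>{..<n}. if j = i then u i else \<zero>\<^bsub>X\<^esub>)) \<in> {..<n} \<rightarrow>\<^sub>E carrier X"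
      using cs by simp
    show "u \<in> {..<n} \<rightarrow>\<^sub>E carrier X" using assms(2) by simp
    fix j assume j: "j \<in> {..<n}"
    have ev: "additive_map (bimod_power n X) X (\<lambda>u. u j)"
      using j by (auto simp: additive_map_def)
    have "(\<Oplus>\<^bsub>bimod_power n X\<^esub>i\<in>{..<n}. (\<lambda>j\<in>{..<n}. if j = i then u i else \<zero>\<^bsub>X\<^esub>)) j =
       (\<Oplus>\<^bsub>X\<^esub>i\<in>{..<n}. (\<lambda>j\<in>{..<n}. if j = i then u i else \<zero>\<^bsub>X\<^esub>) j)"
      by (rule additive_map_finsum[OF P.abelian_group_axioms assms(1) ev _ c]) simp_all
    also have "\<dots> = (\<Oplus>\<^bsub>X\<^esub>i\<in>{..<n}. if j = i then u i else \<zero>\<^bsub>X\<^esub>)"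
      using j by (intro X.finsum_cong_all) (auto simp: mem)
    also have "\<dots> = u j"
      using j by (intro X.finsum_singleton) (auto simp: mem)
    finally show "(\<Oplus>\<^bsub>bimod_power n X\<^esub>i\<in>{..<n}. (\<lambda>j\<in>{..<n}. if j = i then u i else \<zero>\<^bsub>X\<^esub>)) j = u j" .
  qed
qed

lemma bimod_hom_additive: "f \<in> bimod_hom L K X Y \<Longrightarrow> additive_map X Y f"
  by (auto simp: bimod_hom_def additive_map_def)

lemma bimod_hom_lact: "f \<in> bimod_hom L K X Y \<Longrightarrow> l \<in> carrier L \<Longrightarrow> x \<in> carrier X \<Longrightarrow> f (lact X l x) = lact Y l (f x)"
  by (simp add: bimod_hom_def)

lemma bimod_hom_ract: "f \<in> bimod_hom L K X Y \<Longrightarrow> r \<in> carrier K \<Longrightarrow> x \<in> carrier X \<Longrightarrow> f (ract X x r) = ract Y (f x) r"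
  by (simp add: bimod_hom_def)

section \<open>Quasibases from the two direct summand conditions\<close>

context ring_ext
begin

text \<open>An \<open>N\<close>-\<open>M\<close>-bimodule map from \<open>M\<close> to the tensor
  square has the form m \<mapsto> c m with c central, and one in the opposite direction the form x
  \<otimes> y \<mapsto> \<beta>(x) y with \<beta> an \<open>N\<close>-\<open>N\<close>-endomorphism.
  Written in these coordinates, a retraction through a power of \<open>M\<close> evaluated at m
  \<otimes> 1 is the quasibasis identity.\<close>

lemma left_quasibasis_exists:
  assumes "iso_to_direct_summand N M (restrict_scalars \<eta> id (MM N M \<eta>)) (bimod_power n (N_M M \<eta>))"
  shows "\<exists>b \<beta>. left_D2_quasibasis N M \<eta> n b \<beta>"
proof -
  define X where "X = restrict_scalars \<eta> id (MM N M \<eta>)"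
  define Y where "Y = bimod_power n NM"
  have X: "carrier X = carrier XY" "add X = add XY" "\<zero>\<^bsub>X\<^esub> = \<zero>\<^bsub>XY\<^esub>"
    "\<And>l z. lact X l z = lm (\<eta> l) z" "\<And>z m. ract X z m = rm z m"
    by (simp_all add: X_def lm_def rm_def MN_def NM_def)
  have Y_ab: "abelian_group Y" unfolding Y_def by (rule bimod_power_abelian_group[OF T.Y.abelian_group_axioms])
  have X_ab: "abelian_group X" by (rule abelian_group_eqI[OF XY_ab X(1-3)])
  have Y: "carrier Y = {..<n} \<rightarrow>\<^sub>E carrier M" by (simp add: Y_def)
  obtain f g where f: "f \<in> bimod_hom N M X Y" and g: "g \<in> bimod_hom N M Y X"
    and gf: "\<And>x. x \<in> carrier X \<Longrightarrow> g (f x) = x"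
  proof (rule direct_summand_retraction[OF Y_ab])
    show "iso_to_direct_summand N M X Y" using assms by (simp add: X_def Y_def NM_def)
    show "additive_map Y Y (lact Y l)" if "l \<in> carrier N" for l
      using that unfolding Y_def bimod_power_simps
      by (intro additive_map_bimod_power) (simp add: additive_map_def M.r_distr)
    show "additive_map Y Y (\<lambda>y. ract Y y r)" if "r \<in> carrier M" for r
      using that unfolding Y_def bimod_power_simps
      by (intro additive_map_bimod_power) (simp add: additive_map_def M.l_distr)
  qed (simp_all add: X)
  define u where "u i m = (\<lambda>j\<in>{..<n}. if j = i then m else \<zero>)" for i :: nat and m
  have uY: "u i m \<in> carrier Y" if "m \<in> carrier M" for i m
    using that by (auto simp: u_def Y)
  \<comment> \<open>Right \<open>M\<close>-linearity determines g on the i-th coordinate by its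
    value on the i-th unit vector.\<close>
  define b where "b i = g (u i \<one>)" for i
  \<comment> \<open>The i-th coordinate of f is right \<open>M\<close>-linear, so its values at m
    \<otimes> 1 determine it.\<close>
  define \<beta> where "\<beta> i = (\<lambda>m\<in>carrier M. f (pt m \<one>) i)" for i
  have fM: "f z i \<in> carrier M" if "z \<in> carrier XY" "i < n" for z i
    using additive_map_closed[OF bimod_hom_additive[OF f], of z] that by (auto simp: X Y)
  have f_add: "f (z \<oplus>\<^bsub>XY\<^esub> w) i = f z i \<oplus> f w i" if "z \<in> carrier XY" "w \<in> carrier XY" "i < n" for z w i
    using additive_map_add[OF bimod_hom_additive[OF f], of z w] that by (simp add: X Y_def)
  have f_lm: "f (lm (\<eta> a) z) i = \<eta> a \<otimes> f z i" if "z \<in> carrier XY" "a \<in> carrier N" "i < n" for z a i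
    using bimod_hom_lact[OF f, of a z] that by (simp add: X Y_def)
  have f_rm: "f (rm z a) i = f z i \<otimes> a" if "z \<in> carrier XY" "a \<in> carrier M" "i < n" for z a i
    using bimod_hom_ract[OF f, of a z] that by (simp add: X Y_def)
  have g_XY: "g y \<in> carrier XY" if "y \<in> carrier Y" for y
    using additive_map_closed[OF bimod_hom_additive[OF g] that] by (simp add: X)
  have u_rm: "rm (b i) m = g (u i m)" if "m \<in> carrier M" for i m
  proof -
    have "ract Y (u i \<one>) m = u i m"
      using that by (auto simp: Y_def u_def intro!: restrict_ext)
    then show ?thesis using bimod_hom_ract[OF g that uY[of \<one> i]] by (simp add: X b_def)
  qed
  have u_lm: "lm (\<eta> a) (b i) = g (u i (\<eta> a))" if "a \<in> carrier N" for i a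
  proof -
    have "lact Y a (u i \<one>) = u i (\<eta> a)"
      using that by (auto simp: Y_def u_def intro!: restrict_ext)
    then show ?thesis using bimod_hom_lact[OF g that uY[of \<one> i]] by (simp add: X b_def)
  qed
  \<comment> \<open>Both actions of \<eta> a on the i-th unit vector put \<eta> a into coordinate i,
    so its image under g is central over \<open>N\<close>.\<close>
  have b: "b i \<in> carrier B" for i
    unfolding B_iff by (simp add: u_lm u_rm) (simp add: b_def g_XY uY)
  have beta: "\<beta> i \<in> carrier E" if i: "i < n" for i
    unfolding \<beta>_def
  proof (rule E_restrictI)
    have ad: "additive_map M M (\<lambda>m. f (pt m \<one>) i)"
      using i by (simp add: additive_map_def fM f_add pt_add_left)
    have "f (pt (m \<otimes> \<eta> a) \<one>) i = f (pt m \<one>) i \<otimes> \<eta> a" if "m \<in> carrier M" "a \<in> carrier N" for m a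
      using that i f_rm[of "pt m \<one>" "\<eta> a" i] by (simp add: pt_eta)
    then show "right_linear (\<lambda>m. f (pt m \<one>) i)" using ad by (simp add: right_linear_def)
    have "f (pt (\<eta> a \<otimes> m) \<one>) i = \<eta> a \<otimes> f (pt m \<one>) i" if "m \<in> carrier M" "a \<in> carrier N" for m a
      using that i f_lm[of "pt m \<one>" a i] by simp
    then show "left_linear (\<lambda>m. f (pt m \<one>) i)" using ad by (simp add: left_linear_def)
  qed
  have "(\<Oplus>\<^bsub>XY\<^esub>i\<in>{..<n}. rm (b i) (\<beta> i m)) = pt m \<one>" if m: "m \<in> carrier M" for m
  proof -
    let ?w = "f (pt m \<one>)"
    have w: "?w \<in> carrier Y"
      using additive_map_closed[OF bimod_hom_additive[OF f], of "pt m \<one>"] m by (simp add: X)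
    have "(\<Oplus>\<^bsub>XY\<^esub>i\<in>{..<n}. rm (b i) (\<beta> i m)) = (\<Oplus>\<^bsub>XY\<^esub>i\<in>{..<n}. g (u i (?w i)))"
      using m by (intro T.XY.finsum_cong_all) (simp_all add: \<beta>_def u_rm fM g_XY uY)
    also have "\<dots> = (\<Oplus>\<^bsub>X\<^esub>i\<in>{..<n}. g (u i (?w i)))"
      by (rule finsum_eqI) (simp_all add: X)
    also have "\<dots> = g (\<Oplus>\<^bsub>Y\<^esub>i\<in>{..<n}. u i (?w i))"
      by (rule additive_map_finsum[OF Y_ab X_ab bimod_hom_additive[OF g], symmetric]) (use m in \<open>simp_all add: uY fM\<close>)
    also have "(\<Oplus>\<^bsub>Y\<^esub>i\<in>{..<n}. u i (?w i)) = ?w"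
      using bimod_power_expand[OF T.Y.abelian_group_axioms, of ?w n, unfolded NM_simps(2)] w by (simp add: Y_def u_def)
    finally show ?thesis using gf m by (simp add: X)
  qed
  then have "left_D2_quasibasis N M \<eta> n b \<beta>"
    using b beta by (simp add: left_D2_quasibasis_def rm_def MN_def NM_def)
  then show ?thesis by blast
qed

text \<open>With the roles of the sides exchanged, the coordinates of the splitting are m \<mapsto>
  m e_j and x \<otimes> y \<mapsto> x \<gamma>_j(y), and the retraction is evaluated at 1 \<otimes>
  m.\<close>

lemma right_quasibasis_exists:
  assumes "iso_to_direct_summand M N (restrict_scalars id \<eta> (MM N M \<eta>)) (bimod_power n (M_N M \<eta>))"
  shows "\<exists>e \<gamma>. (\<forall>j<n. e j \<in> carrier B) \<and> (\<forall>j<n. \<gamma> j \<in> carrier E) \<and>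
    (\<forall>m\<in>carrier M. (\<Oplus>\<^bsub>XY\<^esub>j\<in>{..<n}. lm (\<gamma> j m) (e j)) = pt \<one> m)"
proof -
  define X where "X = restrict_scalars id \<eta> (MM N M \<eta>)"
  define Y where "Y = bimod_power n MN"
  have X: "carrier X = carrier XY" "add X = add XY" "\<zero>\<^bsub>X\<^esub> = \<zero>\<^bsub>XY\<^esub>"
    "\<And>l z. lact X l z = lm l z" "\<And>z m. ract X z m = rm z (\<eta> m)"
    by (simp_all add: X_def lm_def rm_def MN_def NM_def)
  have Y_ab: "abelian_group Y" unfolding Y_def by (rule bimod_power_abelian_group[OF T.X.abelian_group_axioms])
  have X_ab: "abelian_group X" by (rule abelian_group_eqI[OF XY_ab X(1-3)])
  have Y: "carrier Y = {..<n} \<rightarrow>\<^sub>E carrier M" by (simp add: Y_def)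
  obtain f g where f: "f \<in> bimod_hom M N X Y" and g: "g \<in> bimod_hom M N Y X"
    and gf: "\<And>x. x \<in> carrier X \<Longrightarrow> g (f x) = x"
  proof (rule direct_summand_retraction[OF Y_ab])
    show "iso_to_direct_summand M N X Y" using assms by (simp add: X_def Y_def MN_def)
    show "additive_map Y Y (lact Y l)" if "l \<in> carrier M" for l
      using that unfolding Y_def bimod_power_simps
      by (intro additive_map_bimod_power) (simp add: additive_map_def M.r_distr)
    show "additive_map Y Y (\<lambda>y. ract Y y r)" if "r \<in> carrier N" for r
      using that unfolding Y_def bimod_power_simps
      by (intro additive_map_bimod_power) (simp add: additive_map_def M.l_distr)
  qed (simp_all add: X)
  define u where "u i m = (\<lambda>j\<in>{..<n}. if j = i then m else \<zero>)" for i :: nat and m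
  have uY: "u i m \<in> carrier Y" if "m \<in> carrier M" for i m
    using that by (auto simp: u_def Y)
  define e where "e i = g (u i \<one>)" for i
  define \<gamma> where "\<gamma> i = (\<lambda>m\<in>carrier M. f (pt \<one> m) i)" for i
  have fM: "f z i \<in> carrier M" if "z \<in> carrier XY" "i < n" for z i
    using additive_map_closed[OF bimod_hom_additive[OF f], of z] that by (auto simp: X Y)
  have f_add: "f (z \<oplus>\<^bsub>XY\<^esub> w) i = f z i \<oplus> f w i" if "z \<in> carrier XY" "w \<in> carrier XY" "i < n" for z w i
    using additive_map_add[OF bimod_hom_additive[OF f], of z w] that by (simp add: X Y_def)
  have f_lm: "f (lm a z) i = a \<otimes> f z i" if "z \<in> carrier XY" "a \<in> carrier M" "i < n" for z a i
    using bimod_hom_lact[OF f, of a z] that by (simp add: X Y_def)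
  have f_rm: "f (rm z (\<eta> a)) i = f z i \<otimes> \<eta> a" if "z \<in> carrier XY" "a \<in> carrier N" "i < n" for z a i
    using bimod_hom_ract[OF f, of a z] that by (simp add: X Y_def)
  have g_XY: "g y \<in> carrier XY" if "y \<in> carrier Y" for y
    using additive_map_closed[OF bimod_hom_additive[OF g] that] by (simp add: X)
  have u_lm: "lm m (e i) = g (u i m)" if "m \<in> carrier M" for i m
  proof -
    have "lact Y m (u i \<one>) = u i m"
      using that by (auto simp: Y_def u_def intro!: restrict_ext)
    then show ?thesis using bimod_hom_lact[OF g that uY[of \<one> i]] by (simp add: X e_def)
  qed
  have u_rm: "rm (e i) (\<eta> a) = g (u i (\<eta> a))" if "a \<in> carrier N" for i a
  proof -
    have "ract Y (u i \<one>) a = u i (\<eta> a)"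
      using that by (auto simp: Y_def u_def intro!: restrict_ext)
    then show ?thesis using bimod_hom_ract[OF g that uY[of \<one> i]] by (simp add: X e_def)
  qed
  have e: "e i \<in> carrier B" for i
    unfolding B_iff by (simp add: u_lm u_rm) (simp add: e_def g_XY uY)
  have gamma: "\<gamma> i \<in> carrier E" if i: "i < n" for i
    unfolding \<gamma>_def
  proof (rule E_restrictI)
    have ad: "additive_map M M (\<lambda>m. f (pt \<one> m) i)"
      using i by (simp add: additive_map_def fM f_add pt_add_right)
    have "f (pt \<one> (m \<otimes> \<eta> a)) i = f (pt \<one> m) i \<otimes> \<eta> a" if "m \<in> carrier M" "a \<in> carrier N" for m a
      using that i f_rm[of "pt \<one> m" a i] by simp
    then show "right_linear (\<lambda>m. f (pt \<one> m) i)" using ad by (simp add: right_linear_def)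
    have "f (pt \<one> (\<eta> a \<otimes> m)) i = \<eta> a \<otimes> f (pt \<one> m) i" if "m \<in> carrier M" "a \<in> carrier N" for m a
      using that i f_lm[of "pt \<one> m" "\<eta> a" i] pt_eta[of \<one> m a] by simp
    then show "left_linear (\<lambda>m. f (pt \<one> m) i)" using ad by (simp add: left_linear_def)
  qed
  have "(\<Oplus>\<^bsub>XY\<^esub>i\<in>{..<n}. lm (\<gamma> i m) (e i)) = pt \<one> m" if m: "m \<in> carrier M" for m
  proof -
    let ?w = "f (pt \<one> m)"
    have w: "?w \<in> carrier Y"
      using additive_map_closed[OF bimod_hom_additive[OF f], of "pt \<one> m"] m by (simp add: X)
    have "(\<Oplus>\<^bsub>XY\<^esub>i\<in>{..<n}. lm (\<gamma> i m) (e i)) = (\<Oplus>\<^bsub>XY\<^esub>i\<in>{..<n}. g (u i (?w i)))"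
      using m by (intro T.XY.finsum_cong_all) (simp_all add: \<gamma>_def u_lm fM g_XY uY)
    also have "\<dots> = (\<Oplus>\<^bsub>X\<^esub>i\<in>{..<n}. g (u i (?w i)))"
      by (rule finsum_eqI) (simp_all add: X)
    also have "\<dots> = g (\<Oplus>\<^bsub>Y\<^esub>i\<in>{..<n}. u i (?w i))"
      by (rule additive_map_finsum[OF Y_ab X_ab bimod_hom_additive[OF g], symmetric]) (use m in \<open>simp_all add: uY fM\<close>)
    also have "(\<Oplus>\<^bsub>Y\<^esub>i\<in>{..<n}. u i (?w i)) = ?w"
      using bimod_power_expand[OF T.X.abelian_group_axioms, of ?w n, unfolded MN_simps(2)] w by (simp add: Y_def u_def)
    finally show ?thesis using gf m by (simp add: X)
  qed
  then show ?thesis using e gamma by blast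
qed

end

theorem corollary5p3:
  fixes N :: "('n, 'p) ring_scheme" and M :: "('m, 'q) ring_scheme" and \<eta> :: "'n \<Rightarrow> 'm"
  assumes "D2_extension N M \<eta>"
  shows "(\<exists>k b \<beta>. left_D2_quasibasis N M \<eta> k b \<beta>) \<and>
    (\<forall>k b \<beta>. left_D2_quasibasis N M \<eta> k b \<beta> \<longrightarrow>
      (let R = centralizer_ring N M \<eta>;
           A = D2_left_bialgebroid N M \<eta> k b \<beta>;
           B = D2_right_bialgebroid N M \<eta> k b \<beta>
       in right_bialgebroid_iso R B (right_dual R A)
            (\<lambda>c. \<lambda>\<alpha>\<in>carrier A. MM_lift N M \<eta> M (\<lambda>x y. x \<otimes>\<^bsub>M\<^esub> \<alpha> y) c) \<and>
          right_bialgebroid_iso R B (left_dual R A)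
            (\<lambda>c. \<lambda>\<alpha>\<in>carrier A. MM_lift N M \<eta> M (\<lambda>x y. \<alpha> x \<otimes>\<^bsub>M\<^esub> y) c)))"
proof -
  interpret ring_ext N M \<eta>
    using assms by (simp add: ring_ext_def D2_extension_def)
  obtain n l where
    left: "iso_to_direct_summand N M (restrict_scalars \<eta> id (MM N M \<eta>)) (bimod_power n (N_M M \<eta>))" and
    right: "iso_to_direct_summand M N (restrict_scalars id \<eta> (MM N M \<eta>)) (bimod_power l (M_N M \<eta>))"
    using assms unfolding D2_extension_def by blast
  \<comment> \<open>Chosen before any left quasibasis is fixed, since it depends on the extension
    alone; below it is paired with whichever left quasibasis is given.\<close>
  obtain e \<gamma> where e: "\<And>j. j < l \<Longrightarrow> e j \<in> carrier B" "\<And>j. j < l \<Longrightarrow> \<gamma> j \<in> carrier E"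
    "\<And>m. m \<in> carrier M \<Longrightarrow> (\<Oplus>\<^bsub>XY\<^esub>j\<in>{..<l}. lm (\<gamma> j m) (e j)) = pt \<one>\<^bsub>M\<^esub> m"
    using right_quasibasis_exists[OF right] by blast
  show ?thesis
  proof (intro conjI allI impI)
    show "\<exists>k b \<beta>. left_D2_quasibasis N M \<eta> k b \<beta>"
      using left_quasibasis_exists[OF left] by blast
    fix k b \<beta> assume "left_D2_quasibasis N M \<eta> k b \<beta>"
    then interpret two_quasibases N M \<eta> k b \<beta> l e \<gamma>
      by unfold_locales (use e in auto)
    show "let R = centralizer_ring N M \<eta>;
           A = D2_left_bialgebroid N M \<eta> k b \<beta>;
           B = D2_right_bialgebroid N M \<eta> k b \<beta>
       in right_bialgebroid_iso R B (right_dual R A)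
            (\<lambda>c. \<lambda>\<alpha>\<in>carrier A. MM_lift N M \<eta> M (\<lambda>x y. x \<otimes>\<^bsub>M\<^esub> \<alpha> y) c) \<and>
          right_bialgebroid_iso R B (left_dual R A)
            (\<lambda>c. \<lambda>\<alpha>\<in>carrier A. MM_lift N M \<eta> M (\<lambda>x y. \<alpha> x \<otimes>\<^bsub>M\<^esub> y) c)"
      using Phi_iso Psi_iso unfolding Let_def A_simps(1) phi_def[abs_def] psi_def[abs_def] MN_def NM_def
      by (intro conjI)
  qed
qed

end
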